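(* Let $K>0$, $T>0$, $\sigma>0$ and $\delta\ge 0$ be constants. Let $N$ and $n$ denote the cumulative distribution function and the density of the standard normal law $\mathcal N(0,1)$. Assume that the interest rate is the deterministic function $$r(t)=\frac{n\left(\sqrt{(2\delta+\sigma^2)(T-t)}\right)}{1+\frac{2\sigma}{\sqrt{2\delta+\sigma^2}}\left(N\left(\sqrt{(2\delta+\sigma^2)(T-t)}\right)-\frac12\right)}\cdot\frac{\sigma}{\sqrt{T-t}}+\delta+\frac{\sigma^2}{2},\qquad t\in[0,T),$$ that the asset price satisfies $dX_t=(r(t)-\delta)X_t\,dt+\sigma X_t\,dW_t$ under the risk-neutral measure $\mathsf Q$, and consider the American put option with strike $K$ and maturity $T$, with value function $$V(t,x)=\sup_{t\le\tau\le T}\mathsf E_{t,x}\left[e^{-\int_t^\tau r(s)\,ds}(K-X_\tau)^+\right],\qquad t\in[0,T),\ x>0.$$ Then the optimal exercise boundary of this option is $$b(t)=\frac{K}{1+\frac{2\sigma}{\sqrt{2\delta+\sigma^2}}\left(N\left(\sqrt{(2\delta+\sigma^2)(T-t)}\right)-\frac12\right)},\qquad t\in[0,T);$$ that is, $\{(t,x)\in[0,T)\times(0,\infty): V(t,x)=K-x\}=\{(t,x)\in[0,T)\times(0,\infty): x\le b(t)\}$.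
   Context: $W$ is a standard Brownian motion under the risk-neutral measure $\mathsf Q$; $\mathsf E_{t,x}$ is the expectation under $\mathsf Q$ given $X_t=x$; the supremum is over all stopping times $\tau$ of the filtration $\mathcal F^X$ generated by $X$ taking values in $[t,T]$. The exercise region is $\mathcal E=\{(t,x)\in[0,T)\times(0,\infty): V(t,x)=K-x\}$. The optimal exercise boundary is the function $b:[0,T)\to(0,\infty)$ such that $\mathcal E=\{(t,x)\in[0,T)\times(0,\infty): x\le b(t)\}$. *)

theory Defs
  imports "HOL-Probability.Probability"
begin

section \<open>Brownian motion\<close>

text \<open>
  Time is indexed by the type of real numbers, but \<open>W\<close> is constrained only on \<open>[0, \<infinity>)\<close>.
  A filtration \<open>(F s)\<close> given for \<open>s \<ge> 0\<close> is a filtration over the whole type after setting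
  \<open>F s = F 0\<close> for \<open>s < 0\<close>.
\<close>

definition brownian_motion ::
    "'a measure \<Rightarrow> (real \<Rightarrow> 'a measure) \<Rightarrow> (real \<Rightarrow> 'a \<Rightarrow> real) \<Rightarrow> bool" where
  "brownian_motion M F W \<longleftrightarrow>
     filtration (space M) F \<and>
     (\<forall>s. subalgebra M (F s)) \<and>
     (\<forall>s\<ge>0. W s \<in> borel_measurable (F s)) \<and>
     (\<forall>\<omega>\<in>space M. continuous_on {0..} (\<lambda>s. W s \<omega>)) \<and>
     (AE \<omega> in M. W 0 \<omega> = 0) \<and>
     (\<forall>s u. 0 \<le> s \<and> s < u \<longrightarrow>
        distributed M lborel (\<lambda>\<omega>. W u \<omega> - W s \<omega>) (normal_density 0 (sqrt (u - s))) \<and>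
        prob_space.indep_set M (sets (F s))
          (sets (vimage_algebra (space M) (\<lambda>\<omega>. W u \<omega> - W s \<omega>) borel)))"

section \<open>The Ito integral\<close>

text \<open>
  The integral of a progressively measurable, pathwise square integrable integrand over
  \<open>[a, b]\<close>: simple processes are integrated elementarily, and the integral is the limit in
  probability of the elementary integrals along simple processes \<open>H\<^sub>k\<close> with
  \<open>\<integral>\<^sub>a\<^sup>b (H - H\<^sub>k)\<^sup>2 du \<longlonglongrightarrow> 0\<close> in probability. A simple process is given by
  the number \<open>n\<close> of steps, the points \<open>p 0 < \<dots> < p n\<close> and the step values \<open>\<xi> i\<close> on
  \<open>(p i, p (i + 1)]\<close>.
\<close>

definition simple_integrand ::
    "'a measure \<Rightarrow> (real \<Rightarrow> 'a measure) \<Rightarrow> real \<Rightarrow> real \<Rightarrow>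
     nat \<Rightarrow> (nat \<Rightarrow> real) \<Rightarrow> (nat \<Rightarrow> 'a \<Rightarrow> real) \<Rightarrow> bool" where
  "simple_integrand M F a b n p \<xi> \<longleftrightarrow>
     p 0 = a \<and> p n = b \<and> (\<forall>i<n. p i < p (Suc i)) \<and>
     (\<forall>i<n. \<xi> i \<in> borel_measurable (F (p i)) \<and> (\<exists>C. \<forall>\<omega>\<in>space M. \<bar>\<xi> i \<omega>\<bar> \<le> C))"

definition simple_process ::
    "nat \<Rightarrow> (nat \<Rightarrow> real) \<Rightarrow> (nat \<Rightarrow> 'a \<Rightarrow> real) \<Rightarrow> real \<Rightarrow> 'a \<Rightarrow> real" where
  "simple_process n p \<xi> u \<omega> = (\<Sum>i<n. \<xi> i \<omega> * indicator {p i<..p (Suc i)} u)"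

definition simple_integral ::
    "(real \<Rightarrow> 'a \<Rightarrow> real) \<Rightarrow> nat \<Rightarrow> (nat \<Rightarrow> real) \<Rightarrow> (nat \<Rightarrow> 'a \<Rightarrow> real) \<Rightarrow>
     real \<Rightarrow> 'a \<Rightarrow> real" where
  "simple_integral W n p \<xi> s \<omega> =
     (\<Sum>i<n. \<xi> i \<omega> * (W (min (p (Suc i)) s) \<omega> - W (min (p i) s) \<omega>))"

definition progressively_measurable_on ::
    "(real \<Rightarrow> 'a measure) \<Rightarrow> real \<Rightarrow> real \<Rightarrow> (real \<Rightarrow> 'a \<Rightarrow> real) \<Rightarrow> bool" where
  "progressively_measurable_on F a b H \<longleftrightarrow>
     (\<forall>s\<in>{a..b}. (\<lambda>(u, \<omega>). H u \<omega>)
        \<in> borel_measurable (restrict_space borel {a..s} \<Otimes>\<^sub>M F s))"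

definition has_ito_integral ::
    "'a measure \<Rightarrow> (real \<Rightarrow> 'a measure) \<Rightarrow> (real \<Rightarrow> 'a \<Rightarrow> real) \<Rightarrow> real \<Rightarrow> real \<Rightarrow>
     (real \<Rightarrow> 'a \<Rightarrow> real) \<Rightarrow> (real \<Rightarrow> 'a \<Rightarrow> real) \<Rightarrow> bool" where
  "has_ito_integral M F W a b H I \<longleftrightarrow>
     progressively_measurable_on F a b H \<and>
     (AE \<omega> in M. (\<integral>\<^sup>+u\<in>{a..b}. ennreal ((H u \<omega>)\<^sup>2) \<partial>lborel) < \<infinity>) \<and>
     (\<forall>s\<in>{a..b}. I s \<in> borel_measurable M) \<and>
     (\<exists>n p \<xi>.
        (\<forall>k. simple_integrand M F a b (n k) (p k) (\<xi> k)) \<and>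
        (\<forall>\<epsilon>>0. (\<lambda>k. measure M {\<omega>\<in>space M.
            ennreal \<epsilon> <
              (\<integral>\<^sup>+u\<in>{a..b}. ennreal ((H u \<omega> - simple_process (n k) (p k) (\<xi> k) u \<omega>)\<^sup>2) \<partial>lborel)})
          \<longlonglongrightarrow> 0) \<and>
        (\<forall>s\<in>{a..b}. \<forall>\<epsilon>>0. (\<lambda>k. measure M {\<omega>\<in>space M.
            \<epsilon> < \<bar>simple_integral W (n k) (p k) (\<xi> k) s \<omega> - I s \<omega>\<bar>})
          \<longlonglongrightarrow> 0))"

text \<open>
  \<open>X\<close> is a continuous \<open>F\<close>-adapted solution on \<open>[t, T]\<close> of
  \<open>dX\<^sub>s = \<mu>(s, X\<^sub>s) ds + \<nu>(s, X\<^sub>s) dW\<^sub>s\<close>, \<open>X\<^sub>t = x\<close>.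
\<close>

definition sde_solution ::
    "'a measure \<Rightarrow> (real \<Rightarrow> 'a measure) \<Rightarrow> (real \<Rightarrow> 'a \<Rightarrow> real) \<Rightarrow>
     (real \<Rightarrow> real \<Rightarrow> real) \<Rightarrow> (real \<Rightarrow> real \<Rightarrow> real) \<Rightarrow> real \<Rightarrow> real \<Rightarrow> real \<Rightarrow>
     (real \<Rightarrow> 'a \<Rightarrow> real) \<Rightarrow> bool" where
  "sde_solution M F W \<mu> \<nu> T t x X \<longleftrightarrow>
     (\<forall>s\<in>{t..T}. X s \<in> borel_measurable (F s)) \<and>
     (\<forall>\<omega>\<in>space M. continuous_on {t..T} (\<lambda>s. X s \<omega>)) \<and>
     (AE \<omega> in M. X t \<omega> = x) \<and>
     (AE \<omega> in M. set_integrable lborel {t..T} (\<lambda>u. \<mu> u (X u \<omega>))) \<and>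
     (\<exists>I. has_ito_integral M F W t T (\<lambda>u \<omega>. \<nu> u (X u \<omega>)) I \<and>
        (\<forall>s\<in>{t..T}. AE \<omega> in M. X s \<omega> = x + (LBINT u:{t..s}. \<mu> u (X u \<omega>)) + I s \<omega>))"

section \<open>The American put\<close>

definition natural_filtration ::
    "'a measure \<Rightarrow> real \<Rightarrow> (real \<Rightarrow> 'a \<Rightarrow> real) \<Rightarrow> real \<Rightarrow> 'a measure" where
  "natural_filtration M t X s =
     sigma (space M) {X u -` A \<inter> space M | u A. u \<in> {t..s} \<and> A \<in> sets borel}"

definition exercise_times ::
    "'a measure \<Rightarrow> real \<Rightarrow> real \<Rightarrow> (real \<Rightarrow> 'a \<Rightarrow> real) \<Rightarrow> ('a \<Rightarrow> real) set" where
  "exercise_times M T t X =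
     {\<tau>. stopping_time (natural_filtration M t X) \<tau> \<and> (\<forall>\<omega>\<in>space M. \<tau> \<omega> \<in> {t..T})}"

text \<open>
  Here \<open>X\<close> is the price process started at time \<open>t\<close>. The supremum is taken in the reals: for a
  nonnegative rate the discounted payoffs lie between \<open>0\<close> and \<open>K\<close>.
\<close>

definition american_put_value ::
    "'a measure \<Rightarrow> (real \<Rightarrow> real) \<Rightarrow> real \<Rightarrow> real \<Rightarrow> real \<Rightarrow> (real \<Rightarrow> 'a \<Rightarrow> real) \<Rightarrow> real" where
  "american_put_value M r K T t X =
     (SUP \<tau>\<in>exercise_times M T t X.
        prob_space.expectation M
          (\<lambda>\<omega>. exp (- (LBINT s:{t..\<tau> \<omega>}. r s)) * max (K - X (\<tau> \<omega>) \<omega>) 0))"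

definition exercise_region :: "real \<Rightarrow> real \<Rightarrow> (real \<Rightarrow> real \<Rightarrow> real) \<Rightarrow> (real \<times> real) set" where
  "exercise_region K T V = {(t, x). t \<in> {0..<T} \<and> x \<in> {0<..} \<and> V t x = K - x}"

definition optimal_exercise_boundary ::
    "real \<Rightarrow> real \<Rightarrow> (real \<Rightarrow> real \<Rightarrow> real) \<Rightarrow> (real \<Rightarrow> real) \<Rightarrow> bool" where
  "optimal_exercise_boundary K T V b \<longleftrightarrow>
     (\<forall>t\<in>{0..<T}. 0 < b t) \<and>
     exercise_region K T V = {(t, x). t \<in> {0..<T} \<and> x \<in> {0<..} \<and> x \<le> b t}"

abbreviation std_normal_cdf :: "real \<Rightarrow> real" where
  "std_normal_cdf \<equiv> cdf std_normal_distribution"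

end

theory Submission
  imports Defs
begin

text \<open>
  Write \<open>b = K / D\<close> and \<open>c\<^sup>2 = 2 \<delta> + \<sigma>\<^sup>2\<close>. The rate is
  chosen so that \<open>r = - D' / D + c\<^sup>2 / 2\<close>; hence \<open>X / b\<close> is \<open>exp (\<sigma> Z)\<close> for a
  Brownian motion \<open>Z\<close>, the boundary becomes the constant level \<open>Z = 0\<close>, and the discounted payoff is
  \<open>b(t) exp (- c\<^sup>2 (s - t) / 2) (D(s) - exp (\<sigma> Z\<^sub>s))\<^sup>+\<close>.

  Let \<open>v(q, z)\<close> be the value, at discount rate \<open>c\<^sup>2 / 2\<close> and time to maturity \<open>q\<close>, of the
  European claim paying \<open>(2 \<sigma> / c) sinh (c Z\<^sup>-)\<close>. It is convex in \<open>z\<close>, and by direct computation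
  \<open>v(T - s, 0) = D(s) - 1\<close> with slope \<open>- \<sigma>\<close> at \<open>z = 0\<close>; so it lies above its tangent
  \<open>D(s) - 1 - \<sigma> z\<close>, which lies above \<open>D(s) - exp (\<sigma> z)\<close>. The discounted claim value is a martingale that
  dominates the payoff and agrees with it on \<open>Z = 0\<close>. Therefore no stopping time beats immediate
  exercise from \<open>x = b(t)\<close>, and by convexity of the payoff in \<open>x\<close> none does from \<open>x \<le> b(t)\<close>. From
  \<open>x > b(t)\<close>, stopping at the first visit to \<open>Z \<le> 0\<close> (on a fine grid of times) attains
  \<open>b(t) v(T - t, z)\<close> up to a small overshoot, and this exceeds \<open>K - x\<close> since the tangent inequality is strict.

  That the given solution \<open>X\<close> is the geometric Brownian motion follows by showing that
  \<open>X\<close> divided by the explicit solution has increments along a grid which sum up to zero in the limit.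
\<close>

section \<open>Gaussian integrals\<close>

text \<open>At discount rate \<open>c\<^sup>2 / 2\<close>, sinh (c z) is a stationary solution of
  the heat equation. The odd part of the claim is \<open>- (\<sigma> / c) * sinh (c * z)\<close>, so
  the odd part of \<open>v\<close> never changes, and its slope at \<open>z = 0\<close> is
  \<open>- \<sigma>\<close>, the slope of the payoff there: smooth fit holds for every maturity.
  Value matching at \<open>z = 0\<close> is then what determines the boundary, and with it the rate.
  Below the level the claim only has to dominate the payoff. Two obstacles shape the rest. The Ito
  integral is known only through limits in probability at fixed times, the rate is unbounded near
  \<open>T\<close>, and no moments of \<open>X\<close> are assumed; hence the solution is identified
  by one-step products along grids, with Lenglart's inequality in place of second moments. And the
  value is a supremum over stopping times of the filtration of \<open>X\<close> in continuous time;
  rounding them up to a grid turns optional sampling into a finite sum that needs only Gaussian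
  increments.\<close>

abbreviation gauss :: "real measure" where
  "gauss \<equiv> std_normal_distribution"

interpretation gauss: prob_space gauss
  using prob_space_normal_density[of 1 0] by simp

lemma sets_gauss [simp, measurable_cong]: "sets gauss = sets borel"
  by simp

lemma space_gauss [simp]: "space gauss = UNIV"
  by simp

lemma std_normal_density_shift:
  "std_normal_density (x + c) * exp (c * (x + c)) = exp (c\<^sup>2 / 2) * std_normal_density x"
  by (simp add: std_normal_density_def flip: exp_add)
     (simp add: power2_eq_square field_simps)

text \<open>One-dimensional Cameron-Martin: completing the square turns an exponential weight into a
  translation. The Gaussian exponential moments and the closed form of the claim value are obtained
  from it.\<close>

lemma gauss_shift:
  fixes f :: "real \<Rightarrow> real"
  assumes [measurable]: "f \<in> borel_measurable borel"
    and "has_bochner_integral gauss (\<lambda>x. f (x + c)) y"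
  shows "has_bochner_integral gauss (\<lambda>x. exp (c * x) * f x) (exp (c\<^sup>2 / 2) * y)"
proof -
  have eq: "std_normal_density (c + 1 * x) *\<^sub>R (exp (c * (c + 1 * x)) * f (c + 1 * x))
      = exp (c\<^sup>2 / 2) * (std_normal_density x *\<^sub>R f (x + c))" for x
    using std_normal_density_shift[of x c] by (simp add: algebra_simps)
  have "has_bochner_integral lborel (\<lambda>x. std_normal_density x *\<^sub>R f (x + c)) y"
    using assms(2) by (simp add: has_bochner_integral_iff integrable_density integral_density)
  then have "has_bochner_integral lborel
      (\<lambda>x. exp (c\<^sup>2 / 2) * (std_normal_density x *\<^sub>R f (x + c))) (exp (c\<^sup>2 / 2) * y)"
    by (rule has_bochner_integral_mult_right)
  then have "has_bochner_integral lborel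
      (\<lambda>x. std_normal_density x *\<^sub>R (exp (c * x) * f x)) (exp (c\<^sup>2 / 2) * y)"
    unfolding eq[symmetric]
    by (subst lborel_has_bochner_integral_real_affine_iff[where c = 1 and t = c]) simp_all
  then show ?thesis
    by (simp add: has_bochner_integral_iff integrable_density integral_density)
qed

lemma gauss_exp: "has_bochner_integral gauss (\<lambda>x. exp (c * x)) (exp (c\<^sup>2 / 2))"
  using gauss_shift[of "\<lambda>_. 1" c 1] gauss.prob_space
  by (simp add: has_bochner_integral_iff)

lemma gauss_id: "has_bochner_integral gauss (\<lambda>x. x) 0"
  using integral_std_normal_distribution_moment_odd[of 1] integrable_std_normal_distribution_moment[of 1]
  by (simp add: has_bochner_integral_iff)

lemma gauss_id_exp: "has_bochner_integral gauss (\<lambda>x. x * exp (c * x)) (c * exp (c\<^sup>2 / 2))"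
proof -
  have "has_bochner_integral gauss (\<lambda>x. x + c) (0 + c)"
    by (intro has_bochner_integral_add gauss_id)
       (use gauss.prob_space in \<open>simp add: has_bochner_integral_iff\<close>)
  from gauss_shift[OF _ this] show ?thesis by (simp add: mult.commute)
qed

lemma exp_abs_le: "exp (c * \<bar>x\<bar>) \<le> exp (c * x) + exp (- c * x)" for c x :: real
  by (cases "x \<ge> 0") simp_all

lemma gauss_exp_abs:
  "integrable gauss (\<lambda>x. exp (c * \<bar>x\<bar>))" "(\<integral>x. exp (c * \<bar>x\<bar>) \<partial>gauss) \<le> 2 * exp (c\<^sup>2 / 2)"
proof -
  have b: "has_bochner_integral gauss (\<lambda>x. exp (c * x) + exp (- c * x)) (exp (c\<^sup>2 / 2) + exp ((- c)\<^sup>2 / 2))"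
    by (intro has_bochner_integral_add gauss_exp)
  then have i: "integrable gauss (\<lambda>x. exp (c * x) + exp (- c * x))"
    by (simp only: has_bochner_integral_iff)
  show i2: "integrable gauss (\<lambda>x. exp (c * \<bar>x\<bar>))"
    by (rule Bochner_Integration.integrable_bound[OF i])
       (auto intro!: AE_I2 order_trans[OF exp_abs_le])
  have "(\<integral>x. exp (c * \<bar>x\<bar>) \<partial>gauss) \<le> (\<integral>x. exp (c * x) + exp (- c * x) \<partial>gauss)"
    by (rule integral_mono[OF i2 i exp_abs_le])
  then show "(\<integral>x. exp (c * \<bar>x\<bar>) \<partial>gauss) \<le> 2 * exp (c\<^sup>2 / 2)"
    using has_bochner_integral_integral_eq[OF b] by simp
qed

lemma power_le_fact_exp: "\<bar>x\<bar> ^ n \<le> fact n * exp \<bar>x\<bar>" for x :: real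
proof -
  have "(\<Sum>k\<in>{n}. \<bar>x\<bar> ^ k /\<^sub>R fact k) \<le> (\<Sum>k. \<bar>x\<bar> ^ k /\<^sub>R fact k)"
    by (rule sum_le_suminf) (auto intro: summable_exp)
  then show ?thesis
    by (simp add: exp_def field_simps)
qed

text \<open>The power is absorbed by \<open>power_le_fact_exp\<close>, and \<open>sqrt h\<close> is
  bounded by \<open>sqrt T\<close> in the exponent only, so the factor \<open>h ^ m\<close> survives
  with a constant uniform in \<open>h\<close>. The case \<open>m = 2\<close> is the one applied,
  both for the one-step error of the price and for the overshoot.\<close>

lemma gauss_moment_bound:
  fixes h T l :: real and m :: nat
  assumes "0 \<le> h" "h \<le> T" "0 \<le> l"
  shows "integrable gauss (\<lambda>x. (sqrt h * x) ^ (2 * m) * exp (l * \<bar>sqrt h * x\<bar>))"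
    and "(\<integral>x. (sqrt h * x) ^ (2 * m) * exp (l * \<bar>sqrt h * x\<bar>) \<partial>gauss)
           \<le> h ^ m * (2 * fact (2 * m) * exp ((1 + l * sqrt T)\<^sup>2 / 2))"
proof -
  let ?f = "\<lambda>x. (sqrt h * x) ^ (2 * m) * exp (l * \<bar>sqrt h * x\<bar>)"
  let ?g = "\<lambda>x. h ^ m * fact (2 * m) * exp ((1 + l * sqrt T) * \<bar>x\<bar>)"
  have le: "?f x \<le> ?g x" for x
  proof -
    have "sqrt h \<le> sqrt T" using assms by simp
    then have "l * (sqrt h * \<bar>x\<bar>) \<le> l * (sqrt T * \<bar>x\<bar>)"
      using assms by (intro mult_left_mono mult_right_mono) auto
    then have e: "exp (l * \<bar>sqrt h * x\<bar>) \<le> exp (l * sqrt T * \<bar>x\<bar>)"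
      using assms by (simp add: abs_mult mult.assoc)
    have "(sqrt h * x) ^ (2 * m) = h ^ m * \<bar>x\<bar> ^ (2 * m)"
      using assms by (simp add: power_mult_distrib power_mult)
    also have "\<dots> \<le> h ^ m * (fact (2 * m) * exp \<bar>x\<bar>)"
      using assms by (intro mult_left_mono power_le_fact_exp) auto
    finally have "?f x \<le> h ^ m * (fact (2 * m) * exp \<bar>x\<bar>) * exp (l * sqrt T * \<bar>x\<bar>)"
      using e assms by (intro mult_mono) auto
    then show ?thesis by (simp add: exp_add algebra_simps)
  qed
  have nn: "0 \<le> ?f x" for x by (simp add: power_mult)
  have ig: "integrable gauss ?g" by (intro integrable_mult_right gauss_exp_abs)
  show i: "integrable gauss ?f"
    by (rule Bochner_Integration.integrable_bound[OF ig])
       (use le nn in \<open>auto intro!: AE_I2 order_trans[OF le abs_ge_self]\<close>)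
  have "(\<integral>x. ?f x \<partial>gauss) \<le> (\<integral>x. ?g x \<partial>gauss)"
    by (rule integral_mono[OF i ig le])
  also have "\<dots> \<le> h ^ m * fact (2 * m) * (2 * exp ((1 + l * sqrt T)\<^sup>2 / 2))"
    using assms by (subst integral_mult_right_zero) (intro mult_left_mono gauss_exp_abs; simp)
  finally show "(\<integral>x. ?f x \<partial>gauss) \<le> h ^ m * (2 * fact (2 * m) * exp ((1 + l * sqrt T)\<^sup>2 / 2))"
    by (simp add: ac_simps)
qed

lemma gauss_uminus: "distr gauss borel uminus = gauss"
proof -
  have "distributed gauss lborel (\<lambda>x. x) std_normal_density"
    unfolding distributed_def by (simp add: distr_id2)
  from gauss.normal_density_affine[OF this, of "-1" 0]
  have "distributed gauss lborel uminus std_normal_density" by simp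
  then show ?thesis
    unfolding distributed_def by (simp cong: distr_cong)
qed

lemma gauss_reflect:
  fixes f :: "real \<Rightarrow> real"
  assumes [measurable]: "f \<in> borel_measurable borel"
  shows "integrable gauss (\<lambda>x. f (- x)) \<longleftrightarrow> integrable gauss f"
    and "(\<integral>x. f (- x) \<partial>gauss) = (\<integral>x. f x \<partial>gauss)"
  using integrable_distr_eq[of uminus gauss borel f] integral_distr[of uminus gauss borel f]
  by (simp_all add: gauss_uminus)

section \<open>The dominating European claim\<close>

lemma has_real_derivative_sinh: "(sinh has_real_derivative cosh x) (at x)" for x :: real
  by (auto intro!: derivative_eq_intros)

text \<open>Convexity of \<open>sinh\<close> on the half-line, where \<open>cosh\<close> increases;
  the convexity of the claim comes from here.\<close>

lemma sinh_ge_tangent: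
  fixes u w :: real
  assumes "0 \<le> u" "0 \<le> w"
  shows "sinh u + (w - u) * cosh u \<le> sinh w"
proof (cases u w rule: linorder_cases)
  case less
  then obtain y where "u < y" "y < w" and y: "sinh w - sinh u = (w - u) * cosh y"
    using MVT2[of u w sinh cosh] has_real_derivative_sinh by auto
  then have "(w - u) * cosh u \<le> (w - u) * cosh y"
    using assms less by (intro mult_left_mono) (auto simp: cosh_real_nonneg_le_iff)
  with y show ?thesis by simp
next
  case greater
  then obtain y where "w < y" "y < u" and y: "sinh u - sinh w = (u - w) * cosh y"
    using MVT2[of w u sinh cosh] has_real_derivative_sinh by auto
  then have "(u - w) * cosh y \<le> (u - w) * cosh u"
    using assms greater by (intro mult_left_mono) (auto simp: cosh_real_nonneg_le_iff)
  with y show ?thesis by (simp add: algebra_simps)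
qed simp

lemma sinh_le_exp: "sinh x \<le> exp x" for x :: real
  using exp_gt_zero[of x] exp_gt_zero[of "- x"] by (simp add: sinh_field_def del: exp_gt_zero)

context
  fixes \<sigma> c :: real
  assumes \<sigma>: "0 < \<sigma>" and c: "0 < c"
begin

text \<open>The one-sided slopes at 0 are \<open>- 2 * \<sigma>\<close> and 0. Their midpoint
  \<open>- \<sigma>\<close> is the slope of the payoff there, and the constant
  \<open>2 * \<sigma> / c\<close> is chosen for that.\<close>

definition claim :: "real \<Rightarrow> real" where
  "claim z = 2 * \<sigma> / c * sinh (c * max (- z) 0)"

definition claim_value :: "real \<Rightarrow> real \<Rightarrow> real" where
  "claim_value q z = exp (- (c\<^sup>2 * q / 2)) * (\<integral>x. claim (z + sqrt q * x) \<partial>gauss)"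

lemma claim_nonneg: "0 \<le> claim z"
  using \<sigma> c by (simp add: claim_def)

lemma claim_eq_0: "0 \<le> z \<Longrightarrow> claim z = 0"
  by (simp add: claim_def)

lemma claim_antimono: "y \<le> z \<Longrightarrow> claim z \<le> claim y"
  unfolding claim_def using \<sigma> c by (intro mult_left_mono) auto

lemma claim_measurable [measurable]: "claim \<in> borel_measurable borel"
proof -
  have "continuous_on UNIV claim"
    unfolding claim_def by (intro continuous_intros)
  then show ?thesis by (rule borel_measurable_continuous_onI)
qed

lemma claim_le_exp: "claim z \<le> 2 * \<sigma> / c * exp (c * \<bar>z\<bar>)"
proof -
  have "sinh (c * max (- z) 0) \<le> exp (c * max (- z) 0)" by (rule sinh_le_exp)
  also have "\<dots> \<le> exp (c * \<bar>z\<bar>)" using c by simp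
  finally show ?thesis using \<sigma> c unfolding claim_def by (intro mult_left_mono) auto
qed

lemma claim_integrable:
  assumes "0 \<le> q"
  shows "integrable gauss (\<lambda>x. claim (z + sqrt q * x))"
proof (rule Bochner_Integration.integrable_bound)
  show "integrable gauss (\<lambda>x. 2 * \<sigma> / c * exp (c * \<bar>z\<bar>) * exp (c * sqrt q * \<bar>x\<bar>))"
    by (intro integrable_mult_right gauss_exp_abs)
  have "claim (z + sqrt q * x) \<le> 2 * \<sigma> / c * exp (c * \<bar>z\<bar>) * exp (c * sqrt q * \<bar>x\<bar>)" for x
  proof -
    have "\<bar>z + sqrt q * x\<bar> \<le> \<bar>z\<bar> + sqrt q * \<bar>x\<bar>"
      using assms abs_triangle_ineq[of z "sqrt q * x"] by (simp add: abs_mult)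
    then have "c * \<bar>z + sqrt q * x\<bar> \<le> c * \<bar>z\<bar> + c * sqrt q * \<bar>x\<bar>"
      using c by (metis distrib_left mult.assoc mult_left_mono less_imp_le)
    then have "exp (c * \<bar>z + sqrt q * x\<bar>) \<le> exp (c * \<bar>z\<bar>) * exp (c * sqrt q * \<bar>x\<bar>)"
      by (simp flip: exp_add)
    then have "2 * \<sigma> / c * exp (c * \<bar>z + sqrt q * x\<bar>)
        \<le> 2 * \<sigma> / c * (exp (c * \<bar>z\<bar>) * exp (c * sqrt q * \<bar>x\<bar>))"
      using \<sigma> c by (intro mult_left_mono) auto
    then show ?thesis using claim_le_exp[of "z + sqrt q * x"] by (simp add: mult.assoc)
  qed
  then show "AE x in gauss. norm (claim (z + sqrt q * x))
      \<le> norm (2 * \<sigma> / c * exp (c * \<bar>z\<bar>) * exp (c * sqrt q * \<bar>x\<bar>))"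
    using claim_nonneg \<sigma> c by (auto simp: abs_mult)
qed measurable

lemma claim_value_nonneg: "0 \<le> claim_value q z"
  unfolding claim_value_def by (intro mult_nonneg_nonneg Bochner_Integration.integral_nonneg claim_nonneg) simp

lemma claim_value_measurable [measurable]: "claim_value q \<in> borel_measurable borel"
proof -
  have "(\<lambda>z. \<integral>x. claim (z + sqrt q * x) \<partial>gauss) \<in> borel_measurable borel"
    by (rule gauss.borel_measurable_lebesgue_integral) simp
  then show ?thesis unfolding claim_value_def by simp
qed

lemma claim_value_0: "claim_value 0 z = claim z"
  using gauss.prob_space by (simp add: claim_value_def)

lemma claim_value_antimono:
  assumes "0 \<le> q" "y \<le> z"
  shows "claim_value q z \<le> claim_value q y"
  unfolding claim_value_def using assms
  by (intro mult_left_mono integral_mono claim_integrable claim_antimono) auto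

section \<open>Hyperbolic moments, reflection and smooth fit\<close>

lemma gauss_exp_scaled:
  assumes "0 \<le> q"
  shows "has_bochner_integral gauss (\<lambda>x. exp (z + k * (sqrt q * x))) (exp z * exp (k\<^sup>2 * q / 2))"
  using has_bochner_integral_mult_right[OF gauss_exp[of "k * sqrt q"], of "exp z"] assms
  by (simp add: exp_add power_mult_distrib mult.assoc)

text \<open>\<open>sinh (c * z)\<close> is an eigenfunction of the heat semigroup with eigenvalue
  \<open>exp (c\<^sup>2 * q / 2)\<close>, which the discount factor in \<open>claim_value\<close>
  cancels.\<close>

lemma gauss_sinh:
  assumes "0 \<le> q"
  shows "has_bochner_integral gauss (\<lambda>x. sinh (c * (z + sqrt q * x))) (exp (c\<^sup>2 * q / 2) * sinh (c * z))"
proof -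
  have "has_bochner_integral gauss
      (\<lambda>x. (exp (c * z + c * (sqrt q * x)) - exp (- (c * z) + (- c) * (sqrt q * x))) / 2)
      ((exp (c * z) * exp (c\<^sup>2 * q / 2) - exp (- (c * z)) * exp ((- c)\<^sup>2 * q / 2)) / 2)"
    by (intro has_bochner_integral_divide_zero has_bochner_integral_diff gauss_exp_scaled assms)
  moreover have "(exp (c * z + c * (sqrt q * x)) - exp (- (c * z) + (- c) * (sqrt q * x))) / 2
      = sinh (c * (z + sqrt q * x))" for x
    by (simp add: sinh_field_def distrib_left)
  ultimately show ?thesis
    by (simp add: sinh_field_def algebra_simps diff_divide_distrib)
qed

lemma gauss_cosh:
  assumes "0 \<le> q"
  shows "has_bochner_integral gauss (\<lambda>x. cosh (c * (sqrt q * x))) (exp (c\<^sup>2 * q / 2))"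
proof -
  have "has_bochner_integral gauss
      (\<lambda>x. (exp (0 + c * (sqrt q * x)) + exp (0 + (- c) * (sqrt q * x))) / 2)
      ((exp 0 * exp (c\<^sup>2 * q / 2) + exp 0 * exp ((- c)\<^sup>2 * q / 2)) / 2)"
    by (intro has_bochner_integral_divide_zero has_bochner_integral_add gauss_exp_scaled assms)
  then show ?thesis
    by (simp add: cosh_field_def)
qed

text \<open>By reflection, \<open>claim_value q z\<close> and \<open>claim_value q (- z)\<close>
  differ exactly by the stationary sinh term, and the second is at most the value at 0 by
  monotonicity. This measures the loss from stopping slightly below the level instead of on
  it.\<close>

lemma claim_value_gap:
  assumes "0 \<le> q" "z \<le> 0"
  shows "claim_value q z \<le> claim_value q 0 + 2 * \<sigma> / c * sinh (- (c * z))"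
proof -
  let ?I = "\<lambda>z. \<integral>x. claim (z + sqrt q * x) \<partial>gauss"
  have odd: "claim y - claim (- y) = - (2 * \<sigma> / c) * sinh (c * y)" for y
    by (cases "0 \<le> y") (auto simp: claim_def max_def)
  have refl: "(\<integral>x. claim (- (z + sqrt q * x)) \<partial>gauss) = ?I (- z)"
    using gauss_reflect(2)[of "\<lambda>x. claim (- z + sqrt q * x)"] by simp
  have int: "integrable gauss (\<lambda>x. claim (- (z + sqrt q * x)))"
    using gauss_reflect(1)[of "\<lambda>x. claim (- z + sqrt q * x)"] claim_integrable[OF assms(1), of "- z"]
    by simp
  have "?I z - ?I (- z) = (\<integral>x. claim (z + sqrt q * x) - claim (- (z + sqrt q * x)) \<partial>gauss)"
    unfolding refl[symmetric] by (intro Bochner_Integration.integral_diff[symmetric] claim_integrable assms int)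
  also have "\<dots> = (\<integral>x. - (2 * \<sigma> / c) * sinh (c * (z + sqrt q * x)) \<partial>gauss)"
    by (simp only: odd)
  also have "\<dots> = - (2 * \<sigma> / c) * (exp (c\<^sup>2 * q / 2) * sinh (c * z))"
    using has_bochner_integral_integral_eq[OF gauss_sinh[OF assms(1), of z]] by simp
  finally have I: "?I z = ?I (- z) - 2 * \<sigma> / c * (exp (c\<^sup>2 * q / 2) * sinh (c * z))" by simp
  have "claim_value q z = claim_value q (- z)
      - 2 * \<sigma> / c * ((exp (- (c\<^sup>2 * q / 2)) * exp (c\<^sup>2 * q / 2)) * sinh (c * z))"
    unfolding claim_value_def I by (simp add: right_diff_distrib mult.assoc mult.left_commute)
  also have "exp (- (c\<^sup>2 * q / 2)) * exp (c\<^sup>2 * q / 2) = 1"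
    by (simp flip: exp_add)
  finally have "claim_value q z = claim_value q (- z) + 2 * \<sigma> / c * sinh (- (c * z))" by simp
  moreover have "claim_value q (- z) \<le> claim_value q 0"
    using assms by (intro claim_value_antimono) auto
  ultimately show ?thesis by simp
qed

text \<open>These are subgradients of the convex claim. At the kink \<open>y = 0\<close> the weight
  1/2 selects the middle one, so that the weights at \<open>y\<close> and \<open>- y\<close> always
  sum to 1.\<close>

lemma claim_ge_tangent:
  "claim y - 2 * \<sigma> * z * (cosh (c * y) * (if y < 0 then 1 else if y = 0 then 1 / 2 else 0)) \<le> claim (y + z)"
proof -
  have main: "2 * \<sigma> / c * (sinh (c * - y) + (max (c * - (y + z)) 0 - c * - y) * cosh (c * - y)) \<le> claim (y + z)"
    if "y \<le> 0"
  proof -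
    have "sinh (c * - y) + (max (c * - (y + z)) 0 - c * - y) * cosh (c * - y) \<le> sinh (max (c * - (y + z)) 0)"
      using that c by (intro sinh_ge_tangent) (auto simp: mult_nonneg_nonpos)
    also have "max (c * - (y + z)) 0 = c * max (- (y + z)) 0"
      using c by (auto simp: max_def mult_le_0_iff zero_le_mult_iff)
    finally show ?thesis using \<sigma> c
      unfolding claim_def \<open>max (c * - (y + z)) 0 = c * max (- (y + z)) 0\<close>
      by (intro mult_left_mono) auto
  qed
  have le: "2 * \<sigma> / c * (sinh (c * - y) + (- c * z) * cosh (c * - y))
      \<le> 2 * \<sigma> / c * (sinh (c * - y) + (max (c * - (y + z)) 0 - c * - y) * cosh (c * - y))"
  proof (rule mult_left_mono)
    have "- c * z \<le> max (c * - (y + z)) 0 - c * - y"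
      by (simp add: algebra_simps max_def)
    then show "sinh (c * - y) + (- c * z) * cosh (c * - y)
      \<le> sinh (c * - y) + (max (c * - (y + z)) 0 - c * - y) * cosh (c * - y)"
      by (intro add_left_mono mult_right_mono) auto
  qed (use \<sigma> c in auto)
  consider "y < 0" | "y = 0" | "0 < y" by linarith
  then show ?thesis
  proof cases
    case 1
    have "2 * \<sigma> / c * (sinh (c * - y) + (- c * z) * cosh (c * - y)) = claim y - 2 * \<sigma> * z * cosh (c * y)"
      using 1 c by (simp add: claim_def field_simps)
    with main le 1 show ?thesis by simp
  next
    case 2
    show ?thesis
    proof (cases "z \<le> 0")
      case True
      have "2 * \<sigma> / c * (- c * z) \<le> claim z"
        using main le 2 by (simp add: claim_def)
      moreover have "2 * \<sigma> / c * (- c * z) = - (2 * \<sigma> * z)" using c by simp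
      moreover have "\<sigma> * z \<le> 0" using True \<sigma> by (simp add: mult_nonneg_nonpos)
      ultimately show ?thesis using 2 by (simp add: claim_def)
    next
      case False
      then show ?thesis using 2 \<sigma> by (simp add: claim_def)
    qed
  next
    case 3
    then show ?thesis using claim_nonneg[of "y + z"] by (simp add: claim_eq_0)
  qed
qed

text \<open>Smooth fit: the slope at \<open>z = 0\<close> is \<open>-\<sigma>\<close> for every time to maturity, because the subgradients of
  the claim at \<open>y\<close> and \<open>-y\<close> add up to \<open>- 2 \<sigma> cosh (c y)\<close>.\<close>

lemma claim_value_ge_tangent:
  assumes "0 \<le> q"
  shows "claim_value q 0 - \<sigma> * z \<le> claim_value q z"
proof -
  define k where "k y = cosh (c * y) * (if y < 0 then 1 else if y = 0 then 1 / 2 else 0)" for y :: real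
  have [measurable]: "(\<lambda>y::real. cosh (c * y)) \<in> borel_measurable borel"
    by (intro borel_measurable_continuous_onI continuous_intros)
  have [measurable]: "k \<in> borel_measurable borel"
    unfolding k_def by measurable
  have ki: "integrable gauss (\<lambda>x. k (sqrt q * x))"
    by (rule Bochner_Integration.integrable_bound[where f = "\<lambda>x. cosh (c * (sqrt q * x))"])
       (use gauss_cosh[OF assms] in \<open>auto simp: k_def has_bochner_integral_iff\<close>)
  have ki': "integrable gauss (\<lambda>x. k (- (sqrt q * x)))"
    using gauss_reflect(1)[of "\<lambda>x. k (sqrt q * x)"] ki by simp
  have "k y + k (- y) = cosh (c * y)" for y
    by (auto simp: k_def)
  then have "(\<integral>x. k (sqrt q * x) + k (- (sqrt q * x)) \<partial>gauss) = exp (c\<^sup>2 * q / 2)"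
    using has_bochner_integral_integral_eq[OF gauss_cosh[OF assms]] by simp
  moreover have "(\<integral>x. k (- (sqrt q * x)) \<partial>gauss) = (\<integral>x. k (sqrt q * x) \<partial>gauss)"
    using gauss_reflect(2)[of "\<lambda>x. k (sqrt q * x)"] by simp
  ultimately have k: "2 * (\<integral>x. k (sqrt q * x) \<partial>gauss) = exp (c\<^sup>2 * q / 2)"
    using ki ki' by (subst (asm) Bochner_Integration.integral_add) auto
  have ci: "integrable gauss (\<lambda>x. claim (sqrt q * x))"
    using claim_integrable[OF assms, of 0] by simp
  have "(\<integral>x. claim (sqrt q * x) - 2 * \<sigma> * z * k (sqrt q * x) \<partial>gauss)
      \<le> (\<integral>x. claim (z + sqrt q * x) \<partial>gauss)"
    using claim_ge_tangent[of "sqrt q * _" z] ci ki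
    by (intro integral_mono claim_integrable assms Bochner_Integration.integrable_diff integrable_mult_right)
       (auto simp: k_def add.commute)
  also have "(\<integral>x. claim (sqrt q * x) - 2 * \<sigma> * z * k (sqrt q * x) \<partial>gauss)
      = (\<integral>x. claim (sqrt q * x) \<partial>gauss) - \<sigma> * z * exp (c\<^sup>2 * q / 2)"
    using ci ki k by simp
  finally have "exp (- (c\<^sup>2 * q / 2)) * ((\<integral>x. claim (sqrt q * x) \<partial>gauss) - \<sigma> * z * exp (c\<^sup>2 * q / 2))
      \<le> exp (- (c\<^sup>2 * q / 2)) * (\<integral>x. claim (z + sqrt q * x) \<partial>gauss)"
    by (intro mult_left_mono) auto
  then have "claim_value q 0 - \<sigma> * z * (exp (- (c\<^sup>2 * q / 2)) * exp (c\<^sup>2 * q / 2)) \<le> claim_value q z"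
    by (simp add: claim_value_def algebra_simps)
  also have "exp (- (c\<^sup>2 * q / 2)) * exp (c\<^sup>2 * q / 2) = 1"
    by (simp flip: exp_add)
  finally show ?thesis by simp
qed

section \<open>Closed form of the claim value at the level\<close>

lemma gauss_singleton: "measure gauss {k} = 0"
  by (simp add: measure_def emeasure_density nn_integral_indicator_singleton')

lemma gauss_greaterThan: "measure gauss {k<..} = 1 - cdf gauss k"
  using gauss.prob_compl[of "{..k}"] by (simp add: cdf_def Compl_eq_Diff_UNIV[symmetric])

lemma gauss_greaterThan_uminus: "measure gauss {- k<..} = cdf gauss k"
proof -
  have "measure gauss {- k<..} = measure (distr gauss borel uminus) {- k<..}"
    by (simp add: gauss_uminus)
  also have "\<dots> = measure gauss {..<k}"
    by (subst measure_distr) (auto intro!: arg_cong[where f = "measure gauss"])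
  also have "\<dots> = measure gauss {..<k} + measure gauss {k}"
    by (simp add: gauss_singleton)
  also have "\<dots> = measure gauss ({..<k} \<union> {k})"
    by (subst gauss.finite_measure_Union) auto
  finally show ?thesis by (simp only: cdf_def ivl_disj_un_singleton)
qed

lemma claim_value_at_0:
  assumes "0 \<le> q"
  shows "claim_value q 0 = 2 * \<sigma> / c * (cdf gauss (c * sqrt q) - 1 / 2)"
proof -
  define k where "k = c * sqrt q"
  have ind: "has_bochner_integral gauss (\<lambda>x. indicator {0<..} (x + l) :: real) (measure gauss {- l<..})" for l
  proof -
    have "(\<lambda>x. indicator {0<..} (x + l) :: real) = indicator {- l<..}"
      by (auto simp: indicator_def fun_eq_iff)
    then show ?thesis by (auto intro!: has_bochner_integral_real_indicator gauss.emeasure_finite simp: less_top[symmetric])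
  qed
  \<comment> \<open>Both exponentials in \<open>sinh\<close> are shifted away, which leaves the
    Gaussian masses of \<open>{- k<..}\<close> and \<open>{k<..}\<close>, that is
    \<open>cdf gauss k\<close> and \<open>1 - cdf gauss k\<close>. Half their difference is
    \<open>cdf gauss k - 1 / 2\<close>, the term in the formula for the boundary.\<close>
  have "has_bochner_integral gauss
      (\<lambda>x. (exp (k * x) * indicator {0<..} x - exp ((- k) * x) * indicator {0<..} x) / 2)
      ((exp (k\<^sup>2 / 2) * measure gauss {- k<..} - exp ((- k)\<^sup>2 / 2) * measure gauss {- (- k)<..}) / 2)"
    by (intro has_bochner_integral_divide_zero has_bochner_integral_diff gauss_shift ind) simp_all
  moreover have "(exp (k * x) * indicator {0<..} x - exp ((- k) * x) * indicator {0<..} x) / 2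
      = sinh (k * max x 0)" for x
    by (auto simp: indicator_def sinh_field_def max_def)
  ultimately have "(\<integral>x. sinh (k * max x 0) \<partial>gauss) = exp (k\<^sup>2 / 2) * (cdf gauss k - 1 / 2)"
    by (simp add: has_bochner_integral_iff gauss_greaterThan[of k] gauss_greaterThan_uminus[of k] algebra_simps)
  moreover have "(\<integral>x. sinh (k * max (- x) 0) \<partial>gauss) = (\<integral>x. sinh (k * max x 0) \<partial>gauss)"
    by (rule gauss_reflect(2)) (intro borel_measurable_continuous_onI continuous_intros)
  moreover have "claim (0 + sqrt q * x) = 2 * \<sigma> / c * sinh (k * max (- x) 0)" for x
  proof -
    have "max (- (sqrt q * x)) 0 = sqrt q * max (- x) 0"
      using assms by (auto simp: max_def mult_le_0_iff zero_le_mult_iff)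
    then show ?thesis by (simp add: claim_def k_def mult.assoc)
  qed
  ultimately have "claim_value q 0
      = (exp (- (c\<^sup>2 * q / 2)) * exp (k\<^sup>2 / 2)) * (2 * \<sigma> / c * (cdf gauss k - 1 / 2))"
    by (simp add: claim_value_def)
  moreover have "exp (- (c\<^sup>2 * q / 2)) * exp (k\<^sup>2 / 2) = 1"
    using assms by (simp add: k_def power_mult_distrib flip: exp_add)
  ultimately show ?thesis by (simp add: k_def)
qed

end

section \<open>Brownian motion\<close>

locale brownian = prob_space M for M :: "'a measure" +
  fixes F :: "real \<Rightarrow> 'a measure" and W :: "real \<Rightarrow> 'a \<Rightarrow> real"
  assumes bm: "brownian_motion M F W"
begin

lemma space_F [simp]: "space (F s) = space M"
  using bm by (auto simp: brownian_motion_def filtration_def)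

lemma sets_F_mono: "s \<le> u \<Longrightarrow> sets (F s) \<subseteq> sets (F u)"
  using bm by (auto simp: brownian_motion_def filtration_def)

lemma sets_F_M: "sets (F s) \<subseteq> sets M"
  using bm by (auto simp: brownian_motion_def subalgebra_def)

lemma measurable_F_mono: "f \<in> measurable (F s) N \<Longrightarrow> s \<le> u \<Longrightarrow> f \<in> measurable (F u) N"
  using sets_F_mono[of s u] by (auto simp: measurable_def)

lemma measurable_F_M: "f \<in> measurable (F s) N \<Longrightarrow> f \<in> measurable M N"
  using sets_F_M[of s] by (auto simp: measurable_def)

lemma W_F: "0 \<le> s \<Longrightarrow> s \<le> u \<Longrightarrow> W s \<in> borel_measurable (F u)"
  using bm by (auto simp: brownian_motion_def intro: measurable_F_mono)

lemma W_M: "0 \<le> s \<Longrightarrow> W s \<in> borel_measurable M"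
  using W_F[of s s] measurable_F_M by auto

lemma W_continuous: "\<omega> \<in> space M \<Longrightarrow> continuous_on {0..} (\<lambda>s. W s \<omega>)"
  using bm by (auto simp: brownian_motion_def)

text \<open>Stated as an image of \<open>gauss\<close> under scaling, not through a density, so that
  the degenerate step \<open>s = u\<close> is covered as a point mass at 0; sampling at maturity
  uses it.\<close>

lemma distr_increment:
  assumes "0 \<le> s" "s \<le> u"
  shows "distr M borel (\<lambda>\<omega>. W u \<omega> - W s \<omega>) = distr gauss borel (\<lambda>x. sqrt (u - s) * x)"
proof (cases "s = u")
  case True
  have "(\<lambda>x. 0) -` A \<inter> B = (if 0 \<in> A then B else {})" for A :: "real set" and B
    by auto
  with True show ?thesis
    by (intro measure_eqI) (auto simp: emeasure_distr emeasure_space_1 gauss.emeasure_space_1)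
next
  case False
  with assms have su: "s < u" by simp
  then have h: "0 < sqrt (u - s)" by simp
  have [measurable]: "W u \<in> borel_measurable M" "W s \<in> borel_measurable M"
    using assms by (auto intro: W_M)
  have "distributed M lborel (\<lambda>\<omega>. W u \<omega> - W s \<omega>) (normal_density 0 (sqrt (u - s)))"
    using bm assms su by (auto simp: brownian_motion_def)
  then have "distributed M lborel (\<lambda>\<omega>. (W u \<omega> - W s \<omega>) / sqrt (u - s)) std_normal_density"
    using normal_standard_normal_convert[OF h, of "\<lambda>\<omega>. W u \<omega> - W s \<omega>" 0] by simp
  then have g: "distr M borel (\<lambda>\<omega>. (W u \<omega> - W s \<omega>) / sqrt (u - s)) = gauss"
    unfolding distributed_def by (simp cong: distr_cong)
  have "distr M borel (\<lambda>\<omega>. W u \<omega> - W s \<omega>)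
      = distr (distr M borel (\<lambda>\<omega>. (W u \<omega> - W s \<omega>) / sqrt (u - s))) borel (\<lambda>x. sqrt (u - s) * x)"
    using h by (subst distr_distr) (auto simp: comp_def)
  then show ?thesis unfolding g .
qed

lemma indep_increment:
  assumes "0 \<le> s" "s < u"
  shows "indep_set (sets (F s)) {(\<lambda>\<omega>. W u \<omega> - W s \<omega>) -` B \<inter> space M |B. B \<in> sets borel}"
proof -
  have "indep_set (sets (F s)) (sets (vimage_algebra (space M) (\<lambda>\<omega>. W u \<omega> - W s \<omega>) borel))"
    using bm assms by (auto simp: brownian_motion_def)
  moreover have "{(\<lambda>\<omega>. W u \<omega> - W s \<omega>) -` B \<inter> space M |B. B \<in> sets borel}
      = sets (vimage_algebra (space M) (\<lambda>\<omega>. W u \<omega> - W s \<omega>) borel)"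
    by (rule sets_vimage_algebra2[symmetric]) simp
  ultimately show ?thesis by simp
qed

lemma indep_var_increment:
  fixes \<phi> :: "real \<Rightarrow> real" and Z :: "'a \<Rightarrow> real"
  assumes "0 \<le> s" "s < u" and \<phi>[measurable]: "\<phi> \<in> borel_measurable borel" and Z: "Z \<in> borel_measurable (F s)"
  shows "indep_var borel Z borel (\<lambda>\<omega>. \<phi> (W u \<omega> - W s \<omega>))"
  unfolding indep_var_eq
proof (intro conjI)
  have [measurable]: "W u \<in> borel_measurable M" "W s \<in> borel_measurable M"
    using assms by (auto intro: W_M)
  show "random_variable borel Z" using Z by (rule measurable_F_M)
  show "random_variable borel (\<lambda>\<omega>. \<phi> (W u \<omega> - W s \<omega>))" by measurable
  show "indep_set (sigma_sets (space M) {Z -` A \<inter> space M |A. A \<in> sets borel})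
     (sigma_sets (space M) {(\<lambda>\<omega>. \<phi> (W u \<omega> - W s \<omega>)) -` A \<inter> space M |A. A \<in> sets borel})"
  proof (rule indep_set_sigma_sets)
    have "{Z -` A \<inter> space M |A. A \<in> sets borel} \<subseteq> sets (F s)"
      using Z by (auto simp: measurable_def)
    moreover have "{(\<lambda>\<omega>. \<phi> (W u \<omega> - W s \<omega>)) -` A \<inter> space M |A. A \<in> sets borel}
        \<subseteq> {(\<lambda>\<omega>. W u \<omega> - W s \<omega>) -` B \<inter> space M |B. B \<in> sets borel}"
    proof safe
      fix A :: "real set" assume "A \<in> sets borel"
      then have "\<phi> -` A \<in> sets borel" using measurable_sets[OF \<phi>] by simp
      then show "\<exists>B. (\<lambda>\<omega>. \<phi> (W u \<omega> - W s \<omega>)) -` A \<inter> space M = (\<lambda>\<omega>. W u \<omega> - W s \<omega>) -` B \<inter> space M \<and> B \<in> sets borel"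
        by (intro exI[of _ "\<phi> -` A"]) auto
    qed
    ultimately show "indep_set {Z -` A \<inter> space M |A. A \<in> sets borel}
        {(\<lambda>\<omega>. \<phi> (W u \<omega> - W s \<omega>)) -` A \<inter> space M |A. A \<in> sets borel}"
      using indep_increment[OF assms(1,2)] unfolding indep_set_def
      by (elim indep_sets_mono_sets) (auto split: bool.split)
    show "Int_stable {Z -` A \<inter> space M |A. A \<in> sets borel}"
    proof (rule Int_stableI, safe)
      fix A B :: "real set" assume "A \<in> sets borel" "B \<in> sets borel"
      then show "\<exists>C. Z -` A \<inter> space M \<inter> (Z -` B \<inter> space M) = Z -` C \<inter> space M \<and> C \<in> sets borel"
        by (intro exI[of _ "A \<inter> B"]) auto
    qed
    show "Int_stable {(\<lambda>\<omega>. \<phi> (W u \<omega> - W s \<omega>)) -` A \<inter> space M |A. A \<in> sets borel}"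
    proof (rule Int_stableI, safe)
      fix A B :: "real set" assume "A \<in> sets borel" "B \<in> sets borel"
      then show "\<exists>C. (\<lambda>\<omega>. \<phi> (W u \<omega> - W s \<omega>)) -` A \<inter> space M \<inter> ((\<lambda>\<omega>. \<phi> (W u \<omega> - W s \<omega>)) -` B \<inter> space M)
          = (\<lambda>\<omega>. \<phi> (W u \<omega> - W s \<omega>)) -` C \<inter> space M \<and> C \<in> sets borel"
        by (intro exI[of _ "A \<inter> B"]) auto
    qed
  qed
qed

text \<open>Freezing: the identity map, read as a random element of \<open>F s\<close>, and the
  increment have a product law, because independence identifies the two measures on rectangles;
  Tonelli then integrates out the increment first. Nonnegative integrals keep integrability out of
  the argument.\<close>

lemma nn_integral_increment:
  assumes "0 \<le> s" "s \<le> u" and [measurable]: "f \<in> borel_measurable (F s \<Otimes>\<^sub>M borel)"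
  shows "(\<integral>\<^sup>+\<omega>. f (\<omega>, W u \<omega> - W s \<omega>) \<partial>M) = (\<integral>\<^sup>+\<omega>. (\<integral>\<^sup>+x. f (\<omega>, sqrt (u - s) * x) \<partial>gauss) \<partial>M)"
proof (cases "s = u")
  case True
  then show ?thesis by (simp add: gauss.emeasure_space_1[simplified])
next
  case False
  with assms have su: "s < u" by simp
  have W[measurable]: "W u \<in> borel_measurable M" "W s \<in> borel_measurable M"
    using assms by (auto intro: W_M)
  have id[measurable]: "(\<lambda>\<omega>. \<omega>) \<in> measurable M (F s)"
    by (auto intro!: measurable_F_M[of _ s])
  let ?D = "distr M (F s) (\<lambda>\<omega>. \<omega>)" and ?E = "distr M borel (\<lambda>\<omega>. W u \<omega> - W s \<omega>)"
  interpret D: prob_space ?D by (rule prob_space_distr) fact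
  interpret E: prob_space ?E by (rule prob_space_distr) simp
  interpret P: pair_prob_space ?D ?E ..
  have eq: "?D \<Otimes>\<^sub>M ?E = distr M (F s \<Otimes>\<^sub>M borel) (\<lambda>\<omega>. (\<omega>, W u \<omega> - W s \<omega>))"
  proof (rule pair_measure_eqI[OF D.sigma_finite_measure_axioms E.sigma_finite_measure_axioms])
    show "sets (?D \<Otimes>\<^sub>M ?E) = sets (distr M (F s \<Otimes>\<^sub>M borel) (\<lambda>\<omega>. (\<omega>, W u \<omega> - W s \<omega>)))"
      by (simp cong: sets_pair_measure_cong)
    fix A B assume "A \<in> sets ?D" "B \<in> sets ?E"
    then have [measurable]: "A \<in> sets (F s)" "B \<in> sets borel" by auto
    then have AM: "A \<in> sets M" using sets_F_M[of s] by blast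
    have "emeasure ?D A * emeasure ?E B = emeasure M A * emeasure M ((\<lambda>\<omega>. W u \<omega> - W s \<omega>) -` B \<inter> space M)"
      by (simp add: emeasure_distr sets.Int_space_eq2[OF AM])
    also have "\<dots> = emeasure M (A \<inter> ((\<lambda>\<omega>. W u \<omega> - W s \<omega>) -` B \<inter> space M))"
    proof -
      have "(\<lambda>\<omega>. W u \<omega> - W s \<omega>) -` B \<inter> space M \<in> {(\<lambda>\<omega>. W u \<omega> - W s \<omega>) -` B \<inter> space M |B. B \<in> sets borel}"
        using \<open>B \<in> sets borel\<close> by blast
      from indep_setD[OF indep_increment[OF assms(1) su] \<open>A \<in> sets (F s)\<close> this]
      show ?thesis by (simp only: emeasure_eq_measure ennreal_mult measure_nonneg)
    qed
    also have "A \<inter> ((\<lambda>\<omega>. W u \<omega> - W s \<omega>) -` B \<inter> space M) = (\<lambda>\<omega>. (\<omega>, W u \<omega> - W s \<omega>)) -` (A \<times> B) \<inter> space M"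
      by auto
    also have "emeasure M \<dots> = emeasure (distr M (F s \<Otimes>\<^sub>M borel) (\<lambda>\<omega>. (\<omega>, W u \<omega> - W s \<omega>))) (A \<times> B)"
      by (rule emeasure_distr[symmetric]) measurable
    finally show "emeasure ?D A * emeasure ?E B = emeasure (distr M (F s \<Otimes>\<^sub>M borel) (\<lambda>\<omega>. (\<omega>, W u \<omega> - W s \<omega>))) (A \<times> B)" .
  qed
  have "(\<integral>\<^sup>+\<omega>. f (\<omega>, W u \<omega> - W s \<omega>) \<partial>M) = (\<integral>\<^sup>+y. f y \<partial>(?D \<Otimes>\<^sub>M ?E))"
    unfolding eq by (subst nn_integral_distr) auto
  also have "\<dots> = (\<integral>\<^sup>+\<omega>. (\<integral>\<^sup>+x. f (\<omega>, x) \<partial>?E) \<partial>?D)"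
    by (rule E.nn_integral_fst[symmetric]) simp
  also have "\<dots> = (\<integral>\<^sup>+\<omega>. (\<integral>\<^sup>+x. f (\<omega>, x) \<partial>?E) \<partial>M)"
    by (rule nn_integral_distr[OF id]) (use E.borel_measurable_nn_integral in simp)
  also have "\<dots> = (\<integral>\<^sup>+\<omega>. (\<integral>\<^sup>+x. f (\<omega>, sqrt (u - s) * x) \<partial>gauss) \<partial>M)"
    unfolding distr_increment[OF assms(1,2)]
    by (intro nn_integral_cong nn_integral_distr) auto
  finally show ?thesis .
qed

lemma increment_integral:
  fixes \<phi> :: "real \<Rightarrow> real"
  assumes "0 \<le> s" "s \<le> u" and [measurable]: "\<phi> \<in> borel_measurable borel"
  shows "integrable M (\<lambda>\<omega>. \<phi> (W u \<omega> - W s \<omega>)) \<longleftrightarrow> integrable gauss (\<lambda>x. \<phi> (sqrt (u - s) * x))"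
    and "(\<integral>\<omega>. \<phi> (W u \<omega> - W s \<omega>) \<partial>M) = (\<integral>x. \<phi> (sqrt (u - s) * x) \<partial>gauss)"
proof -
  have [measurable]: "W u \<in> borel_measurable M" "W s \<in> borel_measurable M"
    using assms by (auto intro: W_M)
  show "integrable M (\<lambda>\<omega>. \<phi> (W u \<omega> - W s \<omega>)) \<longleftrightarrow> integrable gauss (\<lambda>x. \<phi> (sqrt (u - s) * x))"
    using integrable_distr_eq[of "\<lambda>\<omega>. W u \<omega> - W s \<omega>" M borel \<phi>]
      integrable_distr_eq[of "\<lambda>x. sqrt (u - s) * x" gauss borel \<phi>]
    by (simp add: distr_increment[OF assms(1,2)])
  show "(\<integral>\<omega>. \<phi> (W u \<omega> - W s \<omega>) \<partial>M) = (\<integral>x. \<phi> (sqrt (u - s) * x) \<partial>gauss)"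
    using integral_distr[of "\<lambda>\<omega>. W u \<omega> - W s \<omega>" M borel \<phi>]
      integral_distr[of "\<lambda>x. sqrt (u - s) * x" gauss borel \<phi>]
    by (simp add: distr_increment[OF assms(1,2)])
qed

lemma increment_product:
  fixes \<phi> :: "real \<Rightarrow> real"
  assumes "0 \<le> s" "s < u" and [measurable]: "\<phi> \<in> borel_measurable borel"
    and Z: "Z \<in> borel_measurable (F s)" "integrable M Z"
    and \<phi>: "integrable gauss (\<lambda>x. \<phi> (sqrt (u - s) * x))"
  shows "integrable M (\<lambda>\<omega>. Z \<omega> * \<phi> (W u \<omega> - W s \<omega>))"
    and "(\<integral>\<omega>. Z \<omega> * \<phi> (W u \<omega> - W s \<omega>) \<partial>M) = (\<integral>\<omega>. Z \<omega> \<partial>M) * (\<integral>x. \<phi> (sqrt (u - s) * x) \<partial>gauss)"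
proof -
  have iv: "indep_var borel Z borel (\<lambda>\<omega>. \<phi> (W u \<omega> - W s \<omega>))"
    using assms by (intro indep_var_increment)
  have i: "integrable M (\<lambda>\<omega>. \<phi> (W u \<omega> - W s \<omega>))"
    using \<phi> assms by (simp add: increment_integral(1))
  show "integrable M (\<lambda>\<omega>. Z \<omega> * \<phi> (W u \<omega> - W s \<omega>))"
    by (rule indep_var_integrable[OF iv Z(2) i])
  show "(\<integral>\<omega>. Z \<omega> * \<phi> (W u \<omega> - W s \<omega>) \<partial>M) = (\<integral>\<omega>. Z \<omega> \<partial>M) * (\<integral>x. \<phi> (sqrt (u - s) * x) \<partial>gauss)"
    using indep_var_lebesgue_integral[OF iv Z(2) i] assms by (simp add: increment_integral(2))
qed

text \<open>Given \<open>F s\<close>, the increment up to \<open>T\<close> is a fresh Gaussian, and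
  averaging the terminal claim over it is what \<open>claim_value\<close> does. The right side
  depends on \<open>s\<close> only through \<open>A\<close>, which allows sampling at different
  times on different sets.\<close>

lemma claim_value_martingale:
  assumes \<sigma>: "0 < \<sigma>" and c: "0 < c" and t: "0 \<le> t" "t \<le> s" "s \<le> T" and A: "A \<in> sets (F s)"
  shows "(\<integral>\<^sup>+\<omega>. ennreal (indicator A \<omega> * (exp (- (c\<^sup>2 * (s - t) / 2)) * claim_value \<sigma> c (T - s) (z + (W s \<omega> - W t \<omega>)))) \<partial>M)
       = (\<integral>\<^sup>+\<omega>. ennreal (indicator A \<omega> * (exp (- (c\<^sup>2 * (T - t) / 2)) * claim \<sigma> c (z + (W T \<omega> - W t \<omega>)))) \<partial>M)"
proof -
  note [measurable] = claim_measurable[OF \<sigma> c]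
  have [measurable]: "W s \<in> borel_measurable (F s)" "W t \<in> borel_measurable (F s)" "A \<in> sets (F s)"
    using t A by (auto intro: W_F)
  let ?f = "\<lambda>(\<omega>, y). ennreal (indicator A \<omega> * (exp (- (c\<^sup>2 * (T - t) / 2)) * claim \<sigma> c (z + (W s \<omega> - W t \<omega>) + y)))"
  have e: "exp (- (c\<^sup>2 * (s - t) / 2)) * exp (- (c\<^sup>2 * (T - s) / 2)) = exp (- (c\<^sup>2 * (T - t) / 2))"
    by (simp add: field_simps flip: exp_add)
  have "ennreal (indicator A \<omega> * (exp (- (c\<^sup>2 * (s - t) / 2)) * claim_value \<sigma> c (T - s) (z + (W s \<omega> - W t \<omega>))))
      = (\<integral>\<^sup>+x. ?f (\<omega>, sqrt (T - s) * x) \<partial>gauss)" for \<omega>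
  proof -
    let ?I = "\<integral>x. indicator A \<omega> * (exp (- (c\<^sup>2 * (T - t) / 2)) * claim \<sigma> c (z + (W s \<omega> - W t \<omega>) + sqrt (T - s) * x)) \<partial>gauss"
    have "indicator A \<omega> * (exp (- (c\<^sup>2 * (s - t) / 2)) * claim_value \<sigma> c (T - s) (z + (W s \<omega> - W t \<omega>))) = ?I"
      unfolding claim_value_def[OF \<sigma> c] e[symmetric] by (simp add: mult.assoc)
    moreover have "ennreal ?I = (\<integral>\<^sup>+x. ennreal (indicator A \<omega> * (exp (- (c\<^sup>2 * (T - t) / 2)) * claim \<sigma> c (z + (W s \<omega> - W t \<omega>) + sqrt (T - s) * x))) \<partial>gauss)"
      using t claim_nonneg[OF \<sigma> c]
      by (intro nn_integral_eq_integral[symmetric] integrable_mult_right claim_integrable[OF \<sigma> c] AE_I2) auto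
    ultimately show ?thesis by (simp only: case_prod_conv)
  qed
  then have "(\<integral>\<^sup>+\<omega>. ennreal (indicator A \<omega> * (exp (- (c\<^sup>2 * (s - t) / 2)) * claim_value \<sigma> c (T - s) (z + (W s \<omega> - W t \<omega>)))) \<partial>M)
      = (\<integral>\<^sup>+\<omega>. (\<integral>\<^sup>+x. ?f (\<omega>, sqrt (T - s) * x) \<partial>gauss) \<partial>M)"
    by (simp only:)
  also have "\<dots> = (\<integral>\<^sup>+\<omega>. ?f (\<omega>, W T \<omega> - W s \<omega>) \<partial>M)"
  proof (rule nn_integral_increment[symmetric])
    show "?f \<in> borel_measurable (F s \<Otimes>\<^sub>M borel)" by measurable
  qed (use t in auto)
  also have "\<dots> = (\<integral>\<^sup>+\<omega>. ennreal (indicator A \<omega> * (exp (- (c\<^sup>2 * (T - t) / 2)) * claim \<sigma> c (z + (W T \<omega> - W t \<omega>)))) \<partial>M)"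
    by (intro nn_integral_cong) (simp add: algebra_simps)
  finally show ?thesis .
qed

text \<open>The sets \<open>A k\<close> are the level sets of a stopping time. On each of them the
  sampled value is exchanged for the terminal claim; the pieces cover the space, and the same
  exchange at time \<open>t\<close> with \<open>A = space M\<close> evaluates the total.\<close>

lemma claim_value_optional_sampling:
  fixes A :: "nat \<Rightarrow> 'a set"
  assumes \<sigma>: "0 < \<sigma>" and c: "0 < c" and t: "0 \<le> t"
    and s: "\<And>k. k \<le> n \<Longrightarrow> t \<le> s k \<and> s k \<le> T"
    and A: "\<And>k. k \<le> n \<Longrightarrow> A k \<in> sets (F (s k))" "disjoint_family_on A {..n}" "(\<Union>k\<le>n. A k) = space M"
  shows "has_bochner_integral M (\<lambda>\<omega>. \<Sum>k\<le>n. indicator (A k) \<omega> *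
            (exp (- (c\<^sup>2 * (s k - t) / 2)) * claim_value \<sigma> c (T - s k) (z + (W (s k) \<omega> - W t \<omega>))))
         (claim_value \<sigma> c (T - t) z)"
proof -
  note [measurable] = claim_measurable[OF \<sigma> c]
  have tT: "t \<le> T" using s[of 0] by simp
  have [measurable]: "W T \<in> borel_measurable M" "W t \<in> borel_measurable M"
    using t tT by (auto intro: W_M)
  have AM: "A k \<in> sets M" if "k \<le> n" for k
    using A(1)[OF that] sets_F_M by auto
  define m where "m k \<omega> = exp (- (c\<^sup>2 * (s k - t) / 2)) * claim_value \<sigma> c (T - s k) (z + (W (s k) \<omega> - W t \<omega>))" for k \<omega>
  have mm: "m k \<in> borel_measurable M" if "k \<le> n" for k
  proof -
    have [measurable]: "W (s k) \<in> borel_measurable M"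
      using s[OF that] t by (intro W_M) simp
    show ?thesis unfolding m_def using claim_value_measurable[OF \<sigma> c, measurable] by measurable
  qed
  have m0: "0 \<le> m k \<omega>" for k \<omega>
    unfolding m_def by (intro mult_nonneg_nonneg claim_value_nonneg \<sigma> c) simp
  let ?g = "\<lambda>\<omega>. exp (- (c\<^sup>2 * (T - t) / 2)) * claim \<sigma> c (z + (W T \<omega> - W t \<omega>))"
  have g0: "0 \<le> ?g \<omega>" for \<omega>
    using claim_nonneg[OF \<sigma> c] by simp
  have "(\<integral>\<^sup>+\<omega>. ennreal (\<Sum>k\<le>n. indicator (A k) \<omega> * m k \<omega>) \<partial>M)
      = (\<integral>\<^sup>+\<omega>. (\<Sum>k\<le>n. ennreal (indicator (A k) \<omega> * m k \<omega>)) \<partial>M)"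
    using m0 by (intro nn_integral_cong) (simp add: sum_ennreal)
  also have "\<dots> = (\<Sum>k\<le>n. \<integral>\<^sup>+\<omega>. ennreal (indicator (A k) \<omega> * m k \<omega>) \<partial>M)"
    using mm AM by (intro nn_integral_sum) auto
  also have "\<dots> = (\<Sum>k\<le>n. \<integral>\<^sup>+\<omega>. ennreal (indicator (A k) \<omega> * ?g \<omega>) \<partial>M)"
    unfolding m_def using s A by (intro sum.cong refl claim_value_martingale \<sigma> c t) auto
  also have "\<dots> = (\<integral>\<^sup>+\<omega>. (\<Sum>k\<le>n. ennreal (indicator (A k) \<omega> * ?g \<omega>)) \<partial>M)"
    using AM by (intro nn_integral_sum[symmetric]) auto
  also have "\<dots> = (\<integral>\<^sup>+\<omega>. ennreal ((\<Sum>k\<le>n. indicator (A k) \<omega>) * ?g \<omega>) \<partial>M)"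
    using g0 by (intro nn_integral_cong) (simp add: sum_ennreal sum_distrib_right)
  also have "\<dots> = (\<integral>\<^sup>+\<omega>. ennreal (indicator (space M) \<omega> * ?g \<omega>) \<partial>M)"
    by (simp only: indicator_UN_disjoint[OF finite_atMost A(2), symmetric] A(3))
  also have "\<dots> = (\<integral>\<^sup>+\<omega>. ennreal (indicator (space M) \<omega> * (exp (- (c\<^sup>2 * (t - t) / 2)) * claim_value \<sigma> c (T - t) (z + (W t \<omega> - W t \<omega>)))) \<partial>M)"
    using tT t sets.top[of "F t"] by (intro claim_value_martingale[symmetric] \<sigma> c) auto
  also have "\<dots> = (\<integral>\<^sup>+\<omega>. ennreal (claim_value \<sigma> c (T - t) z) \<partial>M)"
    by (intro nn_integral_cong) simp
  finally have "(\<integral>\<^sup>+\<omega>. ennreal (\<Sum>k\<le>n. indicator (A k) \<omega> * m k \<omega>) \<partial>M) = ennreal (claim_value \<sigma> c (T - t) z)"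
    by (simp add: emeasure_space_1)
  then show ?thesis
    unfolding m_def[symmetric] using mm AM m0
    by (intro has_bochner_integral_nn_integral borel_measurable_sum borel_measurable_times
        claim_value_nonneg[OF \<sigma> c] AE_I2 sum_nonneg mult_nonneg_nonneg) auto
qed

end

section \<open>Convergence to zero in probability\<close>

context prob_space
begin

definition vanishes :: "(nat \<Rightarrow> 'a \<Rightarrow> real) \<Rightarrow> bool" where
  "vanishes Y \<longleftrightarrow> (\<forall>n. Y n \<in> borel_measurable M) \<and>
     (\<forall>e>0. (\<lambda>n. prob {\<omega> \<in> space M. e < \<bar>Y n \<omega>\<bar>}) \<longlonglongrightarrow> 0)"

lemma vanishes_AE:
  assumes [measurable]: "\<And>n. Y n \<in> borel_measurable M"
    and lim: "AE \<omega> in M. (\<lambda>n. Y n \<omega>) \<longlonglongrightarrow> 0"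
  shows "vanishes Y"
  unfolding vanishes_def
proof (intro conjI allI impI)
  fix e :: real assume "0 < e"
  have "(\<lambda>n. \<integral>\<omega>. indicator {\<omega> \<in> space M. e < \<bar>Y n \<omega>\<bar>} \<omega> \<partial>M) \<longlonglongrightarrow> (\<integral>\<omega>. (0::real) \<partial>M)"
  proof (rule integral_dominated_convergence[where w = "\<lambda>_. 1"])
    show "AE \<omega> in M. (\<lambda>n. indicator {\<omega> \<in> space M. e < \<bar>Y n \<omega>\<bar>} \<omega>) \<longlonglongrightarrow> (0::real)"
      using lim
    proof eventually_elim
      case (elim \<omega>)
      have "eventually (\<lambda>n. \<bar>Y n \<omega>\<bar> < e) sequentially"
        using tendstoD[OF elim \<open>0 < e\<close>] by (simp add: dist_real_def)
      then show ?case
        by (intro tendsto_eventually) (auto elim!: eventually_mono)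
    qed
  qed (auto intro!: AE_I2 simp: indicator_def)
  then show "(\<lambda>n. prob {\<omega> \<in> space M. e < \<bar>Y n \<omega>\<bar>}) \<longlonglongrightarrow> 0" by simp
qed fact

lemma vanishes_add:
  assumes Y: "vanishes Y" and Z: "vanishes Z"
  shows "vanishes (\<lambda>n \<omega>. Y n \<omega> + Z n \<omega>)"
  unfolding vanishes_def
proof (intro conjI allI impI)
  have [measurable]: "\<And>n. Y n \<in> borel_measurable M" "\<And>n. Z n \<in> borel_measurable M"
    using Y Z by (auto simp: vanishes_def)
  show "(\<lambda>\<omega>. Y n \<omega> + Z n \<omega>) \<in> borel_measurable M" for n by measurable
  fix e :: real assume "0 < e"
  show "(\<lambda>n. prob {\<omega> \<in> space M. e < \<bar>Y n \<omega> + Z n \<omega>\<bar>}) \<longlonglongrightarrow> 0"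
  proof (rule tendsto_sandwich[OF _ _ tendsto_const])
    show "(\<lambda>n. prob {\<omega> \<in> space M. e / 2 < \<bar>Y n \<omega>\<bar>} + prob {\<omega> \<in> space M. e / 2 < \<bar>Z n \<omega>\<bar>}) \<longlonglongrightarrow> 0"
      using Y Z \<open>0 < e\<close> unfolding vanishes_def
      by (intro tendsto_add_zero) (simp_all only: half_gt_zero)
    show "\<forall>\<^sub>F n in sequentially. prob {\<omega> \<in> space M. e < \<bar>Y n \<omega> + Z n \<omega>\<bar>}
        \<le> prob {\<omega> \<in> space M. e / 2 < \<bar>Y n \<omega>\<bar>} + prob {\<omega> \<in> space M. e / 2 < \<bar>Z n \<omega>\<bar>}"
      by (intro always_eventually allI order_trans[OF finite_measure_mono measure_Un_le]) auto
  qed auto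
qed

text \<open>The threshold \<open>h\<close> may depend on \<open>e\<close> and \<open>d\<close> but
  not on \<open>n\<close>. Lenglart's inequality delivers this shape: an arbitrarily small error
  plus the probability that a dominating variable is large.\<close>

lemma vanishes_domination:
  assumes Y: "\<And>n. Y n \<in> borel_measurable M" and Q: "vanishes Q"
    and dom: "\<And>e d. 0 < e \<Longrightarrow> 0 < d \<Longrightarrow> \<exists>h>0. \<forall>n.
      prob {\<omega> \<in> space M. e < \<bar>Y n \<omega>\<bar>} \<le> d + prob {\<omega> \<in> space M. h < \<bar>Q n \<omega>\<bar>}"
  shows "vanishes Y"
  unfolding vanishes_def
proof (intro conjI allI impI)
  fix e :: real assume e: "0 < e"
  show "(\<lambda>n. prob {\<omega> \<in> space M. e < \<bar>Y n \<omega>\<bar>}) \<longlonglongrightarrow> 0"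
  proof (rule LIMSEQ_I)
    fix d :: real assume "0 < d"
    then obtain h where h: "0 < h" and
      le: "\<And>n. prob {\<omega> \<in> space M. e < \<bar>Y n \<omega>\<bar>} \<le> d / 2 + prob {\<omega> \<in> space M. h < \<bar>Q n \<omega>\<bar>}"
      using dom[OF e, of "d / 2"] by auto
    have "(\<lambda>n. prob {\<omega> \<in> space M. h < \<bar>Q n \<omega>\<bar>}) \<longlonglongrightarrow> 0"
      using Q h by (simp add: vanishes_def)
    from LIMSEQ_D[OF this, of "d / 2"] \<open>0 < d\<close> obtain N where
      "\<And>n. N \<le> n \<Longrightarrow> prob {\<omega> \<in> space M. h < \<bar>Q n \<omega>\<bar>} < d / 2" by auto
    then show "\<exists>N. \<forall>n\<ge>N. norm (prob {\<omega> \<in> space M. e < \<bar>Y n \<omega>\<bar>} - 0) < d"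
      using le by (intro exI[of _ N]) (fastforce simp: intro: le_less_trans)
  qed
qed fact

lemma vanishes_const_AE:
  assumes "vanishes (\<lambda>_. Y)"
  shows "AE \<omega> in M. Y \<omega> = 0"
proof -
  have [measurable]: "Y \<in> borel_measurable M" using assms by (simp add: vanishes_def)
  have "AE \<omega> in M. \<not> inverse (real (Suc n)) < \<bar>Y \<omega>\<bar>" for n
  proof -
    have "(\<lambda>_::nat. prob {\<omega> \<in> space M. inverse (real (Suc n)) < \<bar>Y \<omega>\<bar>}) \<longlonglongrightarrow> 0"
      using assms by (simp add: vanishes_def)
    then have "prob {\<omega> \<in> space M. inverse (real (Suc n)) < \<bar>Y \<omega>\<bar>} = 0"
      by (simp add: LIMSEQ_const_iff)
    then show ?thesis by (subst (asm) prob_eq_0) auto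
  qed
  then have "AE \<omega> in M. \<forall>n. \<not> inverse (real (Suc n)) < \<bar>Y \<omega>\<bar>"
    by (simp add: AE_all_countable)
  then show ?thesis
  proof eventually_elim
    case (elim \<omega>)
    show ?case
    proof (rule ccontr)
      assume "Y \<omega> \<noteq> 0"
      then obtain n where "inverse (real (Suc n)) < \<bar>Y \<omega>\<bar>"
        using reals_Archimedean[of "\<bar>Y \<omega>\<bar>"] by auto
      with elim show False by auto
    qed
  qed
qed

lemma prob_markov:
  assumes "integrable M Y" "AE \<omega> in M. 0 \<le> Y \<omega>" "(\<integral>\<omega>. Y \<omega> \<partial>M) \<le> c" "0 < e"
  shows "prob {\<omega> \<in> space M. e < Y \<omega>} \<le> c / e"
proof -
  have [measurable]: "Y \<in> borel_measurable M" using assms(1) by auto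
  have "prob {\<omega> \<in> space M. e < Y \<omega>} \<le> prob {\<omega> \<in> space M. e \<le> Y \<omega>}"
    by (intro finite_measure_mono) auto
  also have "\<dots> \<le> (\<integral>\<omega>. Y \<omega> \<partial>M) / e"
    using assms by (intro integral_Markov_inequality_measure[where A = "space M" and u = Y]) auto
  also have "\<dots> \<le> c / e" using assms by (intro divide_right_mono) auto
  finally show ?thesis .
qed

end

section \<open>A domination inequality for discrete stochastic integrals\<close>

context brownian
begin

text \<open>In the expanded square, the later of two distinct increments is centred and independent
  of the rest of the product, so only the diagonal contributes. The order is expressed by
  disjointness of intervals over an arbitrary index set, because the common refinement of two grids
  is indexed by pairs. Bounded coefficients make the mixed products integrable.\<close>

lemma orthogonal_increments:
  fixes a b v :: "'i \<Rightarrow> real" and \<zeta> :: "'i \<Rightarrow> 'a \<Rightarrow> real" and \<phi> :: "'i \<Rightarrow> real \<Rightarrow> real"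
  defines "d \<equiv> \<lambda>j \<omega>. \<phi> j (W (b j) \<omega> - W (a j) \<omega>)"
  assumes fin: "finite J"
    and ab: "\<And>j. j \<in> J \<Longrightarrow> 0 \<le> a j \<and> a j < b j"
    and sep: "\<And>i j. i \<in> J \<Longrightarrow> j \<in> J \<Longrightarrow> i \<noteq> j \<Longrightarrow> b i \<le> a j \<or> b j \<le> a i"
    and \<zeta>: "\<And>j. j \<in> J \<Longrightarrow> \<zeta> j \<in> borel_measurable (F (a j))"
    and bdd: "\<And>j. j \<in> J \<Longrightarrow> \<exists>C. \<forall>\<omega>\<in>space M. \<bar>\<zeta> j \<omega>\<bar> \<le> C"
    and \<phi>: "\<And>j. j \<in> J \<Longrightarrow> \<phi> j \<in> borel_measurable borel"
    and mean: "\<And>j. j \<in> J \<Longrightarrow> has_bochner_integral gauss (\<lambda>x. \<phi> j (sqrt (b j - a j) * x)) 0"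
    and var: "\<And>j. j \<in> J \<Longrightarrow> integrable gauss (\<lambda>x. (\<phi> j (sqrt (b j - a j) * x))\<^sup>2)"
      "\<And>j. j \<in> J \<Longrightarrow> (\<integral>x. (\<phi> j (sqrt (b j - a j) * x))\<^sup>2 \<partial>gauss) \<le> v j"
  shows "integrable M (\<lambda>\<omega>. (\<Sum>j\<in>J. \<zeta> j \<omega> * d j \<omega>)\<^sup>2)"
    and "(\<integral>\<omega>. (\<Sum>j\<in>J. \<zeta> j \<omega> * d j \<omega>)\<^sup>2 \<partial>M) \<le> (\<Sum>j\<in>J. v j * (\<integral>\<omega>. (\<zeta> j \<omega>)\<^sup>2 \<partial>M))"
proof -
  have dF: "d j \<in> borel_measurable (F s)" if "j \<in> J" "b j \<le> s" for j s
  proof -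
    have [measurable]: "W (b j) \<in> borel_measurable (F s)" "W (a j) \<in> borel_measurable (F s)" "\<phi> j \<in> borel_measurable borel"
      using that ab[OF that(1)] \<phi> by (auto intro!: W_F)
    show ?thesis unfolding d_def by measurable
  qed
  have dM: "d j \<in> borel_measurable M" if "j \<in> J" for j
    using dF[OF that order_refl] by (rule measurable_F_M)
  have \<zeta>M: "\<zeta> j \<in> borel_measurable M" if "j \<in> J" for j
    using \<zeta>[OF that] by (rule measurable_F_M)
  have bint: "integrable M (\<lambda>\<omega>. Z \<omega> * Y \<omega>)"
    if "integrable M Y" "Z \<in> borel_measurable M" "\<exists>C. \<forall>\<omega>\<in>space M. \<bar>Z \<omega>\<bar> \<le> C" for Z Y :: "'a \<Rightarrow> real"
  proof -
    from that(3) obtain C where C: "\<And>\<omega>. \<omega> \<in> space M \<Longrightarrow> \<bar>Z \<omega>\<bar> \<le> C" by auto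
    show ?thesis
    proof (rule Bochner_Integration.integrable_bound)
      show "integrable M (\<lambda>\<omega>. C * Y \<omega>)" using that(1) by (rule integrable_mult_right)
      show "AE \<omega> in M. norm (Z \<omega> * Y \<omega>) \<le> norm (C * Y \<omega>)"
        using C by (intro AE_I2) (auto simp: abs_mult intro!: mult_right_mono intro: order_trans[OF _ abs_ge_self])
      show "(\<lambda>\<omega>. Z \<omega> * Y \<omega>) \<in> borel_measurable M" using that by auto
    qed
  qed
  have bdd2: "\<exists>C. \<forall>\<omega>\<in>space M. \<bar>\<zeta> i \<omega> * \<zeta> j \<omega>\<bar> \<le> C" if "i \<in> J" "j \<in> J" for i j
  proof -
    from bdd[OF that(1)] bdd[OF that(2)] obtain C D where "\<And>\<omega>. \<omega> \<in> space M \<Longrightarrow> \<bar>\<zeta> i \<omega>\<bar> \<le> C" "\<And>\<omega>. \<omega> \<in> space M \<Longrightarrow> \<bar>\<zeta> j \<omega>\<bar> \<le> D"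
      by auto
    then show ?thesis by (intro exI[of _ "C * D"]) (auto simp: abs_mult intro!: mult_mono intro: order_trans[OF abs_ge_zero])
  qed
  have di: "integrable M (d j)" if "j \<in> J" for j
    using mean[OF that] ab[OF that] \<phi>[OF that] unfolding d_def
    by (subst increment_integral) (auto simp: has_bochner_integral_iff)
  have off: "integrable M (\<lambda>\<omega>. \<zeta> i \<omega> * d i \<omega> * (\<zeta> j \<omega> * d j \<omega>)) \<and> (\<integral>\<omega>. \<zeta> i \<omega> * d i \<omega> * (\<zeta> j \<omega> * d j \<omega>) \<partial>M) = 0"
    if ij: "i \<in> J" "j \<in> J" "b i \<le> a j" for i j
  proof -
    have ai: "a i \<le> a j" using ab[OF ij(1)] ij(3) by simp
    have [measurable]: "\<zeta> i \<in> borel_measurable (F (a j))" "d i \<in> borel_measurable (F (a j))" "\<zeta> j \<in> borel_measurable (F (a j))"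
      using ij dF ai by (auto intro: measurable_F_mono \<zeta>)
    have Z: "(\<lambda>\<omega>. \<zeta> i \<omega> * \<zeta> j \<omega> * d i \<omega>) \<in> borel_measurable (F (a j))" by measurable
    have Zi: "integrable M (\<lambda>\<omega>. \<zeta> i \<omega> * \<zeta> j \<omega> * d i \<omega>)"
      using ij by (intro bint di bdd2 borel_measurable_times \<zeta>M)
    have eq: "\<zeta> i \<omega> * d i \<omega> * (\<zeta> j \<omega> * d j \<omega>) = (\<zeta> i \<omega> * \<zeta> j \<omega> * d i \<omega>) * \<phi> j (W (b j) \<omega> - W (a j) \<omega>)" for \<omega>
      by (simp add: d_def)
    have mj: "integrable gauss (\<lambda>x. \<phi> j (sqrt (b j - a j) * x))" "(\<integral>x. \<phi> j (sqrt (b j - a j) * x) \<partial>gauss) = 0"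
      using mean[OF ij(2)] by (auto simp: has_bochner_integral_iff)
    show ?thesis unfolding eq
      using increment_product[of "a j" "b j" "\<phi> j", OF _ _ \<phi>[OF ij(2)] Z Zi mj(1)] ab[OF ij(2)] mj(2) by simp
  qed
  have dia: "integrable M (\<lambda>\<omega>. \<zeta> j \<omega> * d j \<omega> * (\<zeta> j \<omega> * d j \<omega>)) \<and>
      (\<integral>\<omega>. \<zeta> j \<omega> * d j \<omega> * (\<zeta> j \<omega> * d j \<omega>) \<partial>M) \<le> v j * (\<integral>\<omega>. (\<zeta> j \<omega>)\<^sup>2 \<partial>M)" if j: "j \<in> J" for j
  proof -
    have Z: "(\<lambda>\<omega>. (\<zeta> j \<omega>)\<^sup>2) \<in> borel_measurable (F (a j))" using \<zeta>[OF j] by measurable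
    have "integrable M (\<lambda>\<omega>. \<zeta> j \<omega> * \<zeta> j \<omega> * 1)"
      using j by (intro bint bdd2 borel_measurable_times \<zeta>M) auto
    then have Zi: "integrable M (\<lambda>\<omega>. (\<zeta> j \<omega>)\<^sup>2)" by (simp add: power2_eq_square)
    have eq: "\<zeta> j \<omega> * d j \<omega> * (\<zeta> j \<omega> * d j \<omega>) = (\<zeta> j \<omega>)\<^sup>2 * (\<phi> j (W (b j) \<omega> - W (a j) \<omega>))\<^sup>2" for \<omega>
      by (simp add: d_def power2_eq_square)
    have "(\<lambda>x. (\<phi> j x)\<^sup>2) \<in> borel_measurable borel" using \<phi>[OF j] by measurable
    note P = increment_product[of "a j" "b j" "\<lambda>x. (\<phi> j x)\<^sup>2", OF _ _ this Z Zi var(1)[OF j]]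
    have "(\<integral>\<omega>. (\<zeta> j \<omega>)\<^sup>2 \<partial>M) * (\<integral>x. (\<phi> j (sqrt (b j - a j) * x))\<^sup>2 \<partial>gauss) \<le> (\<integral>\<omega>. (\<zeta> j \<omega>)\<^sup>2 \<partial>M) * v j"
      by (intro mult_left_mono var j) simp
    then show ?thesis unfolding eq using P ab[OF j] by (simp add: mult.commute)
  qed
  have all: "integrable M (\<lambda>\<omega>. \<zeta> i \<omega> * d i \<omega> * (\<zeta> j \<omega> * d j \<omega>)) \<and>
      (\<integral>\<omega>. \<zeta> i \<omega> * d i \<omega> * (\<zeta> j \<omega> * d j \<omega>) \<partial>M) \<le> (if i = j then v j * (\<integral>\<omega>. (\<zeta> j \<omega>)\<^sup>2 \<partial>M) else 0)"
    if "i \<in> J" "j \<in> J" for i j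
    using dia[of j] off[of i j] off[of j i] sep[of i j] that by (auto simp: mult.commute)
  have sq: "(\<Sum>j\<in>J. \<zeta> j \<omega> * d j \<omega>)\<^sup>2 = (\<Sum>i\<in>J. \<Sum>j\<in>J. \<zeta> i \<omega> * d i \<omega> * (\<zeta> j \<omega> * d j \<omega>))" for \<omega>
    by (simp add: power2_eq_square sum_product)
  show "integrable M (\<lambda>\<omega>. (\<Sum>j\<in>J. \<zeta> j \<omega> * d j \<omega>)\<^sup>2)"
    unfolding sq using all by (intro Bochner_Integration.integrable_sum) auto
  have "(\<integral>\<omega>. (\<Sum>j\<in>J. \<zeta> j \<omega> * d j \<omega>)\<^sup>2 \<partial>M) = (\<Sum>i\<in>J. \<Sum>j\<in>J. \<integral>\<omega>. \<zeta> i \<omega> * d i \<omega> * (\<zeta> j \<omega> * d j \<omega>) \<partial>M)"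
    unfolding sq using all by (simp add: Bochner_Integration.integral_sum)
  also have "\<dots> \<le> (\<Sum>i\<in>J. \<Sum>j\<in>J. if i = j then v j * (\<integral>\<omega>. (\<zeta> j \<omega>)\<^sup>2 \<partial>M) else 0)"
    using all by (intro sum_mono) auto
  also have "\<dots> = (\<Sum>j\<in>J. v j * (\<integral>\<omega>. (\<zeta> j \<omega>)\<^sup>2 \<partial>M))"
    using fin by (simp add: sum.delta)
  finally show "(\<integral>\<omega>. (\<Sum>j\<in>J. \<zeta> j \<omega> * d j \<omega>)\<^sup>2 \<partial>M) \<le> (\<Sum>j\<in>J. v j * (\<integral>\<omega>. (\<zeta> j \<omega>)\<^sup>2 \<partial>M))" .
qed

text \<open>Lenglart's inequality, obtained by switching the integrand off as soon as its bracket exceeds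
  \<open>\<eta>\<close>. The blocks \<open>\<kappa>\<close> allow to control a discrete quadratic variation as well.\<close>

lemma lenglart:
  fixes a b v :: "'i \<Rightarrow> real" and \<zeta> :: "'i \<Rightarrow> 'a \<Rightarrow> real" and \<phi> :: "'i \<Rightarrow> real \<Rightarrow> real" and \<kappa> :: "'i \<Rightarrow> nat"
  defines "d \<equiv> \<lambda>j \<omega>. \<phi> j (W (b j) \<omega> - W (a j) \<omega>)"
  assumes fin: "finite J"
    and ab: "\<And>j. j \<in> J \<Longrightarrow> 0 \<le> a j \<and> a j < b j"
    and sep: "\<And>i j. i \<in> J \<Longrightarrow> j \<in> J \<Longrightarrow> i \<noteq> j \<Longrightarrow> b i \<le> a j \<or> b j \<le> a i"
    and \<zeta>: "\<And>j. j \<in> J \<Longrightarrow> \<zeta> j \<in> borel_measurable (F (a j))"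
    and \<phi>: "\<And>j. j \<in> J \<Longrightarrow> \<phi> j \<in> borel_measurable borel"
    and mean: "\<And>j. j \<in> J \<Longrightarrow> has_bochner_integral gauss (\<lambda>x. \<phi> j (sqrt (b j - a j) * x)) 0"
    and var: "\<And>j. j \<in> J \<Longrightarrow> integrable gauss (\<lambda>x. (\<phi> j (sqrt (b j - a j) * x))\<^sup>2)"
      "\<And>j. j \<in> J \<Longrightarrow> (\<integral>x. (\<phi> j (sqrt (b j - a j) * x))\<^sup>2 \<partial>gauss) \<le> v j"
    and v: "\<And>j. j \<in> J \<Longrightarrow> 0 < v j" and \<kappa>: "\<And>j. j \<in> J \<Longrightarrow> \<kappa> j < m"
    and "0 < e" "0 < \<eta>"
  shows "prob {\<omega> \<in> space M. e < (\<Sum>k<m. (\<Sum>j | j \<in> J \<and> \<kappa> j = k. \<zeta> j \<omega> * d j \<omega>)\<^sup>2)}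
    \<le> \<eta> / e + prob {\<omega> \<in> space M. \<eta> < (\<Sum>j\<in>J. v j * (\<zeta> j \<omega>)\<^sup>2)}"
proof -
  \<comment> \<open>The bracket includes step \<open>j\<close> itself: \<open>\<zeta> j\<close> is
    known at time \<open>a j\<close>, so the switch is still predictable, and the bracket of the
    switched integrand never overshoots \<open>\<eta>\<close>. This also bounds each switched
    coefficient, as \<open>orthogonal_increments\<close> requires.\<close>
  define q where "q j \<omega> = (\<Sum>i | i \<in> J \<and> a i \<le> a j. v i * (\<zeta> i \<omega>)\<^sup>2)" for j \<omega>
  define z where "z j \<omega> = (if q j \<omega> \<le> \<eta> then \<zeta> j \<omega> else 0)" for j \<omega>
  have vn: "0 \<le> v j * x\<^sup>2" if "j \<in> J" for j x
    using v[OF that] by simp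
  have term_le: "v j * (\<zeta> j \<omega>)\<^sup>2 \<le> q j \<omega>" if "j \<in> J" for j \<omega>
  proof -
    have "(\<Sum>i\<in>{j}. v i * (\<zeta> i \<omega>)\<^sup>2) \<le> q j \<omega>"
      unfolding q_def using that fin v by (intro sum_mono2) (auto intro: vn)
    then show ?thesis by simp
  qed
  have zF: "z j \<in> borel_measurable (F (a j))" if "j \<in> J" for j
  proof -
    have [measurable]: "\<zeta> i \<in> borel_measurable (F (a j))" if "i \<in> J" "a i \<le> a j" for i
      using that by (auto intro: measurable_F_mono \<zeta>)
    have "q j \<in> borel_measurable (F (a j))" unfolding q_def by measurable
    then show ?thesis unfolding z_def using \<zeta>[OF that] by measurable
  qed
  have zM: "z j \<in> borel_measurable M" if "j \<in> J" for j
    using zF[OF that] by (rule measurable_F_M)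
  have \<zeta>M: "\<zeta> j \<in> borel_measurable M" if "j \<in> J" for j
    using \<zeta>[OF that] by (rule measurable_F_M)
  have dM: "d j \<in> borel_measurable M" if "j \<in> J" for j
  proof -
    have [measurable]: "W (b j) \<in> borel_measurable M" "W (a j) \<in> borel_measurable M" "\<phi> j \<in> borel_measurable borel"
      using ab[OF that] \<phi>[OF that] by (auto intro!: W_M)
    show ?thesis unfolding d_def by measurable
  qed
  have zb: "\<exists>C. \<forall>\<omega>\<in>space M. \<bar>z j \<omega>\<bar> \<le> C" if "j \<in> J" for j
  proof (intro exI ballI)
    fix \<omega>
    have "(z j \<omega>)\<^sup>2 \<le> \<eta> / v j"
    proof (cases "q j \<omega> \<le> \<eta>")
      case True
      then have "v j * (\<zeta> j \<omega>)\<^sup>2 \<le> \<eta>" using term_le[OF that, of \<omega>] by simp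
      then show ?thesis using v[OF that] True by (simp add: z_def field_simps)
    next
      case False
      then show ?thesis using v[OF that] \<open>0 < \<eta>\<close> by (simp add: z_def)
    qed
    then show "\<bar>z j \<omega>\<bar> \<le> sqrt (\<eta> / v j)"
      by (rule real_le_rsqrt[of "\<bar>z j \<omega>\<bar>", simplified])
  qed
  have tot: "(\<Sum>j\<in>J. v j * (z j \<omega>)\<^sup>2) \<le> \<eta>" for \<omega>
  proof (cases "\<exists>j\<in>J. q j \<omega> \<le> \<eta>")
    case False
    then have "(\<Sum>j\<in>J. v j * (z j \<omega>)\<^sup>2) = 0" by (intro sum.neutral) (auto simp: z_def)
    then show ?thesis using \<open>0 < \<eta>\<close> by simp
  next
    case True
    \<comment> \<open>The latest index still switched on has all the other switched-on terms in its
      own \<open>q\<close>.\<close>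
    let ?G = "{j \<in> J. q j \<omega> \<le> \<eta>}"
    have G: "finite ?G" "?G \<noteq> {}" using fin True by auto
    have "Max (a ` ?G) \<in> a ` ?G" using G by (intro Max_in) auto
    then obtain l where l0: "l \<in> ?G" "a l = Max (a ` ?G)" by auto
    have l: "l \<in> ?G" "\<And>j. j \<in> ?G \<Longrightarrow> a j \<le> a l"
      using G l0 by (auto intro: Max_ge)
    have "(\<Sum>j\<in>J. v j * (z j \<omega>)\<^sup>2) = (\<Sum>j\<in>?G. v j * (\<zeta> j \<omega>)\<^sup>2)"
      using fin by (intro sum.mono_neutral_cong_right) (auto simp: z_def)
    also have "\<dots> \<le> q l \<omega>"
      unfolding q_def[of l] using l fin v by (intro sum_mono2) (auto intro: vn)
    also have "\<dots> \<le> \<eta>" using l by auto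
    finally show ?thesis .
  qed
  let ?J = "\<lambda>k. {j \<in> J. \<kappa> j = k}"
  let ?S = "\<lambda>\<zeta> \<omega>. \<Sum>k<m. (\<Sum>j\<in>?J k. \<zeta> j \<omega> * d j \<omega>)\<^sup>2"
  have L2: "integrable M (\<lambda>\<omega>. (\<Sum>j\<in>?J k. z j \<omega> * d j \<omega>)\<^sup>2)"
    "(\<integral>\<omega>. (\<Sum>j\<in>?J k. z j \<omega> * d j \<omega>)\<^sup>2 \<partial>M) \<le> (\<Sum>j\<in>?J k. v j * (\<integral>\<omega>. (z j \<omega>)\<^sup>2 \<partial>M))" for k
    unfolding d_def
    by (rule orthogonal_increments; use fin ab sep zF zb \<phi> mean var in auto)+
  have z2i: "integrable M (\<lambda>\<omega>. (z j \<omega>)\<^sup>2)" if "j \<in> J" for j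
  proof -
    from zb[OF that] obtain C where C: "\<And>\<omega>. \<omega> \<in> space M \<Longrightarrow> \<bar>z j \<omega>\<bar> \<le> C" by auto
    show ?thesis
    proof (rule integrable_const_bound[where B = "C\<^sup>2"])
      show "AE \<omega> in M. norm ((z j \<omega>)\<^sup>2) \<le> C\<^sup>2"
        using C by (intro AE_I2) (auto simp: abs_le_square_iff[symmetric] intro: order_trans[OF _ abs_ge_self])
    qed (use zM[OF that] in measurable)
  qed
  have "(\<integral>\<omega>. ?S z \<omega> \<partial>M) = (\<Sum>k<m. \<integral>\<omega>. (\<Sum>j\<in>?J k. z j \<omega> * d j \<omega>)\<^sup>2 \<partial>M)"
    using L2 by (intro Bochner_Integration.integral_sum) auto
  also have "\<dots> \<le> (\<Sum>k<m. \<Sum>j\<in>?J k. v j * (\<integral>\<omega>. (z j \<omega>)\<^sup>2 \<partial>M))"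
    using L2 by (intro sum_mono) auto
  also have "\<dots> = (\<Sum>j\<in>J. v j * (\<integral>\<omega>. (z j \<omega>)\<^sup>2 \<partial>M))"
    using fin \<kappa> by (intro sum.group) auto
  also have "\<dots> = (\<integral>\<omega>. (\<Sum>j\<in>J. v j * (z j \<omega>)\<^sup>2) \<partial>M)"
    using z2i by (subst Bochner_Integration.integral_sum) auto
  also have "\<dots> \<le> (\<integral>\<omega>. \<eta> \<partial>M)"
    using z2i tot by (intro integral_mono Bochner_Integration.integrable_sum) auto
  finally have E: "(\<integral>\<omega>. ?S z \<omega> \<partial>M) \<le> \<eta>" by (simp add: prob_space)
  have [measurable]: "?S z \<in> borel_measurable M" "?S \<zeta> \<in> borel_measurable M"
    "(\<lambda>\<omega>. \<Sum>j\<in>J. v j * (\<zeta> j \<omega>)\<^sup>2) \<in> borel_measurable M"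
    using zM \<zeta>M dM by (auto intro!: borel_measurable_sum borel_measurable_power borel_measurable_times)
  have "prob {\<omega> \<in> space M. e < ?S z \<omega>} \<le> \<eta> / e"
    using E \<open>0 < e\<close> L2 by (intro prob_markov Bochner_Integration.integrable_sum AE_I2 sum_nonneg) auto
  \<comment> \<open>Where the full bracket is at most \<open>\<eta>\<close>, nothing has been
    switched off and the two sums coincide.\<close>
  moreover have "prob {\<omega> \<in> space M. e < ?S \<zeta> \<omega>}
      \<le> prob ({\<omega> \<in> space M. e < ?S z \<omega>} \<union> {\<omega> \<in> space M. \<eta> < (\<Sum>j\<in>J. v j * (\<zeta> j \<omega>)\<^sup>2)})"
  proof (intro finite_measure_mono subsetI)
    fix \<omega> assume \<omega>: "\<omega> \<in> {\<omega> \<in> space M. e < ?S \<zeta> \<omega>}"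
    show "\<omega> \<in> {\<omega> \<in> space M. e < ?S z \<omega>} \<union> {\<omega> \<in> space M. \<eta> < (\<Sum>j\<in>J. v j * (\<zeta> j \<omega>)\<^sup>2)}"
    proof (cases "\<eta> < (\<Sum>j\<in>J. v j * (\<zeta> j \<omega>)\<^sup>2)")
      case False
      have "q j \<omega> \<le> (\<Sum>j\<in>J. v j * (\<zeta> j \<omega>)\<^sup>2)" if "j \<in> J" for j
        unfolding q_def using fin v by (intro sum_mono2) (auto intro: vn)
      then have "z j \<omega> = \<zeta> j \<omega>" if "j \<in> J" for j
        using False that by (force simp: z_def)
      then have "?S z \<omega> = ?S \<zeta> \<omega>" by (intro sum.cong refl arg_cong[where f = "\<lambda>x. x\<^sup>2"]) auto
      then show ?thesis using \<omega> by simp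
    qed (use \<omega> in auto)
  qed auto
  ultimately show ?thesis
    using measure_Un_le[of "{\<omega> \<in> space M. e < ?S z \<omega>}" M "{\<omega> \<in> space M. \<eta> < (\<Sum>j\<in>J. v j * (\<zeta> j \<omega>)\<^sup>2)}"]
    by simp
qed

end

section \<open>Approximation of the Ito integral along a sequence of grids\<close>

text \<open>The function \<open>exp (- y) * (1 + y)\<close> is 1 at 0 and its derivative
  \<open>- y * exp (- y)\<close> vanishes there, so replacing \<open>exp y\<close> by
  \<open>1 + y\<close> has a relative error of second order. The convergence along grids rests on
  this order.\<close>

lemma abs_exp_minus_1_le: "\<bar>exp (- y) * (1 + y) - 1\<bar> \<le> y\<^sup>2 * exp \<bar>y\<bar>" for y :: real
proof -
  let ?f = "\<lambda>y::real. exp (- y) * (1 + y)"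
  have der: "(?f has_real_derivative - (z * exp (- z))) (at z)" for z
    by (auto intro!: derivative_eq_intros simp: algebra_simps)
  have bound: "\<bar>y * (z * exp (- z))\<bar> \<le> y\<^sup>2 * exp \<bar>y\<bar>" if "\<bar>z\<bar> \<le> \<bar>y\<bar>" for z
  proof -
    have "\<bar>z\<bar> * exp (- z) \<le> \<bar>y\<bar> * exp \<bar>y\<bar>"
      using that by (intro mult_mono) auto
    then have "\<bar>y\<bar> * (\<bar>z\<bar> * exp (- z)) \<le> \<bar>y\<bar> * (\<bar>y\<bar> * exp \<bar>y\<bar>)"
      by (intro mult_left_mono) auto
    also have "\<dots> = y\<^sup>2 * exp \<bar>y\<bar>"
      by (simp add: power2_eq_square flip: mult.assoc)
    finally show ?thesis by (simp add: abs_mult)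
  qed
  show ?thesis
  proof (cases y "0::real" rule: linorder_cases)
    case less
    then obtain z where z: "y < z" "z < 0" "?f 0 - ?f y = (0 - y) * - (z * exp (- z))"
      using MVT2[of y 0 ?f "\<lambda>z. - (z * exp (- z))"] der by blast
    then have "\<bar>?f y - 1\<bar> = \<bar>y * (z * exp (- z))\<bar>" by simp
    then show ?thesis using bound[of z] z by simp
  next
    case greater
    then obtain z where z: "0 < z" "z < y" "?f y - ?f 0 = (y - 0) * - (z * exp (- z))"
      using MVT2[of 0 y ?f "\<lambda>z. - (z * exp (- z))"] der by blast
    then have "\<bar>?f y - 1\<bar> = \<bar>y * (z * exp (- z))\<bar>" by simp
    then show ?thesis using bound[of z] z by simp
  qed simp
qed

lemma exp_minus_1_le: "exp w - 1 \<le> w * exp w" for w :: real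
proof -
  have "(1 - w) * exp w \<le> exp (- w) * exp w"
    using exp_ge_add_one_self[of "- w"] by (intro mult_right_mono) auto
  also have "\<dots> = 1" by (simp flip: exp_add)
  finally show ?thesis by (simp add: algebra_simps)
qed

text \<open>In one step of length \<open>h\<close> with increment \<open>y\<close> of \<open>W\<close>, the solution is multiplied by about
  \<open>1 + \<sigma> y\<close> and the explicit solution by \<open>exp (\<sigma> y - \<sigma>\<^sup>2 h / 2)\<close>. The quotient minus \<open>1\<close> is
  split into its mean, of order \<open>h\<^sup>2\<close>, and a centred error.\<close>

definition step_mean :: "real \<Rightarrow> real \<Rightarrow> real" where
  "step_mean \<sigma> h = exp (\<sigma>\<^sup>2 * h) * (1 - \<sigma>\<^sup>2 * h) - 1"

definition step_error :: "real \<Rightarrow> real \<Rightarrow> real \<Rightarrow> real" where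
  "step_error \<sigma> h y = exp (\<sigma>\<^sup>2 * h / 2 - \<sigma> * y) * (1 + \<sigma> * y) - 1 - step_mean \<sigma> h"

lemma step_mean_le:
  assumes "0 \<le> h" "h \<le> T"
  shows "\<bar>step_mean \<sigma> h\<bar> \<le> \<sigma> ^ 4 * exp (\<sigma>\<^sup>2 * T) * h\<^sup>2"
proof -
  have "\<bar>step_mean \<sigma> h\<bar> \<le> (\<sigma>\<^sup>2 * h)\<^sup>2 * exp (\<sigma>\<^sup>2 * h)"
    using abs_exp_minus_1_le[of "- (\<sigma>\<^sup>2 * h)"] assms by (simp add: step_mean_def)
  also have "\<dots> \<le> (\<sigma>\<^sup>2 * h)\<^sup>2 * exp (\<sigma>\<^sup>2 * T)"
    using assms by (intro mult_left_mono) (auto intro: mult_left_mono)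
  finally show ?thesis by (simp add: power_mult_distrib algebra_simps flip: power_mult)
qed

lemma gauss_const: "has_bochner_integral gauss (\<lambda>_. c) c" for c :: real
  using gauss.prob_space by (simp add: has_bochner_integral_iff)

text \<open>With \<open>k = - (\<sigma> * sqrt h)\<close>, the moments of \<open>exp (k * x)\<close>
  and \<open>x * exp (k * x)\<close> contribute \<open>exp (\<sigma>\<^sup>2 * h)\<close> and
  \<open>\<sigma>\<^sup>2 * h * exp (\<sigma>\<^sup>2 * h)\<close>; this is where the formula for
  \<open>step_mean\<close> comes from.\<close>

lemma step_error_mean:
  assumes "0 \<le> h"
  shows "has_bochner_integral gauss (\<lambda>x. step_error \<sigma> h (sqrt h * x)) 0"
proof -
  let ?k = "- (\<sigma> * sqrt h)"
  have k: "?k\<^sup>2 = \<sigma>\<^sup>2 * h" using assms by (simp add: power_mult_distrib)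
  have "has_bochner_integral gauss
      (\<lambda>x. exp (\<sigma>\<^sup>2 * h / 2) * exp (?k * x) - exp (\<sigma>\<^sup>2 * h / 2) * ?k * (x * exp (?k * x)) - 1 - step_mean \<sigma> h)
      (exp (\<sigma>\<^sup>2 * h / 2) * exp (?k\<^sup>2 / 2) - exp (\<sigma>\<^sup>2 * h / 2) * ?k * (?k * exp (?k\<^sup>2 / 2)) - 1 - step_mean \<sigma> h)"
    by (intro has_bochner_integral_diff has_bochner_integral_mult_right gauss_exp gauss_id_exp gauss_const)
  moreover have "exp (\<sigma>\<^sup>2 * h / 2) * exp (?k * x) - exp (\<sigma>\<^sup>2 * h / 2) * ?k * (x * exp (?k * x)) - 1 - step_mean \<sigma> h
      = step_error \<sigma> h (sqrt h * x)" for x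
  proof -
    have "exp (\<sigma>\<^sup>2 * h / 2) * exp (?k * x) = exp (\<sigma>\<^sup>2 * h / 2 - \<sigma> * (sqrt h * x))"
      by (simp add: mult.assoc flip: exp_add)
    then show ?thesis unfolding step_error_def by (simp add: algebra_simps)
  qed
  moreover have "exp (\<sigma>\<^sup>2 * h / 2) * exp (?k\<^sup>2 / 2) - exp (\<sigma>\<^sup>2 * h / 2) * ?k * (?k * exp (?k\<^sup>2 / 2)) - 1 - step_mean \<sigma> h = 0"
  proof -
    have "exp (\<sigma>\<^sup>2 * h / 2) * exp (?k\<^sup>2 / 2) = exp (\<sigma>\<^sup>2 * h)"
      unfolding k by (simp flip: exp_add)
    moreover have "exp (\<sigma>\<^sup>2 * h / 2) * ?k * (?k * exp (?k\<^sup>2 / 2)) = ?k\<^sup>2 * (exp (\<sigma>\<^sup>2 * h / 2) * exp (?k\<^sup>2 / 2))"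
      by (simp add: power2_eq_square)
    ultimately show ?thesis unfolding k step_mean_def by (simp add: algebra_simps)
  qed
  ultimately show ?thesis by simp
qed

text \<open>The order \<open>h\<^sup>2\<close> is the point: summed over the steps of a grid, whose
  number is of order \<open>1 / h\<close>, such variances still vanish.\<close>

lemma step_error_variance:
  assumes "0 \<le> T"
  obtains C where "0 < C"
    "\<And>h. 0 \<le> h \<Longrightarrow> h \<le> T \<Longrightarrow> integrable gauss (\<lambda>x. (step_error \<sigma> h (sqrt h * x))\<^sup>2)"
    "\<And>h. 0 \<le> h \<Longrightarrow> h \<le> T \<Longrightarrow> (\<integral>x. (step_error \<sigma> h (sqrt h * x))\<^sup>2 \<partial>gauss) \<le> C * h\<^sup>2"
proof -
  \<comment> \<open>\<open>A\<close> is the coefficient of the quartic term in the increment,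
    \<open>B\<close> that of \<open>h\<^sup>2\<close>; the factors 3 come from squaring a sum of
    three terms.\<close>
  define A where "A = 3 * exp (\<sigma>\<^sup>2 * T) * \<sigma> ^ 4"
  define B where "B = 3 * (\<sigma>\<^sup>2 * exp (\<sigma>\<^sup>2 * T))\<^sup>2 + 3 * (\<sigma> ^ 4 * exp (\<sigma>\<^sup>2 * T))\<^sup>2 * T\<^sup>2"
  let ?f = "\<lambda>h x. (sqrt h * x) ^ (2 * 2) * exp (2 * \<bar>\<sigma>\<bar> * \<bar>sqrt h * x\<bar>)"
  define K where "K = 2 * fact (2 * 2) * exp ((1 + 2 * \<bar>\<sigma>\<bar> * sqrt T)\<^sup>2 / 2)"
  have AB: "0 \<le> A" "0 \<le> B" "0 \<le> K" by (auto simp: A_def B_def K_def)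
  have pt: "(step_error \<sigma> h y)\<^sup>2 \<le> A * (y ^ 4 * exp (2 * \<bar>\<sigma>\<bar> * \<bar>y\<bar>)) + B * h\<^sup>2"
    if h: "0 \<le> h" "h \<le> T" for h y
  proof -
    define x where "x = \<sigma>\<^sup>2 * h"
    \<comment> \<open>\<open>a\<close> is the second-order Taylor error in the increment,
      \<open>b\<close> the Ito correction, of order \<open>h\<close>, and \<open>m\<close> the mean,
      of order \<open>h\<^sup>2\<close>.\<close>
    define a where "a = exp (x / 2) * (exp (- (\<sigma> * y)) * (1 + \<sigma> * y) - 1)"
    define b where "b = exp (x / 2) - 1"
    define m where "m = step_mean \<sigma> h"
    have xT: "x \<le> \<sigma>\<^sup>2 * T" "0 \<le> x" using h by (auto simp: x_def intro: mult_left_mono)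
    have eq: "step_error \<sigma> h y = a + b - m"
    proof -
      have "exp (\<sigma>\<^sup>2 * h / 2 - \<sigma> * y) = exp (x / 2) * exp (- (\<sigma> * y))"
        by (simp add: x_def flip: exp_add)
      then show ?thesis by (simp add: step_error_def a_def b_def m_def algebra_simps)
    qed
    have three: "(a + b - m)\<^sup>2 \<le> 3 * a\<^sup>2 + 3 * b\<^sup>2 + 3 * m\<^sup>2"
      using sum_squares_ge_zero[of "a - b" "a + m"] zero_le_power2[of "b + m"]
      by (simp add: power2_eq_square algebra_simps)
    have "\<bar>a\<bar> \<le> exp (x / 2) * ((\<sigma> * y)\<^sup>2 * exp \<bar>\<sigma> * y\<bar>)"
      unfolding a_def abs_mult[of "exp (x / 2)"] by (rule mult_mono[OF _ abs_exp_minus_1_le[of "\<sigma> * y"]]) simp_all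
    then have "a\<^sup>2 \<le> (exp (x / 2) * ((\<sigma> * y)\<^sup>2 * exp \<bar>\<sigma> * y\<bar>))\<^sup>2"
      by (metis abs_ge_zero power2_abs power_mono)
    also have "\<dots> = exp x * (\<sigma> ^ 4 * (y ^ 4 * exp (2 * \<bar>\<sigma>\<bar> * \<bar>y\<bar>)))"
    proof -
      have "(exp (x / 2))\<^sup>2 = exp x" "(exp \<bar>\<sigma> * y\<bar>)\<^sup>2 = exp (2 * \<bar>\<sigma>\<bar> * \<bar>y\<bar>)"
        by (simp_all add: abs_mult flip: exp_double)
      then show ?thesis by (simp add: power_mult_distrib flip: power_mult)
    qed
    also have "\<dots> \<le> exp (\<sigma>\<^sup>2 * T) * (\<sigma> ^ 4 * (y ^ 4 * exp (2 * \<bar>\<sigma>\<bar> * \<bar>y\<bar>)))"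
      using xT by (intro mult_right_mono) auto
    finally have a2: "3 * a\<^sup>2 \<le> A * (y ^ 4 * exp (2 * \<bar>\<sigma>\<bar> * \<bar>y\<bar>))"
      by (simp add: A_def mult.assoc)
    have "b \<le> x / 2 * exp (x / 2)" unfolding b_def by (rule exp_minus_1_le)
    also have "\<dots> \<le> x * exp (\<sigma>\<^sup>2 * T)" using xT by (intro mult_mono) auto
    finally have "b\<^sup>2 \<le> (x * exp (\<sigma>\<^sup>2 * T))\<^sup>2"
      using xT by (intro power_mono) (auto simp: b_def)
    then have b2: "3 * b\<^sup>2 \<le> 3 * (\<sigma>\<^sup>2 * exp (\<sigma>\<^sup>2 * T))\<^sup>2 * h\<^sup>2"
      by (simp add: x_def power_mult_distrib algebra_simps)
    have "\<bar>m\<bar> \<le> \<sigma> ^ 4 * exp (\<sigma>\<^sup>2 * T) * h\<^sup>2" unfolding m_def using h by (rule step_mean_le)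
    also have "\<dots> = \<sigma> ^ 4 * exp (\<sigma>\<^sup>2 * T) * h * h" by (simp add: power2_eq_square)
    also have "\<dots> \<le> \<sigma> ^ 4 * exp (\<sigma>\<^sup>2 * T) * T * h"
      using h by (intro mult_right_mono mult_left_mono) auto
    finally have "m\<^sup>2 \<le> (\<sigma> ^ 4 * exp (\<sigma>\<^sup>2 * T) * T * h)\<^sup>2"
      by (metis abs_ge_zero power2_abs power_mono)
    then have m2: "3 * m\<^sup>2 \<le> 3 * (\<sigma> ^ 4 * exp (\<sigma>\<^sup>2 * T))\<^sup>2 * T\<^sup>2 * h\<^sup>2"
      by (simp add: power_mult_distrib)
    show ?thesis unfolding eq using three a2 b2 m2 by (simp add: B_def distrib_right)
  qed
  have dom: "integrable gauss (\<lambda>x. A * ?f h x + B * h\<^sup>2)"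
    "(\<integral>x. A * ?f h x + B * h\<^sup>2 \<partial>gauss) \<le> (A * K + B + 1) * h\<^sup>2" if h: "0 \<le> h" "h \<le> T" for h
  proof -
    have l: "0 \<le> 2 * \<bar>\<sigma>\<bar>" by simp
    note mb = gauss_moment_bound[OF h l, of 2, folded K_def]
    show "integrable gauss (\<lambda>x. A * ?f h x + B * h\<^sup>2)"
      by (intro Bochner_Integration.integrable_add integrable_mult_right mb(1)) auto
    have "(\<integral>x. A * ?f h x + B * h\<^sup>2 \<partial>gauss) = A * (\<integral>x. ?f h x \<partial>gauss) + B * h\<^sup>2"
      using mb(1) gauss.prob_space by (subst Bochner_Integration.integral_add) auto
    also have "\<dots> \<le> A * (h\<^sup>2 * K) + B * h\<^sup>2"
      using mb(2) AB by (intro add_right_mono mult_left_mono) auto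
    also have "\<dots> \<le> (A * K + B + 1) * h\<^sup>2" by (simp add: algebra_simps)
    finally show "(\<integral>x. A * ?f h x + B * h\<^sup>2 \<partial>gauss) \<le> (A * K + B + 1) * h\<^sup>2" .
  qed
  have pt': "(step_error \<sigma> h (sqrt h * x))\<^sup>2 \<le> A * ?f h x + B * h\<^sup>2" if "0 \<le> h" "h \<le> T" for h x
    using pt[OF that, of "sqrt h * x"] by simp
  have [measurable]: "step_error \<sigma> h \<in> borel_measurable borel" for h
    unfolding step_error_def by measurable
  have int: "integrable gauss (\<lambda>x. (step_error \<sigma> h (sqrt h * x))\<^sup>2)" if "0 \<le> h" "h \<le> T" for h
    by (rule Bochner_Integration.integrable_bound[OF dom(1)[OF that]])
       (use pt'[OF that] in \<open>auto intro!: AE_I2 intro: order_trans[OF _ abs_ge_self]\<close>)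
  show ?thesis
  \<comment> \<open>The added 1 keeps the constant positive when
    \<open>\<sigma> = 0\<close>.\<close>
  proof (rule that[of "A * K + B + 1"])
    show "0 < A * K + B + 1" using AB by (intro add_nonneg_pos add_nonneg_nonneg mult_nonneg_nonneg) auto
    show "(\<integral>x. (step_error \<sigma> h (sqrt h * x))\<^sup>2 \<partial>gauss) \<le> (A * K + B + 1) * h\<^sup>2"
      if "0 \<le> h" "h \<le> T" for h
      using integral_mono[OF int[OF that] dom(1)[OF that] pt'[OF that]] dom(2)[OF that] by simp
  qed (rule int)
qed

text \<open>With \<open>x = \<sigma>\<^sup>2 * h\<close> the exact value is
  \<open>exp (3 * x) - 2 * exp x + 1\<close>, which is only of order \<open>h\<close>. Its sum over
  a grid stays bounded without vanishing, and it is paired later with a sum of squares that vanishes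
  in probability.\<close>

lemma exp_increment_variance:
  assumes "0 \<le> h" "h \<le> T"
  shows "integrable gauss (\<lambda>x. (exp (\<sigma>\<^sup>2 * h / 2 - \<sigma> * (sqrt h * x)) - 1)\<^sup>2)"
    and "(\<integral>x. (exp (\<sigma>\<^sup>2 * h / 2 - \<sigma> * (sqrt h * x)) - 1)\<^sup>2 \<partial>gauss) \<le> 3 * \<sigma>\<^sup>2 * exp (3 * \<sigma>\<^sup>2 * T) * h"
proof -
  define x where "x = \<sigma>\<^sup>2 * h"
  have x: "0 \<le> x" using assms by (simp add: x_def)
  define k where "k = - (\<sigma> * sqrt h)"
  have k: "k\<^sup>2 = x" using assms by (simp add: power_mult_distrib k_def x_def)
  have i: "has_bochner_integral gauss
      (\<lambda>y. exp x * exp (2 * k * y) - 2 * (exp (x / 2) * exp (k * y)) + 1)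
      (exp x * exp ((2 * k)\<^sup>2 / 2) - 2 * (exp (x / 2) * exp (k\<^sup>2 / 2)) + 1)"
    by (intro has_bochner_integral_add has_bochner_integral_diff has_bochner_integral_mult_right gauss_exp gauss_const)
  have "exp x * exp (2 * k * y) - 2 * (exp (x / 2) * exp (k * y)) + 1
      = (exp (\<sigma>\<^sup>2 * h / 2 - \<sigma> * (sqrt h * y)) - 1)\<^sup>2" for y
  proof -
    have "exp (\<sigma>\<^sup>2 * h / 2 - \<sigma> * (sqrt h * y)) = exp (x / 2) * exp (k * y)"
      by (simp add: x_def k_def mult.assoc flip: exp_add)
    moreover have "(exp (x / 2) * exp (k * y))\<^sup>2 = exp x * exp (2 * k * y)"
      by (simp add: power_mult_distrib mult.assoc flip: exp_double)
    ultimately show ?thesis by (simp add: power2_diff)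
  qed
  with i have i2: "has_bochner_integral gauss (\<lambda>y. (exp (\<sigma>\<^sup>2 * h / 2 - \<sigma> * (sqrt h * y)) - 1)\<^sup>2)
      (exp x * exp ((2 * k)\<^sup>2 / 2) - 2 * (exp (x / 2) * exp (k\<^sup>2 / 2)) + 1)" by simp
  then show "integrable gauss (\<lambda>x. (exp (\<sigma>\<^sup>2 * h / 2 - \<sigma> * (sqrt h * x)) - 1)\<^sup>2)"
    by (simp only: has_bochner_integral_iff)
  have "exp x * exp ((2 * k)\<^sup>2 / 2) - 2 * (exp (x / 2) * exp (k\<^sup>2 / 2)) + 1 = exp (3 * x) - 2 * exp x + 1"
  proof -
    have "exp x * exp ((2 * k)\<^sup>2 / 2) = exp (3 * x)" using k by (simp add: power_mult_distrib flip: exp_add)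
    moreover have "exp (x / 2) * exp (k\<^sup>2 / 2) = exp x" using k by (simp flip: exp_add)
    ultimately show ?thesis by simp
  qed
  also have "\<dots> \<le> exp (3 * x) - 1" using x by simp
  also have "\<dots> \<le> 3 * x * exp (3 * x)" by (rule exp_minus_1_le)
  also have "\<dots> \<le> 3 * x * exp (3 * \<sigma>\<^sup>2 * T)"
    using x assms by (intro mult_left_mono) (auto simp: x_def intro: mult_left_mono)
  finally show "(\<integral>x. (exp (\<sigma>\<^sup>2 * h / 2 - \<sigma> * (sqrt h * x)) - 1)\<^sup>2 \<partial>gauss) \<le> 3 * \<sigma>\<^sup>2 * exp (3 * \<sigma>\<^sup>2 * T) * h"
    using has_bochner_integral_integral_eq[OF i2] by (simp add: x_def algebra_simps)
qed

context brownian
begin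

section \<open>Almost sure approximation by simple integrands\<close>

lemma simple_integrand_points:
  assumes "simple_integrand M F a b n p \<xi>"
  shows "p 0 = a" "p n = b" "\<And>i j. i \<le> j \<Longrightarrow> j \<le> n \<Longrightarrow> p i \<le> p j"
    "\<And>i. i < n \<Longrightarrow> p i < p (Suc i)" "\<And>i. i < n \<Longrightarrow> \<xi> i \<in> borel_measurable (F (p i))"
proof -
  show "p 0 = a" "p n = b" and lt: "\<And>i. i < n \<Longrightarrow> p i < p (Suc i)" and "\<And>i. i < n \<Longrightarrow> \<xi> i \<in> borel_measurable (F (p i))"
    using assms by (auto simp: simple_integrand_def)
  fix i j assume "i \<le> j" "j \<le> n"
  then show "p i \<le> p j"
    by (induction j rule: dec_induct) (auto intro: order_trans[OF _ less_imp_le[OF lt]])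
qed

lemma simple_integral_measurable:
  assumes "simple_integrand M F a b n p \<xi>" "0 \<le> a" "0 \<le> s"
  shows "simple_integral W n p \<xi> s \<in> borel_measurable M"
proof -
  note sp = simple_integrand_points[OF assms(1)]
  have "a \<le> p i" if "i \<le> n" for i using sp(3)[of 0 i] sp(1) that by simp
  then have "0 \<le> p i" if "i \<le> n" for i using that assms(2) by force
  then have [measurable]: "W (min (p i) s) \<in> borel_measurable M" if "i \<le> n" for i
    using that assms by (intro W_M) auto
  have [measurable]: "\<xi> i \<in> borel_measurable M" if "i < n" for i
    using sp(5)[OF that] by (rule measurable_F_M)
  show ?thesis unfolding simple_integral_def by (intro borel_measurable_sum) auto
qed

text \<open>A non-measurable set has \<open>measure\<close> 0, so the convergence demanded by
  \<open>has_ito_integral\<close> is informative only once its events are known to be measurable.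
  Progressive measurability up to the endpoint \<open>b\<close> gives this through Tonelli.\<close>

lemma square_distance_measurable:
  assumes H: "progressively_measurable_on F a b H" and "a \<le> b"
    and si: "simple_integrand M F a b n p \<xi>"
  shows "(\<lambda>\<omega>. \<integral>\<^sup>+u\<in>{a..b}. ennreal ((H u \<omega> - simple_process n p \<xi> u \<omega>)\<^sup>2) \<partial>lborel) \<in> borel_measurable M"
proof -
  note sp = simple_integrand_points[OF si]
  let ?R = "restrict_space lborel {a..b}"
  have R: "sets ?R = sets (restrict_space borel {a..b})"
    by (rule sets_restrict_space_cong) simp
  interpret R: sigma_finite_measure ?R
    by (intro sigma_finite_measure_restrict_space sigma_finite_lborel) simp
  have "case_prod H \<in> borel_measurable (restrict_space borel {a..b} \<Otimes>\<^sub>M F b)"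
    using H \<open>a \<le> b\<close> by (auto simp: progressively_measurable_on_def)
  then have "case_prod H \<in> borel_measurable (?R \<Otimes>\<^sub>M F b)"
    by (simp cong: measurable_cong_sets sets_pair_measure_cong add: R)
  from measurable_compose[OF measurable_pair_swap' this]
  have Hm[measurable]: "(\<lambda>(\<omega>, u). H u \<omega>) \<in> borel_measurable (F b \<Otimes>\<^sub>M ?R)"
    by (simp add: split_beta')
  have [measurable]: "\<xi> i \<in> borel_measurable (F b)" if "i < n" for i
  proof -
    have "p i \<le> b" using sp(3)[of i n] sp(2) that by simp
    then show ?thesis using sp(5)[OF that] by (auto intro: measurable_F_mono)
  qed
  have [measurable]: "(\<lambda>u. indicator {p i<..p (Suc i)} u :: real) \<in> borel_measurable ?R" for i
    by (intro measurable_restrict_space1) simp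
  have "(\<lambda>(\<omega>, u). simple_process n p \<xi> u \<omega>) \<in> borel_measurable (F b \<Otimes>\<^sub>M ?R)"
    unfolding simple_process_def split_beta'
  proof (intro borel_measurable_sum borel_measurable_times)
    fix i assume "i \<in> {..<n}"
    then show "(\<lambda>x. \<xi> i (fst x)) \<in> borel_measurable (F b \<Otimes>\<^sub>M ?R)" by simp
    show "(\<lambda>x. indicator {p i<..p (Suc i)} (snd x) :: real) \<in> borel_measurable (F b \<Otimes>\<^sub>M ?R)"
      by (rule measurable_compose[OF measurable_snd]) simp
  qed
  with Hm have "(\<lambda>(\<omega>, u). ennreal ((H u \<omega> - simple_process n p \<xi> u \<omega>)\<^sup>2)) \<in> borel_measurable (F b \<Otimes>\<^sub>M ?R)"
    unfolding split_beta' by measurable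
  then have "(\<lambda>\<omega>. \<integral>\<^sup>+u. ennreal ((H u \<omega> - simple_process n p \<xi> u \<omega>)\<^sup>2) \<partial>?R) \<in> borel_measurable (F b)"
    by (rule R.borel_measurable_nn_integral)
  then have "(\<lambda>\<omega>. \<integral>\<^sup>+u. ennreal ((H u \<omega> - simple_process n p \<xi> u \<omega>)\<^sup>2) \<partial>?R) \<in> borel_measurable M"
    by (rule measurable_F_M)
  then show ?thesis by (simp add: nn_integral_restrict_space)
qed

text \<open>A subsequence is chosen such that at level \<open>n\<close> the square distance and the
  finitely many errors on \<open>G n\<close> exceed \<open>(1 / 2) ^ n\<close> with probability
  below \<open>(1 / 2) ^ n\<close>; Borel-Cantelli makes the bounds hold eventually, almost surely.
  The sets \<open>G n\<close> may grow with \<open>n\<close>, and the geometric rate leaves room for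
  summing the errors over a grid of \<open>Suc n\<close> steps.\<close>

lemma ito_approximation:
  assumes ito: "has_ito_integral M F W a b H I" and "0 \<le> a" "a \<le> b"
    and G: "\<And>n. finite (G n)" "\<And>n. G n \<subseteq> {a..b}"
  obtains N p \<xi> where
    "\<And>n. simple_integrand M F a b (N n) (p n) (\<xi> n)"
    "AE \<omega> in M. eventually (\<lambda>n.
        (\<integral>\<^sup>+u\<in>{a..b}. ennreal ((H u \<omega> - simple_process (N n) (p n) (\<xi> n) u \<omega>)\<^sup>2) \<partial>lborel) \<le> ennreal ((1 / 2) ^ n)
        \<and> (\<forall>s\<in>G n. \<bar>simple_integral W (N n) (p n) (\<xi> n) s \<omega> - I s \<omega>\<bar> \<le> (1 / 2) ^ n)) sequentially"
proof -
  obtain N p \<xi> where si: "\<And>k. simple_integrand M F a b (N k) (p k) (\<xi> k)"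
    and L2: "\<And>e. 0 < e \<Longrightarrow> (\<lambda>k. measure M {\<omega>\<in>space M. ennreal e <
              (\<integral>\<^sup>+u\<in>{a..b}. ennreal ((H u \<omega> - simple_process (N k) (p k) (\<xi> k) u \<omega>)\<^sup>2) \<partial>lborel)}) \<longlonglongrightarrow> 0"
    and L: "\<And>s e. s \<in> {a..b} \<Longrightarrow> 0 < e \<Longrightarrow> (\<lambda>k. measure M {\<omega>\<in>space M.
            e < \<bar>simple_integral W (N k) (p k) (\<xi> k) s \<omega> - I s \<omega>\<bar>}) \<longlonglongrightarrow> 0"
    using ito unfolding has_ito_integral_def by blast
  have H: "progressively_measurable_on F a b H" and I: "\<And>s. s \<in> {a..b} \<Longrightarrow> I s \<in> borel_measurable M"
    using ito by (auto simp: has_ito_integral_def)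
  define A where "A k e = {\<omega>\<in>space M. ennreal e <
              (\<integral>\<^sup>+u\<in>{a..b}. ennreal ((H u \<omega> - simple_process (N k) (p k) (\<xi> k) u \<omega>)\<^sup>2) \<partial>lborel)}" for k e
  define B where "B k s e = {\<omega>\<in>space M. e < \<bar>simple_integral W (N k) (p k) (\<xi> k) s \<omega> - I s \<omega>\<bar>}" for k s e
  have Am[measurable]: "A k e \<in> sets M" for k e
    using square_distance_measurable[OF H \<open>a \<le> b\<close> si] unfolding A_def by measurable
  have Bm[measurable]: "B k s e \<in> sets M" if "s \<in> {a..b}" for k s e
  proof -
    have [measurable]: "simple_integral W (N k) (p k) (\<xi> k) s \<in> borel_measurable M"
      using that \<open>0 \<le> a\<close> by (intro simple_integral_measurable[OF si]) auto
    show ?thesis unfolding B_def using I[OF that] by measurable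
  qed
  have "\<exists>k. prob (A k ((1 / 2) ^ n)) + (\<Sum>s\<in>G n. prob (B k s ((1 / 2) ^ n))) < (1 / 2) ^ n" for n
  proof -
    have "(\<lambda>k. prob (A k ((1 / 2) ^ n)) + (\<Sum>s\<in>G n. prob (B k s ((1 / 2) ^ n)))) \<longlonglongrightarrow> 0 + (\<Sum>s\<in>G n. 0)"
      unfolding A_def B_def using G(2)[of n] by (intro tendsto_add tendsto_sum L2 L) auto
    then have "\<forall>\<^sub>F k in sequentially. prob (A k ((1 / 2) ^ n)) + (\<Sum>s\<in>G n. prob (B k s ((1 / 2) ^ n))) < (1 / 2) ^ n"
      by (rule order_tendstoD) simp
    then show ?thesis by (rule eventually_happens'[rotated]) simp
  qed
  then obtain \<kappa> where \<kappa>: "\<And>n. prob (A (\<kappa> n) ((1 / 2) ^ n)) + (\<Sum>s\<in>G n. prob (B (\<kappa> n) s ((1 / 2) ^ n))) < (1 / 2) ^ n"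
    by metis
  define E where "E n = A (\<kappa> n) ((1 / 2) ^ n) \<union> (\<Union>s\<in>G n. B (\<kappa> n) s ((1 / 2) ^ n))" for n
  have UBm: "(\<Union>s\<in>G n. B (\<kappa> n) s ((1 / 2) ^ n)) \<in> sets M" for n
    using G(1)[of n] G(2)[of n] by (intro sets.finite_UN Bm) auto
  have Em: "E n \<in> sets M" for n unfolding E_def using UBm by auto
  have E: "prob (E n) \<le> (1 / 2) ^ n" for n
  proof -
    have "prob (E n) \<le> prob (A (\<kappa> n) ((1 / 2) ^ n)) + prob (\<Union>s\<in>G n. B (\<kappa> n) s ((1 / 2) ^ n))"
      unfolding E_def using UBm by (intro measure_Un_le) auto
    also have "prob (\<Union>s\<in>G n. B (\<kappa> n) s ((1 / 2) ^ n)) \<le> (\<Sum>s\<in>G n. prob (B (\<kappa> n) s ((1 / 2) ^ n)))"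
      using G(1)[of n] G(2)[of n] by (intro measure_UNION_le Bm) auto
    finally show ?thesis using \<kappa>[of n] by simp
  qed
  have "AE \<omega> in M. eventually (\<lambda>n. \<omega> \<in> space M - E n) sequentially"
  proof (rule borel_cantelli_AE1[OF Em])
    show "emeasure M (E n) < \<infinity>" for n by (simp add: less_top[symmetric])
    show "summable (\<lambda>n. prob (E n))"
      by (rule summable_comparison_test'[OF summable_geometric[of "1 / 2 :: real"], of 0]) (use E in auto)
  qed
  then have "AE \<omega> in M. eventually (\<lambda>n.
        (\<integral>\<^sup>+u\<in>{a..b}. ennreal ((H u \<omega> - simple_process (N (\<kappa> n)) (p (\<kappa> n)) (\<xi> (\<kappa> n)) u \<omega>)\<^sup>2) \<partial>lborel) \<le> ennreal ((1 / 2) ^ n)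
        \<and> (\<forall>s\<in>G n. \<bar>simple_integral W (N (\<kappa> n)) (p (\<kappa> n)) (\<xi> (\<kappa> n)) s \<omega> - I s \<omega>\<bar> \<le> (1 / 2) ^ n)) sequentially"
    by eventually_elim (erule eventually_mono, auto simp: E_def A_def B_def not_less)
  then show ?thesis
    by (intro that[of "\<lambda>n. N (\<kappa> n)" "\<lambda>n. p (\<kappa> n)" "\<lambda>n. \<xi> (\<kappa> n)"] si)
qed

text \<open>Lenglart's inequality on the common refinement of the coarse grid \<open>s\<close> and the grid \<open>p\<close> of the
  simple integrand, once with a single block and once with one block per step of \<open>s\<close>.\<close>

lemma frozen_integrand_error:
  fixes s :: "nat \<Rightarrow> real" and c x :: "nat \<Rightarrow> 'a \<Rightarrow> real"
  defines "e \<equiv> \<lambda>N p \<xi> k \<omega>. c k \<omega> * (simple_integral W N p \<xi> (s (Suc k)) \<omega> - simple_integral W N p \<xi> (s k) \<omega>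
                - x k \<omega> * (W (s (Suc k)) \<omega> - W (s k) \<omega>))"
  assumes si: "simple_integrand M F t T N p \<xi>" and t: "0 \<le> t"
    and s: "\<And>k. k < n \<Longrightarrow> s k < s (Suc k)" "\<And>k. k \<le> n \<Longrightarrow> t \<le> s k \<and> s k \<le> T"
    and c: "\<And>k. k < n \<Longrightarrow> c k \<in> borel_measurable (F (s k))"
    and x: "\<And>k. k < n \<Longrightarrow> x k \<in> borel_measurable (F (s k))"
  obtains Q where "Q \<in> borel_measurable M" "\<And>\<omega>. 0 \<le> Q \<omega>"
    "\<And>\<epsilon> \<eta>. 0 < \<epsilon> \<Longrightarrow> 0 < \<eta> \<Longrightarrow> prob {\<omega> \<in> space M. \<epsilon> < (\<Sum>k<n. e N p \<xi> k \<omega>)\<^sup>2} \<le> \<eta> / \<epsilon> + prob {\<omega> \<in> space M. \<eta> < Q \<omega>}"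
    "\<And>\<epsilon> \<eta>. 0 < \<epsilon> \<Longrightarrow> 0 < \<eta> \<Longrightarrow> prob {\<omega> \<in> space M. \<epsilon> < (\<Sum>k<n. (e N p \<xi> k \<omega>)\<^sup>2)} \<le> \<eta> / \<epsilon> + prob {\<omega> \<in> space M. \<eta> < Q \<omega>}"
    "\<And>\<omega> H C w. continuous_on {t..T} H \<Longrightarrow> (\<And>k. k < n \<Longrightarrow> \<bar>c k \<omega>\<bar> \<le> C) \<Longrightarrow>
        (\<And>k u. k < n \<Longrightarrow> u \<in> {s k..s (Suc k)} \<Longrightarrow> \<bar>H u - x k \<omega>\<bar> \<le> w) \<Longrightarrow>
        ennreal (Q \<omega>) \<le> ennreal (2 * C\<^sup>2) * (\<integral>\<^sup>+u\<in>{t..T}. ennreal ((H u - simple_process N p \<xi> u \<omega>)\<^sup>2) \<partial>lborel)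
          + ennreal (2 * C\<^sup>2 * w\<^sup>2 * (T - t))"
proof -
  note sp = simple_integrand_points[OF si]
  \<comment> \<open>\<open>{lo<..hi}\<close> is the overlap of step \<open>i\<close> of the simple
    integrand with step \<open>k\<close> of the coarse grid. \<open>J\<close> keeps the nonempty
    overlaps; on each of them the simple integrand minus its frozen substitute is constant in
    time.\<close>
  define lo where "lo = (\<lambda>(k, i). max (p i) (s k))"
  define hi where "hi = (\<lambda>(k, i). min (p (Suc i)) (s (Suc k)))"
  define J where "J = {(k, i). k < n \<and> i < N \<and> lo (k, i) < hi (k, i)}"
  define \<zeta> where "\<zeta> = (\<lambda>(k, i) \<omega>. c k \<omega> * (\<xi> i \<omega> - x k \<omega>))"
  define Q where "Q \<omega> = (\<Sum>j\<in>J. (hi j - lo j) * (\<zeta> j \<omega>)\<^sup>2)" for \<omega>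
  have smono: "s k \<le> s l" if "k \<le> l" "l \<le> n" for k l
    using that by (induction l rule: dec_induct) (auto intro: order_trans[OF _ less_imp_le[OF s(1)]])
  have JJ: "J \<subseteq> {..<n} \<times> {..<N}" by (auto simp: J_def)
  then have finJ: "finite J" by (rule finite_subset) simp
  have ab: "0 \<le> lo j \<and> lo j < hi j" if "j \<in> J" for j
    using that s(2)[of "fst j"] t by (auto simp: J_def lo_def)
  have sep: "hi i \<le> lo j \<or> hi j \<le> lo i" if "i \<in> J" "j \<in> J" "i \<noteq> j" for i j
  proof -
    obtain k1 i1 k2 i2 where ij: "i = (k1, i1)" "j = (k2, i2)" by (metis surj_pair)
    have le: "hi (k, i) \<le> lo (l, i')" if "k < l" "l < n" for k l i i'
    proof -
      have "s (Suc k) \<le> s l" using that by (intro smono) auto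
      then show ?thesis by (auto simp: hi_def lo_def)
    qed
    have le2: "hi (k, i) \<le> lo (k, i')" if "i < i'" "i' < N" for k i i'
    proof -
      have "p (Suc i) \<le> p i'" using that by (intro sp) auto
      then show ?thesis by (auto simp: hi_def lo_def)
    qed
    show ?thesis
    proof (cases k1 k2 rule: linorder_cases)
      case equal
      then show ?thesis using that le2[of i1 i2 k1] le2[of i2 i1 k1] unfolding ij J_def
        by (cases i1 i2 rule: linorder_cases) auto
    qed (use that le in \<open>auto simp: ij J_def\<close>)
  qed
  have \<zeta>F: "\<zeta> j \<in> borel_measurable (F (lo j))" if "j \<in> J" for j
  proof -
    obtain k i where j: "j = (k, i)" by (metis surj_pair)
    then have ki: "k < n" "i < N" using that by (auto simp: J_def)
    have [measurable]: "c k \<in> borel_measurable (F (lo j))" "x k \<in> borel_measurable (F (lo j))" "\<xi> i \<in> borel_measurable (F (lo j))"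
      using measurable_F_mono[OF c[OF ki(1)]] measurable_F_mono[OF x[OF ki(1)]] measurable_F_mono[OF sp(5)[OF ki(2)]]
      by (auto simp: j lo_def)
    have "\<zeta> j = (\<lambda>\<omega>. c k \<omega> * (\<xi> i \<omega> - x k \<omega>))" by (simp add: \<zeta>_def j)
    then show ?thesis by simp
  qed
  have Qm: "Q \<in> borel_measurable M"
    unfolding Q_def using \<zeta>F
    by (intro borel_measurable_sum borel_measurable_times borel_measurable_power) (auto intro: measurable_F_M)
  have block: "(\<Sum>j | j \<in> J \<and> fst j = k. \<zeta> j \<omega> * (W (hi j) \<omega> - W (lo j) \<omega>)) = e N p \<xi> k \<omega>" if k: "k < n" for k \<omega>
  proof -
    \<comment> \<open>An increment stopped at \<open>s (Suc k)\<close> minus the same increment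
      stopped at \<open>s k\<close> is the increment over the overlap, and 0 if the overlap is
      empty.\<close>
    define D where "D i = W (min (p (Suc i)) (s (Suc k))) \<omega> - W (min (p i) (s (Suc k))) \<omega>
        - (W (min (p (Suc i)) (s k)) \<omega> - W (min (p i) (s k)) \<omega>)" for i
    have ss: "s k < s (Suc k)" by (rule s(1)[OF k])
    have D: "D i = (if lo (k, i) < hi (k, i) then W (hi (k, i)) \<omega> - W (lo (k, i)) \<omega> else 0)" if "i < N" for i
      using sp(4)[OF that] ss by (auto simp: D_def lo_def hi_def min_def max_def)
    have tel: "(\<Sum>i<N. W (min (p (Suc i)) v) \<omega> - W (min (p i) v) \<omega>) = W v \<omega> - W t \<omega>" if "t \<le> v" "v \<le> T" for v
      using that sp(1,2) by (subst sum_lessThan_telescope) (simp add: min_def)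
    have "(\<Sum>j | j \<in> J \<and> fst j = k. \<zeta> j \<omega> * (W (hi j) \<omega> - W (lo j) \<omega>))
        = (\<Sum>i | i < N \<and> lo (k, i) < hi (k, i). \<zeta> (k, i) \<omega> * (W (hi (k, i)) \<omega> - W (lo (k, i)) \<omega>))"
      by (rule sum.reindex_bij_witness[of _ "\<lambda>i. (k, i)" snd]) (auto simp: J_def k)
    also have "\<dots> = (\<Sum>i<N. \<zeta> (k, i) \<omega> * D i)"
      using D by (intro sum.mono_neutral_cong_left) auto
    also have "\<dots> = c k \<omega> * ((\<Sum>i<N. \<xi> i \<omega> * D i) - x k \<omega> * (\<Sum>i<N. D i))"
      by (simp add: \<zeta>_def sum_subtractf[symmetric] sum_distrib_left algebra_simps)
    also have "(\<Sum>i<N. \<xi> i \<omega> * D i) = simple_integral W N p \<xi> (s (Suc k)) \<omega> - simple_integral W N p \<xi> (s k) \<omega>"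
      unfolding simple_integral_def D_def by (simp add: sum_subtractf[symmetric] right_diff_distrib)
    also have "(\<Sum>i<N. D i) = W (s (Suc k)) \<omega> - W (s k) \<omega>"
      unfolding D_def sum_subtractf[of "\<lambda>i. W (min (p (Suc i)) (s (Suc k))) \<omega> - W (min (p i) (s (Suc k))) \<omega>"]
      using s(2)[of k] s(2)[of "Suc k"] k by (simp only: tel)
    finally show ?thesis unfolding e_def .
  qed
  have mean: "has_bochner_integral gauss (\<lambda>y. sqrt (hi j - lo j) * y) 0" for j
    using has_bochner_integral_mult_right[OF gauss_id, of "sqrt (hi j - lo j)"] by simp
  have var: "integrable gauss (\<lambda>y. (sqrt (hi j - lo j) * y)\<^sup>2)" "(\<integral>y. (sqrt (hi j - lo j) * y)\<^sup>2 \<partial>gauss) \<le> hi j - lo j" if "j \<in> J" for j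
    using std_normal_distribution_even_moments[of 1] ab[OF that] by (auto simp: power_mult_distrib fact_numeral)
  have len: "prob {\<omega> \<in> space M. \<epsilon> < (\<Sum>k<m. (\<Sum>j | j \<in> J \<and> \<kappa> j = k. \<zeta> j \<omega> * (W (hi j) \<omega> - W (lo j) \<omega>))\<^sup>2)}
      \<le> \<eta> / \<epsilon> + prob {\<omega> \<in> space M. \<eta> < Q \<omega>}"
    if "\<And>j. j \<in> J \<Longrightarrow> \<kappa> j < m" "0 < \<epsilon>" "0 < \<eta>" for \<kappa> :: "nat \<times> nat \<Rightarrow> nat" and m \<epsilon> \<eta>
    unfolding Q_def
    by (rule lenglart[of J lo hi \<zeta> "\<lambda>_ y. y" "\<lambda>j. hi j - lo j" \<kappa>])
       (use finJ ab sep \<zeta>F mean var that in auto)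
  show ?thesis
  proof (rule that[OF Qm])
    show "0 \<le> Q \<omega>" for \<omega>
      unfolding Q_def using ab by (intro sum_nonneg mult_nonneg_nonneg) (simp_all add: less_imp_le)
    fix \<epsilon> \<eta> :: real assume pos: "0 < \<epsilon>" "0 < \<eta>"
    have tot: "(\<Sum>j\<in>J. \<zeta> j \<omega> * (W (hi j) \<omega> - W (lo j) \<omega>)) = (\<Sum>k<n. e N p \<xi> k \<omega>)" for \<omega>
    proof -
      have "(\<Sum>k<n. e N p \<xi> k \<omega>) = (\<Sum>k<n. \<Sum>j | j \<in> J \<and> fst j = k. \<zeta> j \<omega> * (W (hi j) \<omega> - W (lo j) \<omega>))"
        using block by simp
      also have "\<dots> = (\<Sum>j\<in>J. \<zeta> j \<omega> * (W (hi j) \<omega> - W (lo j) \<omega>))"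
        using finJ JJ by (intro sum.group) auto
      finally show ?thesis by simp
    qed
    show "prob {\<omega> \<in> space M. \<epsilon> < (\<Sum>k<n. e N p \<xi> k \<omega>)\<^sup>2} \<le> \<eta> / \<epsilon> + prob {\<omega> \<in> space M. \<eta> < Q \<omega>}"
      using len[of "\<lambda>_. 0" 1, OF _ pos] by (simp add: tot)
    have "prob {\<omega> \<in> space M. \<epsilon> < (\<Sum>k<n. (\<Sum>j | j \<in> J \<and> fst j = k. \<zeta> j \<omega> * (W (hi j) \<omega> - W (lo j) \<omega>))\<^sup>2)}
        \<le> \<eta> / \<epsilon> + prob {\<omega> \<in> space M. \<eta> < Q \<omega>}"
      using JJ by (intro len pos) auto
    then show "prob {\<omega> \<in> space M. \<epsilon> < (\<Sum>k<n. (e N p \<xi> k \<omega>)\<^sup>2)} \<le> \<eta> / \<epsilon> + prob {\<omega> \<in> space M. \<eta> < Q \<omega>}"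
      using block by simp
  next
    fix \<omega> and H :: "real \<Rightarrow> real" and C w :: real
    assume H: "continuous_on {t..T} H" and C: "\<And>k. k < n \<Longrightarrow> \<bar>c k \<omega>\<bar> \<le> C"
      and w: "\<And>k u. k < n \<Longrightarrow> u \<in> {s k..s (Suc k)} \<Longrightarrow> \<bar>H u - x k \<omega>\<bar> \<le> w"
    let ?P = "\<lambda>u. simple_process N p \<xi> u \<omega>"
    have tT: "t \<le> T" using sp(3)[of 0 N] sp(1,2) by simp
    \<comment> \<open>\<open>H\<close> is continuous on \<open>{t..T}\<close> only, so measurability
      is first obtained for its truncation.\<close>
    have "(\<lambda>u. H u * indicator {t..T} u) \<in> borel_measurable borel"
      using borel_measurable_continuous_on_indicator[OF _ H] by (simp add: mult.commute)
    moreover have Pm: "?P \<in> borel_measurable borel" unfolding simple_process_def by measurable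
    ultimately have Im: "(\<lambda>u. ennreal ((H u * indicator {t..T} u - ?P u)\<^sup>2) * indicator {t..T} u) \<in> borel_measurable borel"
      by measurable
    have eqI: "ennreal ((H u * indicator {t..T} u - ?P u)\<^sup>2) * indicator {t..T} u = ennreal ((H u - ?P u)\<^sup>2) * indicator {t..T} u" for u
      by (auto simp: indicator_def)
    note Im' = Im[unfolded eqI]
    have pt: "(\<Sum>j\<in>J. ennreal ((\<zeta> j \<omega>)\<^sup>2) * indicator {lo j<..hi j} u)
        \<le> ennreal (2 * C\<^sup>2) * (ennreal ((H u - ?P u)\<^sup>2) * indicator {t..T} u) + ennreal (2 * C\<^sup>2 * w\<^sup>2) * indicator {t..T} u" for u
    proof (cases "\<exists>j\<in>J. u \<in> {lo j<..hi j}")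
      case False
      then have "(\<Sum>j\<in>J. ennreal ((\<zeta> j \<omega>)\<^sup>2) * indicator {lo j<..hi j} u) = 0"
        by (intro sum.neutral) auto
      then show ?thesis by simp
    next
      case True
      then obtain j where j: "j \<in> J" "u \<in> {lo j<..hi j}" by auto
      obtain k i where ki: "j = (k, i)" by (metis surj_pair)
      then have kn: "k < n" "i < N" using j by (auto simp: J_def)
      have u: "p i < u" "u \<le> p (Suc i)" "s k < u" "u \<le> s (Suc k)" using j by (auto simp: ki lo_def hi_def)
      have uT: "u \<in> {t..T}" using u s(2)[of k] s(2)[of "Suc k"] kn by auto
      define \<psi> where "\<psi> l = ennreal ((\<zeta> l \<omega>)\<^sup>2) * indicator {lo l<..hi l} u" for l
      have "sum \<psi> J = sum \<psi> {j}"
        using j finJ sep[of _ j] by (intro sum.mono_neutral_right) (force simp: \<psi>_def indicator_def)+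
      then have 1: "(\<Sum>l\<in>J. ennreal ((\<zeta> l \<omega>)\<^sup>2) * indicator {lo l<..hi l} u) = ennreal ((\<zeta> j \<omega>)\<^sup>2)"
        using j by (simp add: \<psi>_def[symmetric]) (simp add: \<psi>_def)
      define \<phi> where "\<phi> l = \<xi> l \<omega> * indicator {p l<..p (Suc l)} u" for l
      have "?P u = sum \<phi> {i}"
        unfolding simple_process_def \<phi>_def[symmetric]
      proof (intro sum.mono_neutral_right ballI)
        fix l assume l: "l \<in> {..<N} - {i}"
        then consider "l < i" | "i < l" by fastforce
        then have "p (Suc l) \<le> p i \<or> p (Suc i) \<le> p l"
        proof cases
          case 1
          then show ?thesis using kn by (intro disjI1 sp) auto
        next
          case 2
          then show ?thesis using l by (intro disjI2 sp) auto
        qed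
        then show "\<phi> l = 0" using u by (auto simp: \<phi>_def indicator_def)
      qed (use kn in auto)
      then have P: "?P u = \<xi> i \<omega>" using u by (simp add: \<phi>_def)
      have wb: "\<bar>H u - x k \<omega>\<bar> \<le> w" using w[OF kn(1)] u by simp
      have "(\<zeta> j \<omega>)\<^sup>2 = (c k \<omega>)\<^sup>2 * (\<xi> i \<omega> - x k \<omega>)\<^sup>2" by (simp add: \<zeta>_def ki power_mult_distrib)
      also have "\<dots> \<le> C\<^sup>2 * (2 * (H u - \<xi> i \<omega>)\<^sup>2 + 2 * w\<^sup>2)"
      proof (rule mult_mono)
        show "(c k \<omega>)\<^sup>2 \<le> C\<^sup>2" using C[OF kn(1)] by (metis abs_ge_zero power2_abs power_mono)
        have "(H u - x k \<omega>)\<^sup>2 \<le> w\<^sup>2" using wb by (metis abs_ge_zero power2_abs power_mono)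
        moreover have "(\<xi> i \<omega> - x k \<omega>)\<^sup>2 \<le> 2 * (H u - \<xi> i \<omega>)\<^sup>2 + 2 * (H u - x k \<omega>)\<^sup>2"
          using zero_le_power2[of "(H u - \<xi> i \<omega>) + (H u - x k \<omega>)"] by (simp add: power2_eq_square algebra_simps)
        ultimately show "(\<xi> i \<omega> - x k \<omega>)\<^sup>2 \<le> 2 * (H u - \<xi> i \<omega>)\<^sup>2 + 2 * w\<^sup>2" by simp
      qed auto
      finally have "ennreal ((\<zeta> j \<omega>)\<^sup>2) \<le> ennreal (2 * C\<^sup>2 * (H u - \<xi> i \<omega>)\<^sup>2 + 2 * C\<^sup>2 * w\<^sup>2)"
        by (intro ennreal_leI) (simp add: algebra_simps)
      also have "\<dots> = ennreal (2 * C\<^sup>2) * ennreal ((H u - \<xi> i \<omega>)\<^sup>2) + ennreal (2 * C\<^sup>2 * w\<^sup>2)"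
        by (simp add: ennreal_plus ennreal_mult)
      finally show ?thesis using uT unfolding 1 P by simp
    qed
    have "ennreal (Q \<omega>) = (\<Sum>j\<in>J. ennreal ((hi j - lo j) * (\<zeta> j \<omega>)\<^sup>2))"
      unfolding Q_def using ab by (intro sum_ennreal[symmetric] mult_nonneg_nonneg) (simp_all add: less_imp_le)
    also have "\<dots> = (\<Sum>j\<in>J. \<integral>\<^sup>+u. ennreal ((\<zeta> j \<omega>)\<^sup>2) * indicator {lo j<..hi j} u \<partial>lborel)"
    proof (intro sum.cong refl)
      fix j assume "j \<in> J"
      then have "0 \<le> hi j - lo j" "lo j \<le> hi j" using ab[of j] by simp_all
      then show "ennreal ((hi j - lo j) * (\<zeta> j \<omega>)\<^sup>2) = (\<integral>\<^sup>+u. ennreal ((\<zeta> j \<omega>)\<^sup>2) * indicator {lo j<..hi j} u \<partial>lborel)"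
        by (subst nn_integral_cmult_indicator) (auto simp: ennreal_mult mult.commute)
    qed
    also have "\<dots> = (\<integral>\<^sup>+u. (\<Sum>j\<in>J. ennreal ((\<zeta> j \<omega>)\<^sup>2) * indicator {lo j<..hi j} u) \<partial>lborel)"
      by (intro nn_integral_sum[symmetric]) auto
    also have "\<dots> \<le> (\<integral>\<^sup>+u. ennreal (2 * C\<^sup>2) * (ennreal ((H u - ?P u)\<^sup>2) * indicator {t..T} u) + ennreal (2 * C\<^sup>2 * w\<^sup>2) * indicator {t..T} u \<partial>lborel)"
      by (intro nn_integral_mono pt)
    also have "\<dots> = (\<integral>\<^sup>+u. ennreal (2 * C\<^sup>2) * (ennreal ((H u - ?P u)\<^sup>2) * indicator {t..T} u) \<partial>lborel)
        + (\<integral>\<^sup>+u. ennreal (2 * C\<^sup>2 * w\<^sup>2) * indicator {t..T} u \<partial>lborel)"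
      using Im' by (intro nn_integral_add) auto
    also have "(\<integral>\<^sup>+u. ennreal (2 * C\<^sup>2) * (ennreal ((H u - ?P u)\<^sup>2) * indicator {t..T} u) \<partial>lborel)
        = ennreal (2 * C\<^sup>2) * (\<integral>\<^sup>+u\<in>{t..T}. ennreal ((H u - ?P u)\<^sup>2) \<partial>lborel)"
      using Im' by (intro nn_integral_cmult) auto
    also have "(\<integral>\<^sup>+u. ennreal (2 * C\<^sup>2 * w\<^sup>2) * indicator {t..T} u \<partial>lborel) = ennreal (2 * C\<^sup>2 * w\<^sup>2 * (T - t))"
      using tT by (simp add: nn_integral_cmult_indicator ennreal_mult[symmetric])
    finally show "ennreal (Q \<omega>) \<le> ennreal (2 * C\<^sup>2) * (\<integral>\<^sup>+u\<in>{t..T}. ennreal ((H u - ?P u)\<^sup>2) \<partial>lborel)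
          + ennreal (2 * C\<^sup>2 * w\<^sup>2 * (T - t))" .
  qed
qed

end

section \<open>Uniqueness for the linear stochastic differential equation\<close>

lemma continuous_on_Icc_abs_bounded:
  fixes f :: "real \<Rightarrow> real"
  assumes "continuous_on {a..b} f"
  obtains C where "0 \<le> C" "\<And>u. u \<in> {a..b} \<Longrightarrow> \<bar>f u\<bar> \<le> C"
proof -
  have "bounded (f ` {a..b})"
    using assms by (intro compact_imp_bounded compact_continuous_image) auto
  then obtain C where "\<forall>u\<in>{a..b}. \<bar>f u\<bar> \<le> C" by (auto simp: bounded_iff)
  then have "\<And>u. u \<in> {a..b} \<Longrightarrow> \<bar>f u\<bar> \<le> max C 0" by (force simp: max_def)
  then show ?thesis by (intro that[of "max C 0"]) auto
qed

lemma set_integrable_mult_continuous: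
  fixes f m :: "real \<Rightarrow> real"
  assumes m: "set_integrable lborel {a..b} m" and f: "continuous_on {a..b} f"
  shows "set_integrable lborel {a..b} (\<lambda>u. m u * f u)"
proof -
  obtain C where C: "0 \<le> C" "\<And>u. u \<in> {a..b} \<Longrightarrow> \<bar>f u\<bar> \<le> C"
    using continuous_on_Icc_abs_bounded[OF f] by blast
  have mm: "(\<lambda>u. indicator {a..b} u * m u) \<in> borel_measurable lborel"
    using m by (auto simp: set_integrable_def)
  have fm: "(\<lambda>u. indicator {a..b} u * f u) \<in> borel_measurable lborel"
    using borel_measurable_continuous_on_indicator[OF _ f] by simp
  show ?thesis unfolding set_integrable_def
  proof (rule Bochner_Integration.integrable_bound)
    show "integrable lborel (\<lambda>u. C * (indicator {a..b} u *\<^sub>R m u))"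
      using m by (auto simp: set_integrable_def)
    have "(\<lambda>u. (indicator {a..b} u * m u) * (indicator {a..b} u * f u)) \<in> borel_measurable lborel"
      using mm fm by (rule borel_measurable_times)
    moreover have "(indicator {a..b} u * m u) * (indicator {a..b} u * f u) = indicator {a..b} u *\<^sub>R (m u * f u)" for u
      by (simp add: indicator_def)
    ultimately show "(\<lambda>u. indicator {a..b} u *\<^sub>R (m u * f u)) \<in> borel_measurable lborel" by simp
    show "AE u in lborel. norm (indicator {a..b} u *\<^sub>R (m u * f u)) \<le> norm (C * (indicator {a..b} u *\<^sub>R m u))"
      using C by (intro AE_I2) (auto simp: indicator_def abs_mult mult.commute intro!: mult_right_mono)
  qed
qed

section \<open>Integrals split along a grid\<close>

lemma set_integrable_Icc_subset:
  fixes m :: "real \<Rightarrow> real"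
  assumes "set_integrable lborel {a..b} m" "a \<le> c" "d \<le> b"
  shows "set_integrable lborel {c..d} m"
  by (rule set_integrable_subset[OF assms(1)]) (use assms in auto)

lemma set_integral_Icc_split:
  fixes f :: "real \<Rightarrow> real"
  assumes f: "set_integrable lborel {a..c} f" and "a \<le> b" "b \<le> c"
  shows "(LBINT u:{a..c}. f u) = (LBINT u:{a..b}. f u) + (LBINT u:{b..c}. f u)"
proof -
  have "set_integrable lborel {a..b} f" "set_integrable lborel {b..c} f"
    using assms by (auto intro: set_integrable_Icc_subset)
  then show ?thesis
    using f set_borel_integral_eq_integral[OF f] Henstock_Kurzweil_Integration.integral_combine[of a b c f] assms
    by (simp add: set_borel_integral_eq_integral(2))
qed

lemma set_integral_Icc_grid:
  fixes f :: "real \<Rightarrow> real" and g :: "nat \<Rightarrow> real"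
  assumes f: "set_integrable lborel {g 0..g n} f" and g: "\<And>k. k < n \<Longrightarrow> g k \<le> g (Suc k)"
  shows "(\<Sum>k<n. LBINT u:{g k..g (Suc k)}. f u) = (LBINT u:{g 0..g n}. f u)"
  using assms
proof (induction n)
  case 0
  then show ?case using set_borel_integral_eq_integral(2)[OF 0(1)] by simp
next
  case (Suc n)
  have le: "g 0 \<le> g k" if "k \<le> Suc n" for k
    using that by (induction k) (auto intro: order_trans[OF _ Suc.prems(2)])
  have "set_integrable lborel {g 0..g n} f"
    using Suc.prems by (intro set_integrable_Icc_subset[OF Suc.prems(1)]) auto
  with Suc have "(\<Sum>k<n. LBINT u:{g k..g (Suc k)}. f u) = (LBINT u:{g 0..g n}. f u)" by auto
  then show ?case
    using set_integral_Icc_split[OF Suc.prems(1), of "g n"] le[of n] Suc.prems(2)[of n] by simp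
qed

lemma set_integral_mult_bound:
  fixes f m :: "real \<Rightarrow> real"
  assumes m: "set_integrable lborel {a..b} m" and f: "continuous_on {a..b} f"
    and w: "\<And>u. u \<in> {a..b} \<Longrightarrow> \<bar>f u\<bar> \<le> w"
  shows "\<bar>LBINT u:{a..b}. m u * f u\<bar> \<le> w * (LBINT u:{a..b}. \<bar>m u\<bar>)"
proof -
  have mf: "set_integrable lborel {a..b} (\<lambda>u. m u * f u)"
    by (rule set_integrable_mult_continuous[OF m f])
  have "\<bar>LBINT u:{a..b}. m u * f u\<bar> \<le> (LBINT u:{a..b}. \<bar>m u * f u\<bar>)"
    using integral_abs_bound[of lborel "\<lambda>u. indicator {a..b} u * (m u * f u)"]
    by (simp add: set_lebesgue_integral_def abs_mult)
  also have "\<dots> \<le> (LBINT u:{a..b}. w * \<bar>m u\<bar>)"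
    using set_integrable_abs[OF mf] set_integrable_abs[OF m] w
    by (intro set_integral_mono set_integrable_mult_right) (auto simp: abs_mult mult.commute intro!: mult_right_mono)
  finally show ?thesis by simp
qed

text \<open>\<open>w\<close> plays the oscillation of a path over one grid step, which is small for
  a fine mesh but has no rate in \<open>n\<close>. The restriction \<open>w \<le> 1\<close> permits
  bounding \<open>w\<^sup>2\<close> by \<open>w\<close>.\<close>

lemma tendsto_0_approx:
  fixes a b :: "nat \<Rightarrow> real"
  assumes "\<And>w. 0 < w \<Longrightarrow> w \<le> 1 \<Longrightarrow> eventually (\<lambda>n. \<bar>a n\<bar> \<le> b n + K * w) sequentially"
    and b: "b \<longlonglongrightarrow> 0" and "0 \<le> K"
  shows "a \<longlonglongrightarrow> 0"
proof (rule tendstoI)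
  fix e :: real assume e: "0 < e"
  define w where "w = min 1 (e / (2 * (K + 1)))"
  have w: "0 < w" "w \<le> 1" using e \<open>0 \<le> K\<close> by (auto simp: w_def)
  have "K * w \<le> (K + 1) * (e / (2 * (K + 1)))"
    using \<open>0 \<le> K\<close> e w by (intro mult_mono) (auto simp: w_def)
  also have "\<dots> = (K + 1) / (K + 1) * (e / 2)" by (simp add: field_simps)
  also have "\<dots> = e / 2" using \<open>0 \<le> K\<close> by simp
  finally have "K * w \<le> e / 2" .
  have "eventually (\<lambda>n. b n < e / 2) sequentially"
    using b e by (intro order_tendstoD) auto
  then show "eventually (\<lambda>n. dist (a n) 0 < e) sequentially"
    using assms(1)[OF w] by eventually_elim (use \<open>K * w \<le> e / 2\<close> in simp)
qed

context brownian
begin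

text \<open>\<open>\<theta>\<close> is the reciprocal of the drift factor and the exponential that
  of the martingale factor, so their product with the solution should not move. The coefficient
  \<open>\<mu>\<close> is assumed integrable and not bounded, because the rate is singular at
  maturity; since the solution comes without moment bounds, all convergence is almost sure or in
  probability.\<close>

lemma linear_sde_unique:
  assumes t: "0 \<le> t" and s: "t \<le> s" "s \<le> T"
    and \<mu>: "set_integrable lborel {t..T} \<mu>"
    and \<theta>: "continuous_on {t..T} \<theta>" "\<theta> t = 1"
      "\<And>u v. t \<le> u \<Longrightarrow> u \<le> v \<Longrightarrow> v \<le> T \<Longrightarrow> \<theta> v - \<theta> u = - (LBINT w:{u..v}. \<mu> w * \<theta> w)"
    and sde: "sde_solution M F W (\<lambda>u y. \<mu> u * y) (\<lambda>u y. \<sigma> * y) T t x X"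
  shows "AE \<omega> in M. \<theta> s * exp (\<sigma>\<^sup>2 * (s - t) / 2 - \<sigma> * (W s \<omega> - W t \<omega>)) * X s \<omega> = x"
proof (cases "s = t")
  case True
  then show ?thesis using sde \<theta>(2) by (auto simp: sde_solution_def)
next
  case False
  with s have ts: "t < s" by simp
  have tT: "t \<le> T" using s by simp
  have XF: "\<And>u. u \<in> {t..T} \<Longrightarrow> X u \<in> borel_measurable (F u)"
    and Xc: "\<And>\<omega>. \<omega> \<in> space M \<Longrightarrow> continuous_on {t..T} (\<lambda>u. X u \<omega>)"
    and Xt: "AE \<omega> in M. X t \<omega> = x"
    using sde by (auto simp: sde_solution_def)
  obtain I where ito: "has_ito_integral M F W t T (\<lambda>u \<omega>. \<sigma> * X u \<omega>) I"
    and XI: "\<And>u. u \<in> {t..T} \<Longrightarrow> AE \<omega> in M. X u \<omega> = x + (LBINT w:{t..u}. \<mu> w * X w \<omega>) + I u \<omega>"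
    using sde by (auto simp: sde_solution_def)
  define h where "h n = (s - t) / real (Suc n)" for n
  define g where "g n k = t + real k * h n" for n k
  have h: "0 < h n" "h n \<le> s - t" for n
    using ts divide_left_mono[of 1 "real (Suc n)" "s - t"] by (simp_all add: h_def)
  have hn: "real (Suc n) * h n = s - t" for n by (simp add: h_def)
  have g0: "g n 0 = t" and gs: "g n (Suc n) = s" for n
    using hn[of n] by (simp_all add: g_def)
  have gS: "g n (Suc k) = g n k + h n" for n k by (simp add: g_def algebra_simps)
  have gmono: "g n k \<le> g n l" if "k \<le> l" for n k l
    using that h(1)[of n] by (auto simp: g_def intro!: mult_right_mono)
  have gT: "t \<le> g n k \<and> g n k \<le> T" if "k \<le> Suc n" for n k
    using gmono[of 0 k n] gmono[OF that, of n] g0 gs s by auto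
  have h0: "h \<longlonglongrightarrow> 0"
    unfolding h_def using LIMSEQ_inverse_real_of_nat tendsto_mult_right_zero by (force simp: divide_inverse)
  define E where "E u \<omega> = exp (\<sigma>\<^sup>2 * (u - t) / 2 - \<sigma> * (W u \<omega> - W t \<omega>))" for u \<omega>
  have Wc: "continuous_on {t..T} (\<lambda>u. W u \<omega>)" if "\<omega> \<in> space M" for \<omega>
    by (rule continuous_on_subset[OF W_continuous[OF that]]) (use t in auto)
  have Ec: "continuous_on {t..T} (\<lambda>u. E u \<omega>)" if "\<omega> \<in> space M" for \<omega>
    unfolding E_def by (intro continuous_intros Wc that) simp
  have EF: "E u \<in> borel_measurable (F u)" if "u \<in> {t..T}" for u
  proof -
    have [measurable]: "W u \<in> borel_measurable (F u)" "W t \<in> borel_measurable (F u)"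
      using that t by (auto intro: W_F)
    show ?thesis unfolding E_def by measurable
  qed
  obtain N p \<xi> where si: "\<And>n. simple_integrand M F t T (N n) (p n) (\<xi> n)"
    and appr: "AE \<omega> in M. eventually (\<lambda>n.
        (\<integral>\<^sup>+u\<in>{t..T}. ennreal ((\<sigma> * X u \<omega> - simple_process (N n) (p n) (\<xi> n) u \<omega>)\<^sup>2) \<partial>lborel) \<le> ennreal ((1 / 2) ^ n)
        \<and> (\<forall>v\<in>g n ` {..Suc n}. \<bar>simple_integral W (N n) (p n) (\<xi> n) v \<omega> - I v \<omega>\<bar> \<le> (1 / 2) ^ n)) sequentially"
    using ito_approximation[OF ito t tT, of "\<lambda>n. g n ` {..Suc n}"] gT by (auto simp: image_subset_iff)
  define SI where "SI n = simple_integral W (N n) (p n) (\<xi> n)" for n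
  define D where "D n k \<omega> = W (g n (Suc k)) \<omega> - W (g n k) \<omega>" for n k \<omega>
  define c where "c n k \<omega> = E (g n k) \<omega> * \<theta> (g n k)" for n k \<omega>
  define e where "e n k \<omega> = c n k \<omega> * (SI n (g n (Suc k)) \<omega> - SI n (g n k) \<omega> - \<sigma> * X (g n k) \<omega> * D n k \<omega>)" for n k \<omega>
  have cF: "c n k \<in> borel_measurable (F (g n k))" and XgF: "X (g n k) \<in> borel_measurable (F (g n k))" if "k \<le> Suc n" for n k
    using EF XF gT[OF that] unfolding c_def by auto
  have cM: "c n k \<in> borel_measurable M" and XgM: "X (g n k) \<in> borel_measurable M" if "k \<le> Suc n" for n k
    using measurable_F_M[OF cF[OF that]] measurable_F_M[OF XgF[OF that]] by auto
  have DM: "D n k \<in> borel_measurable M" if "k \<le> n" for n k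
  proof -
    have [measurable]: "W (g n (Suc k)) \<in> borel_measurable M" "W (g n k) \<in> borel_measurable M"
      using gT[of "Suc k" n] gT[of k n] that t by (auto intro!: W_M)
    show ?thesis unfolding D_def by measurable
  qed
  have SIM: "SI n (g n k) \<in> borel_measurable M" if "k \<le> Suc n" for n k
    unfolding SI_def using gT[OF that] t by (intro simple_integral_measurable[OF si]) auto
  have eM: "e n k \<in> borel_measurable M" if "k \<le> n" for n k
    unfolding e_def using that by (intro borel_measurable_times borel_measurable_diff cM SIM XgM DM) auto

  \<comment> \<open>Packages the conclusions of \<open>frozen_integrand_error\<close> for one
    \<open>n\<close>, so that the dominating variables can be chosen for all \<open>n\<close> at
    once.\<close>
  define P where "P n q \<longleftrightarrow> q \<in> borel_measurable M \<and> (\<forall>\<omega>. 0 \<le> q \<omega>) \<and>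
     (\<forall>\<epsilon> \<eta>. 0 < \<epsilon> \<longrightarrow> 0 < \<eta> \<longrightarrow> prob {\<omega> \<in> space M. \<epsilon> < (\<Sum>k<Suc n. e n k \<omega>)\<^sup>2} \<le> \<eta> / \<epsilon> + prob {\<omega> \<in> space M. \<eta> < q \<omega>}) \<and>
     (\<forall>\<epsilon> \<eta>. 0 < \<epsilon> \<longrightarrow> 0 < \<eta> \<longrightarrow> prob {\<omega> \<in> space M. \<epsilon> < (\<Sum>k<Suc n. (e n k \<omega>)\<^sup>2)} \<le> \<eta> / \<epsilon> + prob {\<omega> \<in> space M. \<eta> < q \<omega>}) \<and>
     (\<forall>\<omega>\<in>space M. \<forall>C w. (\<forall>k<Suc n. \<bar>c n k \<omega>\<bar> \<le> C) \<longrightarrow>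
        (\<forall>k<Suc n. \<forall>u\<in>{g n k..g n (Suc k)}. \<bar>\<sigma> * X u \<omega> - \<sigma> * X (g n k) \<omega>\<bar> \<le> w) \<longrightarrow>
        ennreal (q \<omega>) \<le> ennreal (2 * C\<^sup>2) * (\<integral>\<^sup>+u\<in>{t..T}. ennreal ((\<sigma> * X u \<omega> - simple_process (N n) (p n) (\<xi> n) u \<omega>)\<^sup>2) \<partial>lborel)
          + ennreal (2 * C\<^sup>2 * w\<^sup>2 * (T - t)))" for n and q :: "'a \<Rightarrow> real"
  have "\<exists>q. P n q" for n
  proof -
    have c': "\<And>k. k < Suc n \<Longrightarrow> c n k \<in> borel_measurable (F (g n k))"
      and x': "\<And>k. k < Suc n \<Longrightarrow> (\<lambda>\<omega>. \<sigma> * X (g n k) \<omega>) \<in> borel_measurable (F (g n k))"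
      using cF XgF by auto
    have g': "\<And>k. k < Suc n \<Longrightarrow> g n k < g n (Suc k)" using h(1) by (simp add: gS)
    obtain q where q: "q \<in> borel_measurable M" "\<And>\<omega>. 0 \<le> q \<omega>"
      and q1: "\<And>\<epsilon> \<eta>. 0 < \<epsilon> \<Longrightarrow> 0 < \<eta> \<Longrightarrow> prob {\<omega> \<in> space M. \<epsilon> < (\<Sum>k<Suc n. e n k \<omega>)\<^sup>2} \<le> \<eta> / \<epsilon> + prob {\<omega> \<in> space M. \<eta> < q \<omega>}"
      and q2: "\<And>\<epsilon> \<eta>. 0 < \<epsilon> \<Longrightarrow> 0 < \<eta> \<Longrightarrow> prob {\<omega> \<in> space M. \<epsilon> < (\<Sum>k<Suc n. (e n k \<omega>)\<^sup>2)} \<le> \<eta> / \<epsilon> + prob {\<omega> \<in> space M. \<eta> < q \<omega>}"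
      and q3: "\<And>\<omega> H C w. continuous_on {t..T} H \<Longrightarrow> (\<And>k. k < Suc n \<Longrightarrow> \<bar>c n k \<omega>\<bar> \<le> C) \<Longrightarrow>
        (\<And>k u. k < Suc n \<Longrightarrow> u \<in> {g n k..g n (Suc k)} \<Longrightarrow> \<bar>H u - \<sigma> * X (g n k) \<omega>\<bar> \<le> w) \<Longrightarrow>
        ennreal (q \<omega>) \<le> ennreal (2 * C\<^sup>2) * (\<integral>\<^sup>+u\<in>{t..T}. ennreal ((H u - simple_process (N n) (p n) (\<xi> n) u \<omega>)\<^sup>2) \<partial>lborel)
          + ennreal (2 * C\<^sup>2 * w\<^sup>2 * (T - t))"
      unfolding e_def SI_def D_def
      by (rule frozen_integrand_error[OF si[of n] t, of "Suc n" "g n" "c n" "\<lambda>k \<omega>. \<sigma> * X (g n k) \<omega>", OF g' gT c' x']) blast+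
    have "continuous_on {t..T} (\<lambda>u. \<sigma> * X u \<omega>)" if "\<omega> \<in> space M" for \<omega>
      by (intro continuous_intros Xc that)
    with q q1 q2 q3 have "P n q" unfolding P_def by (intro conjI allI impI ballI) blast+
    then show ?thesis by (rule exI[of "P n"])
  qed
  then obtain Q where Q: "\<And>n. P n (Q n)" by metis
  have QM: "\<And>n. Q n \<in> borel_measurable M" and Q0: "\<And>n \<omega>. 0 \<le> Q n \<omega>"
    using Q by (auto simp: P_def)

  have small: "eventually (\<lambda>n. h n < d) sequentially" if "0 < d" for d
    using h0 that by (rule order_tendstoD)

  \<comment> \<open>The bound has two parts: the square distance to the simple integrand, eventually
    at most \<open>(1 / 2) ^ n\<close>, and the oscillation of the path over one grid step. The
    bound \<open>C\<close> on the weights depends on the path but not on \<open>n\<close>.\<close>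
  have Qlim: "AE \<omega> in M. (\<lambda>n. Q n \<omega>) \<longlonglongrightarrow> 0"
    using appr AE_space
  proof eventually_elim
    case (elim \<omega>)
    note \<omega> = elim(2)
    have "continuous_on {t..T} (\<lambda>u. E u \<omega> * \<theta> u)" by (intro continuous_intros Ec \<omega> \<theta>)
    then obtain C where C: "0 \<le> C" "\<And>u. u \<in> {t..T} \<Longrightarrow> \<bar>E u \<omega> * \<theta> u\<bar> \<le> C"
      using continuous_on_Icc_abs_bounded by blast
    have cC: "\<bar>c n k \<omega>\<bar> \<le> C" if "k < Suc n" for n k
      unfolding c_def using gT[of k n] that by (intro C) auto
    have "uniformly_continuous_on {t..T} (\<lambda>u. \<sigma> * X u \<omega>)"
      by (intro compact_uniformly_continuous continuous_intros Xc \<omega>) auto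
    note uc = this[unfolded uniformly_continuous_on_def, rule_format]
    show ?case
    proof (rule tendsto_0_approx[where b = "\<lambda>n. 2 * C\<^sup>2 * (1 / 2) ^ n" and K = "2 * C\<^sup>2 * (T - t)"])
      fix w :: real assume w: "0 < w" "w \<le> 1"
      obtain d where d: "0 < d" "\<And>u v. u \<in> {t..T} \<Longrightarrow> v \<in> {t..T} \<Longrightarrow> dist v u < d \<Longrightarrow> dist (\<sigma> * X v \<omega>) (\<sigma> * X u \<omega>) < w"
        using uc[OF w(1)] by blast
      show "eventually (\<lambda>n. \<bar>Q n \<omega>\<bar> \<le> 2 * C\<^sup>2 * (1 / 2) ^ n + 2 * C\<^sup>2 * (T - t) * w) sequentially"
        using elim(1) small[OF d(1)]
      proof eventually_elim
        case (elim n)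
        have "\<bar>\<sigma> * X u \<omega> - \<sigma> * X (g n k) \<omega>\<bar> \<le> w" if "k < Suc n" "u \<in> {g n k..g n (Suc k)}" for k u
          using d(2)[of "g n k" u] that elim gT[of k n] gT[of "Suc k" n] gS[of n k] by (force simp: dist_real_def)
        then have "ennreal (Q n \<omega>) \<le> ennreal (2 * C\<^sup>2) * (\<integral>\<^sup>+u\<in>{t..T}. ennreal ((\<sigma> * X u \<omega> - simple_process (N n) (p n) (\<xi> n) u \<omega>)\<^sup>2) \<partial>lborel)
          + ennreal (2 * C\<^sup>2 * w\<^sup>2 * (T - t))"
          using Q[of n] \<omega> cC unfolding P_def by blast
        also have "\<dots> \<le> ennreal (2 * C\<^sup>2) * ennreal ((1 / 2) ^ n) + ennreal (2 * C\<^sup>2 * w\<^sup>2 * (T - t))"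
          using elim by (intro add_right_mono mult_left_mono) auto
        also have "\<dots> = ennreal (2 * C\<^sup>2 * (1 / 2) ^ n + 2 * C\<^sup>2 * w\<^sup>2 * (T - t))"
          using tT by (simp add: ennreal_mult ennreal_plus)
        finally have "Q n \<omega> \<le> 2 * C\<^sup>2 * (1 / 2) ^ n + 2 * C\<^sup>2 * w\<^sup>2 * (T - t)"
          using tT by (subst (asm) ennreal_le_iff) auto
        also have "2 * C\<^sup>2 * w\<^sup>2 * (T - t) \<le> 2 * C\<^sup>2 * w * (T - t)"
          using w tT power_decreasing[of 1 2 w] by (intro mult_right_mono mult_left_mono) auto
        finally show ?case using Q0[of n \<omega>] by (simp add: algebra_simps)
      qed
    next
      show "(\<lambda>n. 2 * C\<^sup>2 * (1 / 2) ^ n) \<longlonglongrightarrow> 0"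
        by (intro tendsto_mult_right_zero LIMSEQ_power_zero) simp
    qed (use tT in auto)
  qed
  have Qv: "vanishes Q" by (rule vanishes_AE[OF QM Qlim])

  define \<rho> where "\<rho> n k \<omega> = exp (\<sigma>\<^sup>2 * h n / 2 - \<sigma> * D n k \<omega>)" for n k \<omega>
  have \<rho>: "E (g n (Suc k)) \<omega> = \<rho> n k \<omega> * E (g n k) \<omega>" for n k \<omega>
    unfolding E_def \<rho>_def D_def by (simp add: gS field_simps flip: exp_add)
  define Z where "Z n k \<omega> = c n k \<omega> * X (g n k) \<omega>" for n k \<omega>
  have ZF: "Z n k \<in> borel_measurable (F (g n k))" if "k \<le> Suc n" for n k
    unfolding Z_def using cF XgF that by (intro borel_measurable_times) auto
  have ZM: "Z n k \<in> borel_measurable M" if "k \<le> Suc n" for n k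
    using ZF[OF that] by (rule measurable_F_M)
  have Zb: "\<exists>C\<ge>0. \<forall>n. \<forall>k\<le>n. \<bar>Z n k \<omega>\<bar> \<le> C" if "\<omega> \<in> space M" for \<omega>
  proof -
    have "continuous_on {t..T} (\<lambda>u. E u \<omega> * \<theta> u * X u \<omega>)" by (intro continuous_intros Ec that \<theta> Xc)
    then obtain C where C: "0 \<le> C" "\<And>u. u \<in> {t..T} \<Longrightarrow> \<bar>E u \<omega> * \<theta> u * X u \<omega>\<bar> \<le> C"
      using continuous_on_Icc_abs_bounded by blast
    then show ?thesis using gT unfolding Z_def c_def by (intro exI[of _ C]) auto
  qed
  have gd: "g n (Suc k) - g n k = h n" for n k by (simp add: gS)

  \<comment> \<open>The increment of \<open>\<theta> * E * X\<close> over one step splits exactly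
    into the centred one-step error (\<open>S1\<close>), the mean taken out of it
    (\<open>S2\<close>), the error from freezing the integrand (\<open>S3\<close>), the product of
    that error with the fluctuation of the exponential (\<open>S4\<close>), and a remainder
    (\<open>S5\<close>) made of the drift mismatch and the distance of the simple integral from the
    Ito integral.\<close>
  define S1 where "S1 n \<omega> = (\<Sum>k<Suc n. Z n k \<omega> * step_error \<sigma> (h n) (D n k \<omega>))" for n \<omega>
  define S2 where "S2 n \<omega> = step_mean \<sigma> (h n) * (\<Sum>k<Suc n. Z n k \<omega>)" for n \<omega>
  define S3 where "S3 n \<omega> = (\<Sum>k<Suc n. e n k \<omega>)" for n \<omega>
  define S4 where "S4 n \<omega> = (\<Sum>k<Suc n. (\<rho> n k \<omega> - 1) * e n k \<omega>)" for n \<omega>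
  define Y where "Y \<omega> = \<theta> s * E s \<omega> * X s \<omega> - X t \<omega>" for \<omega>
  define S5 where "S5 n \<omega> = Y \<omega> - (S1 n \<omega> + S2 n \<omega> + S3 n \<omega> + S4 n \<omega>)" for n \<omega>
  have [measurable]: "step_error \<sigma> h \<in> borel_measurable borel" for h
    unfolding step_error_def by measurable
  have S1M: "S1 n \<in> borel_measurable M" for n
    unfolding S1_def using ZM DM by (intro borel_measurable_sum borel_measurable_times) auto
  have S2M: "S2 n \<in> borel_measurable M" for n
    unfolding S2_def using ZM by (intro borel_measurable_sum borel_measurable_times) auto
  have S3M: "S3 n \<in> borel_measurable M" for n
    unfolding S3_def using eM by (intro borel_measurable_sum) auto
  have \<rho>M: "\<rho> n k \<in> borel_measurable M" if "k \<le> n" for n k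
    using DM[OF that] unfolding \<rho>_def by measurable
  have S4M: "S4 n \<in> borel_measurable M" for n
    unfolding S4_def using eM \<rho>M by (intro borel_measurable_sum borel_measurable_times borel_measurable_diff) auto
  have YM: "Y \<in> borel_measurable M"
    unfolding Y_def using EF[of s] XF[of s] XF[of t] s
    by (intro borel_measurable_diff borel_measurable_times) (auto intro: measurable_F_M)
  have S5M: "S5 n \<in> borel_measurable M" for n
    unfolding S5_def by (intro borel_measurable_diff borel_measurable_add YM S1M S2M S3M S4M)

  obtain K where K: "0 < K"
    and Ki: "\<And>h. 0 \<le> h \<Longrightarrow> h \<le> s - t \<Longrightarrow> integrable gauss (\<lambda>x. (step_error \<sigma> h (sqrt h * x))\<^sup>2)"
    and KI: "\<And>h. 0 \<le> h \<Longrightarrow> h \<le> s - t \<Longrightarrow> (\<integral>x. (step_error \<sigma> h (sqrt h * x))\<^sup>2 \<partial>gauss) \<le> K * h\<^sup>2"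
    using step_error_variance[of "s - t" \<sigma>] ts by auto
  define Q1 where "Q1 n \<omega> = (\<Sum>k<Suc n. K * (h n)\<^sup>2 * (Z n k \<omega>)\<^sup>2)" for n \<omega>
  have Q1M: "Q1 n \<in> borel_measurable M" for n
    unfolding Q1_def using ZM by (intro borel_measurable_sum borel_measurable_times borel_measurable_power) auto
  have Q1_0: "0 \<le> Q1 n \<omega>" for n \<omega>
    unfolding Q1_def using K by (intro sum_nonneg) auto
  have S1v: "vanishes S1"
  proof (rule vanishes_domination[OF S1M])
    show "vanishes Q1"
    proof (rule vanishes_AE[OF Q1M], rule AE_I2)
      fix \<omega> assume "\<omega> \<in> space M"
      then obtain C where C: "0 \<le> C" "\<And>n k. k \<le> n \<Longrightarrow> \<bar>Z n k \<omega>\<bar> \<le> C" using Zb by blast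
      have "Q1 n \<omega> \<le> K * (s - t) * C\<^sup>2 * h n" for n
      proof -
        have "Q1 n \<omega> \<le> (\<Sum>k<Suc n. K * (h n)\<^sup>2 * C\<^sup>2)"
          unfolding Q1_def
        proof (intro sum_mono mult_left_mono)
          fix k assume "k \<in> {..<Suc n}"
          then show "(Z n k \<omega>)\<^sup>2 \<le> C\<^sup>2" using C(2)[of k n] by (simp add: abs_le_square_iff[symmetric])
        qed (use K in auto)
        also have "\<dots> = K * (real (Suc n) * h n) * C\<^sup>2 * h n" by (simp add: power2_eq_square algebra_simps)
        finally show ?thesis unfolding hn .
      qed
      moreover have "(\<lambda>n. K * (s - t) * C\<^sup>2 * h n) \<longlonglongrightarrow> 0"
        by (intro tendsto_mult_right_zero h0)
      ultimately show "(\<lambda>n. Q1 n \<omega>) \<longlonglongrightarrow> 0"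
        using Q1_0 by (intro Lim_null_comparison[of "\<lambda>n. Q1 n \<omega>" "\<lambda>n. K * (s - t) * C\<^sup>2 * h n"]) auto
    qed
    fix \<epsilon> d :: real assume "0 < \<epsilon>" "0 < d"
    \<comment> \<open>Lenglart's inequality is applied to the square with threshold
      \<open>\<epsilon>\<^sup>2\<close>; this choice makes its first term equal to
      \<open>d\<close>.\<close>
    define \<eta> where "\<eta> = d * \<epsilon>\<^sup>2"
    have "0 < \<eta>" using \<open>0 < \<epsilon>\<close> \<open>0 < d\<close> by (simp add: \<eta>_def)
    have "prob {\<omega> \<in> space M. \<epsilon> < \<bar>S1 n \<omega>\<bar>} \<le> d + prob {\<omega> \<in> space M. \<eta> < \<bar>Q1 n \<omega>\<bar>}" for n
    proof -
      have "prob {\<omega> \<in> space M. \<epsilon>\<^sup>2 < (\<Sum>k<1. (\<Sum>j | j \<in> {..<Suc n} \<and> (0::nat) = k. Z n j \<omega> * step_error \<sigma> (h n) (W (g n (Suc j)) \<omega> - W (g n j) \<omega>))\<^sup>2)}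
          \<le> \<eta> / \<epsilon>\<^sup>2 + prob {\<omega> \<in> space M. \<eta> < (\<Sum>j\<in>{..<Suc n}. K * (h n)\<^sup>2 * (Z n j \<omega>)\<^sup>2)}"
      proof (rule lenglart[where a = "g n" and b = "\<lambda>j. g n (Suc j)" and \<phi> = "\<lambda>_. step_error \<sigma> (h n)" and \<kappa> = "\<lambda>_. 0"], unfold gd)
        show "0 \<le> g n j \<and> g n j < g n (Suc j)" if "j \<in> {..<Suc n}" for j
          using gT[of j n] that t h(1)[of n] by (auto simp: gS)
        show "g n (Suc i) \<le> g n j \<or> g n (Suc j) \<le> g n i" if "i \<noteq> j" for i j
          using that gmono[of "Suc i" j n] gmono[of "Suc j" i n] by linarith
        show "has_bochner_integral gauss (\<lambda>x. step_error \<sigma> (h n) (sqrt (h n) * x)) 0"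
          using h(1)[of n] by (intro step_error_mean) simp
        show "integrable gauss (\<lambda>x. (step_error \<sigma> (h n) (sqrt (h n) * x))\<^sup>2)"
          "(\<integral>x. (step_error \<sigma> (h n) (sqrt (h n) * x))\<^sup>2 \<partial>gauss) \<le> K * (h n)\<^sup>2"
          using h[of n] Ki[of "h n"] KI[of "h n"] by auto
        show "0 < K * (h n)\<^sup>2" using K h(1)[of n] by simp
      qed (use ZF \<open>0 < \<epsilon>\<close> \<open>0 < \<eta>\<close> in auto)
      then have "prob {\<omega> \<in> space M. \<epsilon>\<^sup>2 < (S1 n \<omega>)\<^sup>2} \<le> \<eta> / \<epsilon>\<^sup>2 + prob {\<omega> \<in> space M. \<eta> < Q1 n \<omega>}"
        by (simp add: S1_def Q1_def D_def lessThan_def)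
      moreover have "\<epsilon>\<^sup>2 < y\<^sup>2 \<longleftrightarrow> \<epsilon> < \<bar>y\<bar>" for y
        using \<open>0 < \<epsilon>\<close> abs_le_square_iff[of y \<epsilon>] by (auto simp: not_le[symmetric])
      moreover have "\<eta> / \<epsilon>\<^sup>2 = d" using \<open>0 < \<epsilon>\<close> by (simp add: \<eta>_def)
      ultimately show ?thesis using Q1_0 by simp
    qed
    with \<open>0 < \<eta>\<close> show "\<exists>h>0. \<forall>n. prob {\<omega> \<in> space M. \<epsilon> < \<bar>S1 n \<omega>\<bar>} \<le> d + prob {\<omega> \<in> space M. h < \<bar>Q1 n \<omega>\<bar>}"
      by blast
  qed

  have S2v: "vanishes S2"
  proof (rule vanishes_AE[OF S2M], rule AE_I2)
    fix \<omega> assume "\<omega> \<in> space M"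
    then obtain C where C: "0 \<le> C" "\<And>n k. k \<le> n \<Longrightarrow> \<bar>Z n k \<omega>\<bar> \<le> C" using Zb by blast
    define L where "L = \<sigma> ^ 4 * exp (\<sigma>\<^sup>2 * (s - t))"
    have L0: "0 \<le> L" by (simp add: L_def)
    have "\<bar>S2 n \<omega>\<bar> \<le> L * (s - t) * C * h n" for n
    proof -
      have "\<bar>\<Sum>k<Suc n. Z n k \<omega>\<bar> \<le> (\<Sum>k<Suc n. C)"
        using C by (intro order_trans[OF sum_abs] sum_mono) auto
      moreover have "\<bar>step_mean \<sigma> (h n)\<bar> \<le> L * (h n)\<^sup>2"
        unfolding L_def using h[of n] by (intro step_mean_le) auto
      ultimately have "\<bar>S2 n \<omega>\<bar> \<le> (L * (h n)\<^sup>2) * (\<Sum>k<Suc n. C)"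
        unfolding S2_def abs_mult using L0 by (intro mult_mono) auto
      also have "\<dots> = L * (real (Suc n) * h n) * C * h n" by (simp add: power2_eq_square algebra_simps)
      finally show ?thesis unfolding hn .
    qed
    moreover have "(\<lambda>n. L * (s - t) * C * h n) \<longlonglongrightarrow> 0"
      by (intro tendsto_mult_right_zero h0)
    ultimately show "(\<lambda>n. S2 n \<omega>) \<longlonglongrightarrow> 0"
      by (intro Lim_null_comparison[of "\<lambda>n. S2 n \<omega>" "\<lambda>n. L * (s - t) * C * h n"]) auto
  qed

  have S3v: "vanishes S3"
  proof (rule vanishes_domination[OF S3M Qv])
    fix \<epsilon> d :: real assume "0 < \<epsilon>" "0 < d"
    define \<eta> where "\<eta> = d * \<epsilon>\<^sup>2"
    have "0 < \<eta>" using \<open>0 < \<epsilon>\<close> \<open>0 < d\<close> by (simp add: \<eta>_def)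
    have "prob {\<omega> \<in> space M. \<epsilon> < \<bar>S3 n \<omega>\<bar>} \<le> d + prob {\<omega> \<in> space M. \<eta> < \<bar>Q n \<omega>\<bar>}" for n
    proof -
      have "0 < \<epsilon>\<^sup>2" using \<open>0 < \<epsilon>\<close> by simp
      then have "prob {\<omega> \<in> space M. \<epsilon>\<^sup>2 < (S3 n \<omega>)\<^sup>2} \<le> \<eta> / \<epsilon>\<^sup>2 + prob {\<omega> \<in> space M. \<eta> < Q n \<omega>}"
        using Q[of n] \<open>0 < \<eta>\<close> unfolding P_def S3_def by blast
      moreover have "\<epsilon>\<^sup>2 < y\<^sup>2 \<longleftrightarrow> \<epsilon> < \<bar>y\<bar>" for y
        using \<open>0 < \<epsilon>\<close> abs_le_square_iff[of y \<epsilon>] by (auto simp: not_le[symmetric])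
      moreover have "\<eta> / \<epsilon>\<^sup>2 = d" using \<open>0 < \<epsilon>\<close> by (simp add: \<eta>_def)
      ultimately show ?thesis using Q0 by simp
    qed
    with \<open>0 < \<eta>\<close> show "\<exists>h>0. \<forall>n. prob {\<omega> \<in> space M. \<epsilon> < \<bar>S3 n \<omega>\<bar>} \<le> d + prob {\<omega> \<in> space M. h < \<bar>Q n \<omega>\<bar>}"
      by blast
  qed

  \<comment> \<open>The added 1 keeps \<open>L\<close> positive for \<open>\<sigma> = 0\<close> too;
    \<open>L\<close> becomes a divisor in the proof for \<open>S4\<close>.\<close>
  define L where "L = 3 * \<sigma>\<^sup>2 * exp (3 * \<sigma>\<^sup>2 * (s - t)) * (s - t) + 1"
  have L: "0 < L" using ts by (auto simp: L_def intro!: add_nonneg_pos)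
  have \<rho>2: "integrable M (\<lambda>\<omega>. \<Sum>k<Suc n. (\<rho> n k \<omega> - 1)\<^sup>2)" "(\<integral>\<omega>. (\<Sum>k<Suc n. (\<rho> n k \<omega> - 1)\<^sup>2) \<partial>M) \<le> L" for n
  proof -
    let ?\<psi> = "\<lambda>y. (exp (\<sigma>\<^sup>2 * h n / 2 - \<sigma> * y) - 1)\<^sup>2"
    have h': "0 \<le> h n" "h n \<le> s - t" using h[of n] by auto
    have one: "integrable M (\<lambda>\<omega>. (\<rho> n k \<omega> - 1)\<^sup>2) \<and> (\<integral>\<omega>. (\<rho> n k \<omega> - 1)\<^sup>2 \<partial>M) \<le> 3 * \<sigma>\<^sup>2 * exp (3 * \<sigma>\<^sup>2 * (s - t)) * h n"
      if "k < Suc n" for k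
    proof -
      have b: "0 \<le> g n k" "g n k \<le> g n (Suc k)" using gT[of k n] gmono[of k "Suc k" n] that t by auto
      have m: "?\<psi> \<in> borel_measurable borel" by measurable
      show ?thesis
        using increment_integral[OF b m] exp_increment_variance[OF h', of \<sigma>] unfolding \<rho>_def D_def gd by simp
    qed
    then show "integrable M (\<lambda>\<omega>. \<Sum>k<Suc n. (\<rho> n k \<omega> - 1)\<^sup>2)"
      by (intro Bochner_Integration.integrable_sum) auto
    have "(\<integral>\<omega>. (\<Sum>k<Suc n. (\<rho> n k \<omega> - 1)\<^sup>2) \<partial>M) = (\<Sum>k<Suc n. \<integral>\<omega>. (\<rho> n k \<omega> - 1)\<^sup>2 \<partial>M)"
      using one by (intro Bochner_Integration.integral_sum) auto
    also have "\<dots> \<le> (\<Sum>k<Suc n. 3 * \<sigma>\<^sup>2 * exp (3 * \<sigma>\<^sup>2 * (s - t)) * h n)"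
      using one by (intro sum_mono) auto
    also have "\<dots> = 3 * \<sigma>\<^sup>2 * exp (3 * \<sigma>\<^sup>2 * (s - t)) * (real (Suc n) * h n)"
      by (simp add: algebra_simps)
    also have "\<dots> \<le> L" unfolding hn L_def by simp
    finally show "(\<integral>\<omega>. (\<Sum>k<Suc n. (\<rho> n k \<omega> - 1)\<^sup>2) \<partial>M) \<le> L" .
  qed
  \<comment> \<open>The fluctuations of the exponential have a sum of squares that is bounded in
    mean but not small, while that of the freezing errors is small in probability; a weighted
    inequality for products trades one against the other.\<close>
  have S4v: "vanishes S4"
  proof (rule vanishes_domination[OF S4M Qv])
    fix \<epsilon> d :: real assume "0 < \<epsilon>" "0 < d"
    \<comment> \<open>The weight \<open>l\<close> makes Markov's bound for the first sum equal to
      \<open>d / 2\<close>, and \<open>\<eta>\<close> does the same for the first term of Lenglart's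
      bound on the second.\<close>
    define l where "l = d * \<epsilon> / (2 * L)"
    define \<eta> where "\<eta> = d / 2 * (l * \<epsilon>)"
    have pos: "0 < l" "0 < \<eta>" using \<open>0 < \<epsilon>\<close> \<open>0 < d\<close> L by (simp_all add: \<eta>_def l_def)
    have "prob {\<omega> \<in> space M. \<epsilon> < \<bar>S4 n \<omega>\<bar>} \<le> d + prob {\<omega> \<in> space M. \<eta> < \<bar>Q n \<omega>\<bar>}" for n
    proof -
      let ?A = "{\<omega> \<in> space M. \<epsilon> / l < (\<Sum>k<Suc n. (\<rho> n k \<omega> - 1)\<^sup>2)}"
      let ?B = "{\<omega> \<in> space M. l * \<epsilon> < (\<Sum>k<Suc n. (e n k \<omega>)\<^sup>2)}"
      have Am: "?A \<in> sets M" using \<rho>2(1)[of n, THEN borel_measurable_integrable] by measurable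
      have "(\<lambda>\<omega>. \<Sum>k<Suc n. (e n k \<omega>)\<^sup>2) \<in> borel_measurable M"
        using eM by (intro borel_measurable_sum borel_measurable_power) auto
      then have Bm: "?B \<in> sets M" by measurable
      have "{\<omega> \<in> space M. \<epsilon> < \<bar>S4 n \<omega>\<bar>} \<subseteq> ?A \<union> ?B"
      proof (rule subsetI, rule ccontr)
        fix \<omega> assume \<omega>: "\<omega> \<in> {\<omega> \<in> space M. \<epsilon> < \<bar>S4 n \<omega>\<bar>}" and "\<omega> \<notin> ?A \<union> ?B"
        then have A: "l * (\<Sum>k<Suc n. (\<rho> n k \<omega> - 1)\<^sup>2) \<le> \<epsilon>" and B: "(\<Sum>k<Suc n. (e n k \<omega>)\<^sup>2) \<le> l * \<epsilon>"
          using pos by (auto simp: not_less field_simps simp del: sum.lessThan_Suc)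
        have am: "\<bar>a * b\<bar> \<le> (l * a\<^sup>2 + b\<^sup>2 / l) / 2" for a b :: real
        proof -
          have "0 \<le> (l * \<bar>a\<bar> - \<bar>b\<bar>)\<^sup>2" by simp
          then have "2 * l * (\<bar>a\<bar> * \<bar>b\<bar>) \<le> l * (l * a\<^sup>2) + b\<^sup>2"
            by (simp add: power2_diff power_mult_distrib power2_eq_square algebra_simps)
          then show ?thesis using pos by (simp add: abs_mult field_simps)
        qed
        have "\<bar>S4 n \<omega>\<bar> \<le> (\<Sum>k<Suc n. (l * (\<rho> n k \<omega> - 1)\<^sup>2 + (e n k \<omega>)\<^sup>2 / l) / 2)"
          unfolding S4_def by (intro order_trans[OF sum_abs] sum_mono am)
        also have "\<dots> = (l * (\<Sum>k<Suc n. (\<rho> n k \<omega> - 1)\<^sup>2) + (\<Sum>k<Suc n. (e n k \<omega>)\<^sup>2) / l) / 2"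
          by (simp only: sum_divide_distrib[symmetric] sum.distrib sum_distrib_left)
        also have "\<dots> \<le> (\<epsilon> + l * \<epsilon> / l) / 2"
          using A B pos by (intro divide_right_mono add_mono) auto
        also have "\<dots> = \<epsilon>" using pos by simp
        finally show False using \<omega> by simp
      qed
      then have "prob {\<omega> \<in> space M. \<epsilon> < \<bar>S4 n \<omega>\<bar>} \<le> prob ?A + prob ?B"
        using Am Bm by (intro order_trans[OF finite_measure_mono measure_Un_le]) auto
      also have "prob ?A \<le> L / (\<epsilon> / l)"
        using \<rho>2[of n] pos \<open>0 < \<epsilon>\<close> by (intro prob_markov AE_I2 sum_nonneg) auto
      also have "L / (\<epsilon> / l) = d / 2" using L \<open>0 < \<epsilon>\<close> \<open>0 < d\<close> by (simp add: l_def field_simps)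
      also have "prob ?B \<le> \<eta> / (l * \<epsilon>) + prob {\<omega> \<in> space M. \<eta> < Q n \<omega>}"
        using Q[of n] pos(2) mult_pos_pos[OF pos(1) \<open>0 < \<epsilon>\<close>] unfolding P_def by blast
      also have "\<eta> / (l * \<epsilon>) = d / 2" using pos \<open>0 < \<epsilon>\<close> by (simp add: \<eta>_def)
      finally show ?thesis using Q0 by simp
    qed
    with pos show "\<exists>h>0. \<forall>n. prob {\<omega> \<in> space M. \<epsilon> < \<bar>S4 n \<omega>\<bar>} \<le> d + prob {\<omega> \<in> space M. h < \<bar>Q n \<omega>\<bar>}"
      by blast
  qed

  \<comment> \<open>The equation holds almost surely at each fixed time only; the countably many
    grid times share one null set.\<close>
  have XIg: "AE \<omega> in M. \<forall>n. \<forall>k\<in>{..Suc n}. X (g n k) \<omega> = x + (LBINT w:{t..g n k}. \<mu> w * X w \<omega>) + I (g n k) \<omega>"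
    unfolding AE_all_countable using gT by (intro allI AE_finite_allI XI) auto
  have S5v: "vanishes S5"
  proof (rule vanishes_AE[OF S5M])
    show "AE \<omega> in M. (\<lambda>n. S5 n \<omega>) \<longlonglongrightarrow> 0"
      using appr XIg AE_space
    proof eventually_elim
      case (elim \<omega>)
      note \<omega> = elim(3)
      obtain CE where CE: "0 \<le> CE" "\<And>u. u \<in> {t..T} \<Longrightarrow> \<bar>E u \<omega>\<bar> \<le> CE"
        using continuous_on_Icc_abs_bounded[OF Ec[OF \<omega>]] by blast
      obtain CT where CT: "0 \<le> CT" "\<And>u. u \<in> {t..T} \<Longrightarrow> \<bar>\<theta> u\<bar> \<le> CT"
        using continuous_on_Icc_abs_bounded[OF \<theta>(1)] by blast
      define B where "B = (LBINT u:{t..T}. \<bar>\<mu> u\<bar>)"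
      have B0: "0 \<le> B" unfolding B_def set_lebesgue_integral_def by (intro Bochner_Integration.integral_nonneg) auto
      let ?X = "\<lambda>u. X u \<omega>"
      have \<mu>X: "set_integrable lborel {t..T} (\<lambda>u. \<mu> u * ?X u)"
        by (rule set_integrable_mult_continuous[OF \<mu> Xc[OF \<omega>]])
      \<comment> \<open>\<open>f\<close> is the gap between the Ito and the simple integral over one
        step. \<open>dd\<close> is the drift part of the discrete product rule for
        \<open>\<theta> * X\<close>, with \<open>\<theta>\<close> taken at the left end and
        \<open>X\<close> at the right end; the two drifts cancel up to this displacement of the
        arguments.\<close>
      define f where "f n k = I (g n (Suc k)) \<omega> - I (g n k) \<omega> - (SI n (g n (Suc k)) \<omega> - SI n (g n k) \<omega>)" for n k
      define dd where "dd n k = (LBINT u:{g n k..g n (Suc k)}. \<mu> u * (\<theta> (g n k) * ?X u - \<theta> u * ?X (g n (Suc k))))" for n k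
      have step: "\<theta> (g n (Suc k)) * E (g n (Suc k)) \<omega> * ?X (g n (Suc k)) - \<theta> (g n k) * E (g n k) \<omega> * ?X (g n k)
          = Z n k \<omega> * step_error \<sigma> (h n) (D n k \<omega>) + step_mean \<sigma> (h n) * Z n k \<omega> + e n k \<omega>
            + (\<rho> n k \<omega> - 1) * e n k \<omega> + E (g n (Suc k)) \<omega> * (\<theta> (g n k) * f n k + dd n k)" if "k < Suc n" for n k
      proof -
        have gk: "t \<le> g n k" "g n k \<le> g n (Suc k)" "g n (Suc k) \<le> T"
          using gT[of k n] gT[of "Suc k" n] gmono[of k "Suc k" n] that by auto
        let ?A = "LBINT u:{g n k..g n (Suc k)}. \<mu> u * ?X u"
        have i1: "set_integrable lborel {g n k..g n (Suc k)} (\<lambda>u. \<mu> u * ?X u)"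
          using gk by (intro set_integrable_Icc_subset[OF \<mu>X]) auto
        have "set_integrable lborel {t..T} (\<lambda>u. \<mu> u * \<theta> u)"
          by (rule set_integrable_mult_continuous[OF \<mu> \<theta>(1)])
        then have i2: "set_integrable lborel {g n k..g n (Suc k)} (\<lambda>u. \<mu> u * \<theta> u)"
          using gk by (auto intro: set_integrable_Icc_subset)
        have X': "?X (g n (Suc k)) = ?X (g n k) + ?A + (I (g n (Suc k)) \<omega> - I (g n k) \<omega>)"
        proof -
          have "set_integrable lborel {t..g n (Suc k)} (\<lambda>u. \<mu> u * ?X u)"
            using gk by (intro set_integrable_Icc_subset[OF \<mu>X]) auto
          then have "(LBINT w:{t..g n (Suc k)}. \<mu> w * ?X w) = (LBINT w:{t..g n k}. \<mu> w * ?X w) + ?A"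
            using gk by (intro set_integral_Icc_split) auto
          moreover have "?X (g n (Suc k)) = x + (LBINT w:{t..g n (Suc k)}. \<mu> w * ?X w) + I (g n (Suc k)) \<omega>"
            "?X (g n k) = x + (LBINT w:{t..g n k}. \<mu> w * ?X w) + I (g n k) \<omega>"
            using elim(2) that by (auto simp: Suc_le_eq)
          ultimately show ?thesis by simp
        qed
        have \<theta>': "\<theta> (g n (Suc k)) - \<theta> (g n k) = - (LBINT u:{g n k..g n (Suc k)}. \<mu> u * \<theta> u)"
          using gk by (intro \<theta>(3)) auto
        have "dd n k = (LBINT u:{g n k..g n (Suc k)}. \<theta> (g n k) * (\<mu> u * ?X u) - ?X (g n (Suc k)) * (\<mu> u * \<theta> u))"
          unfolding dd_def by (simp add: algebra_simps)
        also have "\<dots> = \<theta> (g n k) * ?A - ?X (g n (Suc k)) * (LBINT u:{g n k..g n (Suc k)}. \<mu> u * \<theta> u)"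
          using i1 i2 by (subst set_integral_diff) auto
        finally have dd: "dd n k = \<theta> (g n k) * ?A + (\<theta> (g n (Suc k)) - \<theta> (g n k)) * ?X (g n (Suc k))"
          unfolding \<theta>' by simp
        have \<phi>: "step_error \<sigma> (h n) (D n k \<omega>) = \<rho> n k \<omega> * (1 + \<sigma> * D n k \<omega>) - 1 - step_mean \<sigma> (h n)"
          by (simp add: step_error_def \<rho>_def)
        show ?thesis
          unfolding dd \<phi> f_def e_def Z_def c_def \<rho> X' by (simp add: algebra_simps)
      qed
      have S5: "S5 n \<omega> = (\<Sum>k<Suc n. E (g n (Suc k)) \<omega> * (\<theta> (g n k) * f n k + dd n k))" for n
      proof -
        have "(\<Sum>k<Suc n. \<theta> (g n (Suc k)) * E (g n (Suc k)) \<omega> * ?X (g n (Suc k)) - \<theta> (g n k) * E (g n k) \<omega> * ?X (g n k)) = Y \<omega>"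
          unfolding sum_lessThan_telescope[of "\<lambda>k. \<theta> (g n k) * E (g n k) \<omega> * ?X (g n k)"]
          by (simp add: g0 gs Y_def \<theta>(2) E_def)
        moreover have "(\<Sum>k<Suc n. \<theta> (g n (Suc k)) * E (g n (Suc k)) \<omega> * ?X (g n (Suc k)) - \<theta> (g n k) * E (g n k) \<omega> * ?X (g n k))
            = S1 n \<omega> + S2 n \<omega> + S3 n \<omega> + S4 n \<omega> + (\<Sum>k<Suc n. E (g n (Suc k)) \<omega> * (\<theta> (g n k) * f n k + dd n k))"
          unfolding S1_def S2_def S3_def S4_def sum_distrib_left sum.distrib[symmetric]
          by (intro sum.cong refl step) auto
        ultimately show ?thesis unfolding S5_def by simp
      qed
      \<comment> \<open>Uniform continuity on the square compares
        \<open>\<theta> (g n k) * X u\<close> with \<open>\<theta> u * X (g n (Suc k))\<close> in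
        one go, since both arguments move by at most one grid step.\<close>
      define \<Psi> where "\<Psi> = (\<lambda>(u, v). \<theta> u * ?X v)"
      have "continuous_on ({t..T} \<times> {t..T}) \<Psi>"
        unfolding \<Psi>_def split_beta'
        by (intro continuous_intros continuous_on_compose2[OF \<theta>(1)] continuous_on_compose2[OF Xc[OF \<omega>]]) auto
      then have "uniformly_continuous_on ({t..T} \<times> {t..T}) \<Psi>"
        by (intro compact_uniformly_continuous compact_Times) auto
      note uc = this[unfolded uniformly_continuous_on_def, rule_format]
      show ?case
      proof (rule tendsto_0_approx[where b = "\<lambda>n. CE * CT * 2 * (real (Suc n) * (1 / 2) ^ n)" and K = "CE * B"])
        fix w :: real assume w: "0 < w" "w \<le> 1"
        obtain d where d: "0 < d" "\<And>a b. a \<in> {t..T} \<times> {t..T} \<Longrightarrow> b \<in> {t..T} \<times> {t..T} \<Longrightarrow> dist b a < d \<Longrightarrow> dist (\<Psi> b) (\<Psi> a) < w"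
          using uc[OF w(1)] by blast
        have "0 < d / 2" using d by simp
        from elim(1) small[OF this]
        show "eventually (\<lambda>n. \<bar>S5 n \<omega>\<bar> \<le> CE * CT * 2 * (real (Suc n) * (1 / 2) ^ n) + CE * B * w) sequentially"
        proof eventually_elim
          case (elim n)
          have f: "\<bar>f n k\<bar> \<le> 2 * (1 / 2) ^ n" if "k < Suc n" for k
          proof -
            have "\<bar>SI n (g n (Suc k)) \<omega> - I (g n (Suc k)) \<omega>\<bar> \<le> (1 / 2) ^ n" "\<bar>SI n (g n k) \<omega> - I (g n k) \<omega>\<bar> \<le> (1 / 2) ^ n"
              using elim(1) that unfolding SI_def by auto
            then show ?thesis unfolding f_def by linarith
          qed
          have dd: "\<bar>dd n k\<bar> \<le> w * (LBINT u:{g n k..g n (Suc k)}. \<bar>\<mu> u\<bar>)" if "k < Suc n" for k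
          proof -
            have gk: "t \<le> g n k" "g n k \<le> g n (Suc k)" "g n (Suc k) \<le> T" "g n (Suc k) = g n k + h n"
              using gT[of k n] gT[of "Suc k" n] gmono[of k "Suc k" n] that gS by auto
            show ?thesis unfolding dd_def
            proof (rule set_integral_mult_bound)
              show "set_integrable lborel {g n k..g n (Suc k)} \<mu>"
                using gk by (intro set_integrable_Icc_subset[OF \<mu>]) auto
              show "continuous_on {g n k..g n (Suc k)} (\<lambda>u. \<theta> (g n k) * X u \<omega> - \<theta> u * X (g n (Suc k)) \<omega>)"
                using gk by (intro continuous_intros continuous_on_subset[OF \<theta>(1)] continuous_on_subset[OF Xc[OF \<omega>]]) auto
              fix u assume u: "u \<in> {g n k..g n (Suc k)}"
              have "dist (g n k, u) (u, g n (Suc k)) \<le> dist (g n k) u + dist u (g n (Suc k))"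
                unfolding dist_Pair_Pair by (rule sqrt_sum_squares_le_sum) auto
              also have "\<dots> < d" using u gk elim(2) by (simp add: dist_real_def)
              finally have "dist (\<Psi> (g n k, u)) (\<Psi> (u, g n (Suc k))) < w"
                using u gk by (intro d(2)) auto
              then show "\<bar>\<theta> (g n k) * X u \<omega> - \<theta> u * X (g n (Suc k)) \<omega>\<bar> \<le> w"
                by (simp add: \<Psi>_def dist_real_def)
            qed
          qed
          have "set_integrable lborel {g n 0..g n (Suc n)} (\<lambda>u. \<bar>\<mu> u\<bar>)"
            unfolding g0 gs by (rule set_integrable_Icc_subset[OF set_integrable_abs[OF \<mu>]]) (use s in auto)
          then have "(\<Sum>k<Suc n. LBINT u:{g n k..g n (Suc k)}. \<bar>\<mu> u\<bar>) = (LBINT u:{g n 0..g n (Suc n)}. \<bar>\<mu> u\<bar>)"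
            using gmono by (intro set_integral_Icc_grid) auto
          also have "\<dots> \<le> B"
          proof -
            have "B = (LBINT u:{t..s}. \<bar>\<mu> u\<bar>) + (LBINT u:{s..T}. \<bar>\<mu> u\<bar>)"
              unfolding B_def using set_integrable_abs[OF \<mu>] s by (intro set_integral_Icc_split) auto
            moreover have "0 \<le> (LBINT u:{s..T}. \<bar>\<mu> u\<bar>)"
              unfolding set_lebesgue_integral_def by (intro Bochner_Integration.integral_nonneg) auto
            ultimately show ?thesis unfolding g0 gs by simp
          qed
          finally have sumB: "(\<Sum>k<Suc n. LBINT u:{g n k..g n (Suc k)}. \<bar>\<mu> u\<bar>) \<le> B" .
          have "\<bar>S5 n \<omega>\<bar> \<le> (\<Sum>k<Suc n. CE * (CT * (2 * (1 / 2) ^ n) + w * (LBINT u:{g n k..g n (Suc k)}. \<bar>\<mu> u\<bar>)))"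
            unfolding S5
          proof (intro order_trans[OF sum_abs] sum_mono)
            fix k assume "k \<in> {..<Suc n}"
            then have k: "k < Suc n" by simp
            have "\<bar>\<theta> (g n k) * f n k\<bar> \<le> CT * (2 * (1 / 2) ^ n)"
              unfolding abs_mult using gT[of k n] k CT(1) by (intro mult_mono CT f) auto
            then have "\<bar>\<theta> (g n k) * f n k + dd n k\<bar> \<le> CT * (2 * (1 / 2) ^ n) + w * (LBINT u:{g n k..g n (Suc k)}. \<bar>\<mu> u\<bar>)"
              using dd[OF k] by linarith
            then show "\<bar>E (g n (Suc k)) \<omega> * (\<theta> (g n k) * f n k + dd n k)\<bar>
                \<le> CE * (CT * (2 * (1 / 2) ^ n) + w * (LBINT u:{g n k..g n (Suc k)}. \<bar>\<mu> u\<bar>))"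
              unfolding abs_mult using gT[of "Suc k" n] k CE(1) by (intro mult_mono CE) auto
          qed
          also have "\<dots> = CE * CT * 2 * (real (Suc n) * (1 / 2) ^ n) + CE * w * (\<Sum>k<Suc n. LBINT u:{g n k..g n (Suc k)}. \<bar>\<mu> u\<bar>)"
            unfolding sum_distrib_left[symmetric] sum.distrib by (simp add: distrib_left mult.assoc del: sum.lessThan_Suc)
          also have "\<dots> \<le> CE * CT * 2 * (real (Suc n) * (1 / 2) ^ n) + CE * w * B"
            using sumB CE w by (intro add_left_mono mult_left_mono) auto
          finally show ?case by (simp add: mult.assoc mult.commute[of w])
        qed
      next
        have "(\<lambda>n. real n * (1 / 2 :: real) ^ n) \<longlonglongrightarrow> 0" "(\<lambda>n. (1 / 2 :: real) ^ n) \<longlonglongrightarrow> 0"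
          using powser_times_n_limit_0[of "1 / 2 :: real"] by (auto intro: LIMSEQ_power_zero)
        from tendsto_add_zero[OF this(2) this(1)]
        have "(\<lambda>n. real (Suc n) * (1 / 2 :: real) ^ n) \<longlonglongrightarrow> 0" by (simp add: algebra_simps)
        then show "(\<lambda>n. CE * CT * 2 * (real (Suc n) * (1 / 2) ^ n)) \<longlonglongrightarrow> 0"
          by (rule tendsto_mult_right_zero)
        show "0 \<le> CE * B" using CE B0 by simp
      qed
    qed
  qed

  have "vanishes (\<lambda>n \<omega>. S1 n \<omega> + S2 n \<omega> + S3 n \<omega> + S4 n \<omega> + S5 n \<omega>)"
    by (intro vanishes_add S1v S2v S3v S4v S5v)
  moreover have "S1 n \<omega> + S2 n \<omega> + S3 n \<omega> + S4 n \<omega> + S5 n \<omega> = Y \<omega>" for n \<omega>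
    by (simp add: S5_def)
  ultimately have "vanishes (\<lambda>_. Y)" by simp
  then have "AE \<omega> in M. Y \<omega> = 0" by (rule vanishes_const_AE)
  with Xt show ?thesis
    by eventually_elim (simp add: Y_def E_def)
qed

end

section \<open>The exercise boundary\<close>

lemma cdf_gauss_diff:
  assumes "a \<le> y"
  shows "cdf gauss y = cdf gauss a + integral {a..y} std_normal_density"
proof -
  have c: "continuous_on {a..y} std_normal_density"
    unfolding std_normal_density_def by (intro continuous_intros) auto
  have si: "set_integrable lborel {a..y} std_normal_density"
    by (rule borel_integrable_atLeastAtMost') (rule c)
  have "cdf gauss y - cdf gauss a = measure gauss {a<..y}"
  proof (cases "a < y")
    case True
    interpret real_distribution gauss by (rule real_dist_normal_dist)
    show ?thesis using True by (rule cdf_diff_eq)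
  qed (use assms in simp)
  also have "\<dots> = (LBINT x:{a<..y}. std_normal_density x)"
  proof -
    have "emeasure gauss {a<..y} = (\<integral>\<^sup>+x. ennreal (indicator {a<..y} x * std_normal_density x) \<partial>lborel)"
      by (subst emeasure_density) (auto intro!: nn_integral_cong simp: indicator_def)
    then show ?thesis by (simp add: measure_def set_lebesgue_integral_def integral_eq_nn_integral)
  qed
  also have "\<dots> = (LBINT x:{a..y}. std_normal_density x)"
    unfolding set_lebesgue_integral_def
    by (intro integral_discrete_difference[of "{a}"]) (auto simp: indicator_def)
  also have "\<dots> = integral {a..y} std_normal_density"
    by (rule set_borel_integral_eq_integral(2)[OF si])
  finally show ?thesis by simp
qed

lemma DERIV_cdf_gauss [derivative_intros]:
  assumes "(f has_real_derivative f') (at x within S)"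
  shows "((\<lambda>x. cdf gauss (f x)) has_real_derivative (std_normal_density (f x) * f')) (at x within S)"
proof (rule DERIV_chain2[OF _ assms])
  fix x :: real
  have c: "continuous_on {x - 1..x + 1} std_normal_density"
    unfolding std_normal_density_def by (intro continuous_intros) auto
  have "((\<lambda>y. cdf gauss (x - 1) + integral {x - 1..y} std_normal_density) has_real_derivative (0 + std_normal_density x))
      (at x within {x - 1..x + 1})"
    by (intro DERIV_add DERIV_const integral_has_real_derivative c) auto
  then have "((\<lambda>y. cdf gauss (x - 1) + integral {x - 1..y} std_normal_density) has_real_derivative std_normal_density x) (at x)"
    by (simp add: at_within_Icc_at)
  then show "(cdf gauss has_real_derivative std_normal_density x) (at x)"
  proof (rule has_field_derivative_transform_within_open)
    show "open {x - 1<..}" "x \<in> {x - 1<..}" by auto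
    show "cdf gauss (x - 1) + integral {x - 1..y} std_normal_density = cdf gauss y" if "y \<in> {x - 1<..}" for y
      using cdf_gauss_diff[of "x - 1" y] that by simp
  qed
qed

text \<open>The integrand may blow up at an endpoint, as the rate does like
  \<open>1 / sqrt (T - s)\<close> at maturity; its sign and the continuity of \<open>\<Phi>\<close>
  up to the ends give integrability. Passing from the open to the closed interval adds only two
  points.\<close>

lemma set_integral_FTC_nonneg:
  fixes f \<Phi> :: "real \<Rightarrow> real"
  assumes "a \<le> b"
    and der: "\<And>x. a < x \<Longrightarrow> x < b \<Longrightarrow> (\<Phi> has_real_derivative f x) (at x)"
    and f: "\<And>x. a < x \<Longrightarrow> x < b \<Longrightarrow> isCont f x" "\<And>x. a < x \<Longrightarrow> x < b \<Longrightarrow> 0 \<le> f x"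
    and \<Phi>: "continuous_on {a..b} \<Phi>"
  shows "set_integrable lborel {a..b} f" "(LBINT x:{a..b}. f x) = \<Phi> b - \<Phi> a"
proof -
  have "set_integrable lborel {a..b} f \<and> (LBINT x:{a..b}. f x) = \<Phi> b - \<Phi> a"
  proof (cases "a = b")
    case True
    have "integrable lborel (\<lambda>x. indicator {b} x * f x) \<and> (\<integral>x. indicator {b} x * f x \<partial>lborel) = 0"
      using integrable_discrete_difference[of "{b}" lborel "\<lambda>x. indicator {b} x * f x" "\<lambda>_. 0"]
        integral_discrete_difference[of "{b}" lborel "\<lambda>x. indicator {b} x * f x" "\<lambda>_. 0"] by simp
    then show ?thesis using True by (simp add: set_integrable_def set_lebesgue_integral_def)
  next
    case False
    with assms have ab: "a < b" by simp
    have A: "((\<Phi> \<circ> real_of_ereal) \<longlongrightarrow> \<Phi> a) (at_right (ereal a))"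
    proof -
      have "(\<Phi> \<longlongrightarrow> \<Phi> a) (at a within {a..b})" using \<Phi> ab by (auto simp: continuous_on)
      then have "(\<Phi> \<longlongrightarrow> \<Phi> a) (at_right a)" using ab by (simp add: at_within_Icc_at_right)
      then show ?thesis by (simp add: ereal_tendsto_simps)
    qed
    have B: "((\<Phi> \<circ> real_of_ereal) \<longlongrightarrow> \<Phi> b) (at_left (ereal b))"
    proof -
      have "(\<Phi> \<longlongrightarrow> \<Phi> b) (at b within {a..b})" using \<Phi> ab by (auto simp: continuous_on)
      then have "(\<Phi> \<longlongrightarrow> \<Phi> b) (at_left b)" using ab by (simp add: at_within_Icc_at_left)
      then show ?thesis by (simp add: ereal_tendsto_simps)
    qed
    have FTC: "set_integrable lborel (einterval (ereal a) (ereal b)) f" "(LBINT x=ereal a..ereal b. f x) = \<Phi> b - \<Phi> a"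
      by (rule interval_integral_FTC_nonneg[where F = \<Phi>]; use ab der f A B in auto)+
    have "integrable lborel (\<lambda>x. indicator {a..b} x * f x)
        = integrable lborel (\<lambda>x. indicator (einterval (ereal a) (ereal b)) x * f x)"
      by (intro integrable_discrete_difference[of "{a, b}"]) (auto simp: indicator_def einterval_def)
    with FTC have "set_integrable lborel {a..b} f" by (simp add: set_integrable_def)
    with FTC show ?thesis using ab by (simp add: interval_integral_Icc)
  qed
  then show "set_integrable lborel {a..b} f" "(LBINT x:{a..b}. f x) = \<Phi> b - \<Phi> a" by auto
qed

text \<open>The boundary is \<open>b = K / bdenom\<close>, and the interest rate is
  \<open>r = - bdenom' / bdenom + c\<^sup>2 / 2\<close> for \<open>c\<^sup>2 = 2 \<delta> + \<sigma>\<^sup>2\<close>, so that \<open>X / b\<close> is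
  a geometric Brownian motion with constant coefficients.\<close>

locale boundary =
  fixes \<sigma> c T :: real
  assumes \<sigma>: "0 < \<sigma>" and c: "0 < c"
begin

definition bdenom :: "real \<Rightarrow> real" where
  "bdenom s = 1 + 2 * \<sigma> / c * (cdf gauss (c * sqrt (T - s)) - 1 / 2)"

text \<open>Minus the logarithmic derivative of \<open>bdenom\<close> before time \<open>T\<close>,
  that is, the growth rate of the boundary.\<close>

definition drift :: "real \<Rightarrow> real" where
  "drift s = \<sigma> * std_normal_density (c * sqrt (T - s)) / (sqrt (T - s) * bdenom s)"

lemma bdenom_claim_value: "s \<le> T \<Longrightarrow> bdenom s = 1 + claim_value \<sigma> c (T - s) 0"
  by (simp add: bdenom_def claim_value_at_0[OF \<sigma> c])

lemma bdenom_ge_1: "s \<le> T \<Longrightarrow> 1 \<le> bdenom s"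
  using claim_value_nonneg[OF \<sigma> c, of "T - s" 0] by (simp add: bdenom_claim_value)

text \<open>The real square root is extended to negative arguments as an odd increasing function, so
  monotonicity, and likewise continuity, need no case distinction at \<open>T\<close>.\<close>

lemma bdenom_antimono: "s \<le> u \<Longrightarrow> bdenom u \<le> bdenom s"
proof -
  assume "s \<le> u"
  interpret real_distribution gauss by (rule real_dist_normal_dist)
  have "c * sqrt (T - u) \<le> c * sqrt (T - s)" using \<open>s \<le> u\<close> c by simp
  then have "cdf gauss (c * sqrt (T - u)) \<le> cdf gauss (c * sqrt (T - s))" by (rule cdf_nondecreasing)
  then show ?thesis using \<sigma> c unfolding bdenom_def
    by (intro add_left_mono mult_left_mono) auto
qed

lemma continuous_on_bdenom: "continuous_on S bdenom"
proof -
  have "continuous_on UNIV (cdf gauss)"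
    using DERIV_cdf_gauss[OF DERIV_ident] by (intro continuous_at_imp_continuous_on) (auto intro: DERIV_isCont)
  then have "continuous_on S (\<lambda>s. cdf gauss (c * sqrt (T - s)))"
    by (rule continuous_on_compose2) (auto intro!: continuous_intros)
  then show ?thesis unfolding bdenom_def by (intro continuous_intros)
qed

lemma DERIV_bdenom:
  assumes "s < T"
  shows "(bdenom has_real_derivative - (drift s * bdenom s)) (at s)"
proof -
  have "(bdenom has_real_derivative
      2 * \<sigma> / c * (std_normal_density (c * sqrt (T - s)) * (c * (- (inverse (sqrt (T - s)) / 2))))) (at s)"
    unfolding bdenom_def[abs_def] using assms by (auto intro!: derivative_eq_intros)
  moreover have "2 * \<sigma> / c * (std_normal_density (c * sqrt (T - s)) * (c * (- (inverse (sqrt (T - s)) / 2))))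
      = - (drift s * bdenom s)"
    using c bdenom_ge_1[of s] assms by (simp add: drift_def field_simps)
  ultimately show ?thesis by simp
qed

lemma drift_nonneg: "s < T \<Longrightarrow> 0 \<le> drift s"
  using \<sigma> bdenom_ge_1[of s] by (simp add: drift_def)

lemma isCont_drift:
  assumes "s < T"
  shows "isCont drift s"
proof -
  have "isCont bdenom s" using continuous_on_bdenom[of UNIV] by (simp add: continuous_on_eq_continuous_at)
  moreover have "isCont std_normal_density y" for y
    unfolding std_normal_density_def by (intro continuous_intros) auto
  then have "isCont (\<lambda>s. std_normal_density (c * sqrt (T - s))) s"
    by (intro isCont_o2[of _ "\<lambda>s. c * sqrt (T - s)" std_normal_density] continuous_intros)
  ultimately show ?thesis
    unfolding drift_def[abs_def] using assms bdenom_ge_1[of s] by (intro continuous_intros) auto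
qed

text \<open>The constant is a parameter because two rates occur: \<open>k = c\<^sup>2 / 2\<close>
  for the discount rate \<open>r\<close>, and \<open>k = \<sigma>\<^sup>2 / 2\<close> for the growth
  rate \<open>r - \<delta>\<close>. The antiderivative stays continuous at the singular endpoint
  \<open>T\<close>.\<close>

lemma drift_integral:
  assumes r: "\<And>u. s < u \<Longrightarrow> u < T \<Longrightarrow> m u = drift u + k" and "0 \<le> k" "s \<le> v" "v \<le> T"
  shows "set_integrable lborel {s..v} m"
    and "(LBINT u:{s..v}. m u) = ln (bdenom s) - ln (bdenom v) + k * (v - s)"
proof -
  let ?\<Phi> = "\<lambda>u. k * u - ln (bdenom u)"
  have pos: "0 < bdenom u" if "u \<le> T" for u using bdenom_ge_1[OF that] by simp
  have near: "eventually (\<lambda>u. m u = drift u + k) (nhds u)" if "s < u" "u < v" for u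
    using that assms by (intro eventually_nhds_in_open[of "{s<..<T}", THEN eventually_mono]) auto
  have der: "(?\<Phi> has_real_derivative m u) (at u)" if "s < u" "u < v" for u
  proof -
    have u: "u < T" using that assms by simp
    have "(?\<Phi> has_real_derivative k * 1 - inverse (bdenom u) * - (drift u * bdenom u)) (at u)"
      using u pos[of u] by (intro derivative_intros DERIV_ln DERIV_chain2[OF DERIV_ln DERIV_bdenom]) auto
    moreover have "k * 1 - inverse (bdenom u) * - (drift u * bdenom u) = m u"
      using pos[of u] u r[of u] that by simp
    ultimately show ?thesis by simp
  qed
  have cont: "isCont m u" if "s < u" "u < v" for u
  proof -
    have "isCont (\<lambda>u. drift u + k) u" using that assms by (intro continuous_intros isCont_drift) auto
    then show ?thesis using isCont_cong[OF near[OF that]] by simp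
  qed
  have nn: "0 \<le> m u" if "s < u" "u < v" for u
    using that assms drift_nonneg[of u] by simp
  have \<Phi>: "continuous_on {s..v} ?\<Phi>"
    using pos assms by (intro continuous_intros continuous_on_bdenom) (auto simp: less_imp_neq[symmetric])
  show "set_integrable lborel {s..v} m"
    by (rule set_integral_FTC_nonneg(1)[OF \<open>s \<le> v\<close> der cont nn \<Phi>])
  show "(LBINT u:{s..v}. m u) = ln (bdenom s) - ln (bdenom v) + k * (v - s)"
    using set_integral_FTC_nonneg(2)[OF \<open>s \<le> v\<close> der cont nn \<Phi>] by (simp add: algebra_simps)
qed

text \<open>\<open>\<theta>\<close> is the exponential of minus the integral of \<open>m\<close>
  from \<open>t\<close>, written through \<open>bdenom\<close>. It solves
  \<open>\<theta>' = - m * \<theta>\<close>, here in the integrated form that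
  \<open>linear_sde_unique\<close> asks for.\<close>

lemma drift_integrating_factor:
  assumes r: "\<And>u. t < u \<Longrightarrow> u < T \<Longrightarrow> m u = drift u + k" and "0 \<le> k" "t \<le> s" "s \<le> v" "v \<le> T"
  defines "\<theta> \<equiv> \<lambda>u. bdenom u / bdenom t * exp (- (k * (u - t)))"
  shows "\<theta> v - \<theta> s = - (LBINT u:{s..v}. m u * \<theta> u)"
proof -
  have pos: "0 < bdenom u" if "u \<le> T" for u using bdenom_ge_1[OF that] by simp
  have tT: "t \<le> T" using assms by simp
  have \<theta>_pos: "0 < \<theta> u" if "u \<le> T" for u using pos[OF that] pos[OF tT] by (simp add: \<theta>_def)
  have \<theta>c: "continuous_on S \<theta>" for S
    unfolding \<theta>_def using pos[OF tT] by (intro continuous_intros continuous_on_bdenom) auto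
  have near: "eventually (\<lambda>u. m u = drift u + k) (nhds u)" if "s < u" "u < v" for u
    using that assms by (intro eventually_nhds_in_open[of "{t<..<T}", THEN eventually_mono]) auto
  have der: "((\<lambda>u. - \<theta> u) has_real_derivative m u * \<theta> u) (at u)" if "s < u" "u < v" for u
  proof -
    have u: "u < T" using that assms by simp
    have e: "((\<lambda>u. exp (- (k * (u - t)))) has_real_derivative - k * exp (- (k * (u - t)))) (at u)"
      by (auto intro!: derivative_eq_intros)
    have "((\<lambda>u. bdenom u / bdenom t) has_real_derivative - (drift u * bdenom u) / bdenom t) (at u)"
      by (rule DERIV_cdivide[OF DERIV_bdenom[OF u]])
    from DERIV_minus[OF DERIV_mult[OF this e]]
    have "((\<lambda>u. - \<theta> u) has_real_derivative
        - (- (drift u * bdenom u) / bdenom t * exp (- (k * (u - t))) + - k * exp (- (k * (u - t))) * (bdenom u / bdenom t))) (at u)"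
      by (simp add: \<theta>_def)
    moreover have "- (- (drift u * bdenom u) / bdenom t * exp (- (k * (u - t))) + - k * exp (- (k * (u - t))) * (bdenom u / bdenom t)) = m u * \<theta> u"
      using u r[of u] that assms by (simp add: \<theta>_def algebra_simps add_divide_distrib)
    ultimately show ?thesis by simp
  qed
  have cont: "isCont (\<lambda>u. m u * \<theta> u) u" if "s < u" "u < v" for u
  proof -
    have "isCont (\<lambda>u. drift u + k) u" using that assms by (intro continuous_intros isCont_drift) auto
    then have "isCont m u" using isCont_cong[OF near[OF that]] by simp
    moreover have "isCont \<theta> u" using \<theta>c[of UNIV] by (simp add: continuous_on_eq_continuous_at)
    ultimately show ?thesis by (intro continuous_intros)
  qed
  have nn: "0 \<le> m u * \<theta> u" if "s < u" "u < v" for u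
  proof (rule mult_nonneg_nonneg)
    show "0 \<le> m u" using that assms(2,3,4,5) drift_nonneg[of u] r[of u] by simp
    show "0 \<le> \<theta> u" using \<theta>_pos[of u] that assms(5) by simp
  qed
  have "(LBINT u:{s..v}. m u * \<theta> u) = - \<theta> v - - \<theta> s"
    by (rule set_integral_FTC_nonneg(2)[OF \<open>s \<le> v\<close> der cont nn continuous_on_minus[OF \<theta>c]])
  then show ?thesis by simp
qed

end

section \<open>The American put\<close>

lemma sinh_le_mult_exp: "0 \<le> v \<Longrightarrow> sinh v \<le> v * exp v" for v :: real
proof -
  assume v: "0 \<le> v"
  have "sinh v \<le> v * cosh v" using sinh_ge_tangent[of v 0] v by simp
  also have "\<dots> \<le> v * exp v"
    using v by (intro mult_left_mono) (simp_all add: cosh_field_def)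
  finally show ?thesis .
qed

text \<open>Trades the first power for the fourth: over a grid, sums of fourth powers of Brownian
  increments vanish with the mesh, sums of first powers do not.\<close>

lemma le_add_power4:
  fixes y \<epsilon> :: real
  assumes "0 < \<epsilon>" "0 \<le> y"
  shows "y \<le> \<epsilon> + y ^ 4 / \<epsilon> ^ 3"
proof (cases "y \<le> \<epsilon>")
  case True
  have "0 \<le> y ^ 4 / \<epsilon> ^ 3" using assms by simp
  with True show ?thesis by simp
next
  case False
  then have "\<epsilon> ^ 3 \<le> y ^ 3" using assms by (intro power_mono) auto
  then have "y * \<epsilon> ^ 3 \<le> y * y ^ 3" using assms by (intro mult_left_mono) auto
  also have "y * y ^ 3 = y ^ 4" by (simp add: power_numeral_reduce)
  finally have "y \<le> y ^ 4 / \<epsilon> ^ 3" using assms by (simp add: field_simps)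
  then show ?thesis using assms by simp
qed

context brownian
begin

text \<open>Stopping times of the price filtration are thereby stopping times of \<open>F\<close>,
  for which the martingale property is available.\<close>

lemma sets_natural_filtration_subset:
  assumes X: "\<And>u. u \<in> {t..T} \<Longrightarrow> X u \<in> borel_measurable (F u)" and "s \<le> T"
  shows "sets (natural_filtration M t X s) \<subseteq> sets (F s)"
proof -
  have "{X u -` A \<inter> space M | u A. u \<in> {t..s} \<and> A \<in> sets borel} \<subseteq> sets (F s)"
  proof safe
    fix u and A :: "real set" assume "u \<in> {t..s}" "A \<in> sets borel"
    then have "X u \<in> borel_measurable (F s)"
      using assms by (intro measurable_F_mono[OF assms(1), of u s]) auto
    then show "X u -` A \<inter> space M \<in> sets (F s)"
      using \<open>A \<in> sets borel\<close> by (auto simp: measurable_def)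
  qed
  then show ?thesis
    unfolding natural_filtration_def
    using sets.sigma_sets_subset[of _ "F s"] by (subst sets_measure_of) auto
qed

lemma space_natural_filtration [simp]: "space (natural_filtration M t X s) = space M"
  unfolding natural_filtration_def by (subst space_measure_of) auto

lemma measurable_natural_filtration:
  fixes X :: "real \<Rightarrow> 'a \<Rightarrow> real"
  assumes "u \<in> {t..s}"
  shows "X u \<in> borel_measurable (natural_filtration M t X s)"
proof (rule measurableI)
  fix A :: "real set" assume "A \<in> sets borel"
  then have "X u -` A \<inter> space M \<in> {X u -` A \<inter> space M | u A. u \<in> {t..s} \<and> A \<in> sets borel}"
    using assms by blast
  then show "X u -` A \<inter> space (natural_filtration M t X s) \<in> sets (natural_filtration M t X s)"
    unfolding space_natural_filtration unfolding natural_filtration_def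
    by (subst sets_measure_of) auto
qed simp

end

locale american_put = brownian M F W + boundary \<sigma> c T
  for M :: "'a measure" and F W and \<sigma> c T :: real +
  fixes K \<delta> t x :: real and r :: "real \<Rightarrow> real" and X :: "real \<Rightarrow> 'a \<Rightarrow> real"
  assumes K: "0 < K" and \<delta>: "0 \<le> \<delta>" and c2: "c\<^sup>2 = 2 * \<delta> + \<sigma>\<^sup>2"
    and t: "0 \<le> t" "t < T" and x: "0 < x"
    and r: "\<And>s. t < s \<Longrightarrow> s < T \<Longrightarrow> r s = drift s + c\<^sup>2 / 2"
    and sde: "sde_solution M F W (\<lambda>s y. (r s - \<delta>) * y) (\<lambda>s y. \<sigma> * y) T t x X"
begin

section \<open>Explicit price and discounted payoff\<close>

definition payoff :: "real \<Rightarrow> 'a \<Rightarrow> real" where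
  "payoff s \<omega> = exp (- (LBINT u:{t..s}. r u)) * max (K - X s \<omega>) 0"

definition bd :: real where "bd = K / bdenom t"

lemma bdenom_pos: "s \<le> T \<Longrightarrow> 0 < bdenom s"
  using bdenom_ge_1[of s] by simp

lemma bd: "0 < bd" "bd * bdenom t = K"
  using K bdenom_pos[of t] t by (simp_all add: bd_def)

lemma discount:
  assumes "t \<le> s" "s \<le> T"
  shows "exp (- (LBINT u:{t..s}. r u)) = bdenom s / bdenom t * exp (- (c\<^sup>2 * (s - t) / 2))"
proof -
  have "(LBINT u:{t..s}. r u) = ln (bdenom t) - ln (bdenom s) + c\<^sup>2 / 2 * (s - t)"
    using r assms by (intro drift_integral(2)) auto
  then have "- (LBINT u:{t..s}. r u) = ln (bdenom s) - ln (bdenom t) + - (c\<^sup>2 * (s - t) / 2)" by simp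
  then show ?thesis
    using bdenom_pos[of s] bdenom_pos[of t] assms by (simp only: exp_add exp_diff exp_ln)
qed

lemma X_F: "s \<in> {t..T} \<Longrightarrow> X s \<in> borel_measurable (F s)"
  and X_continuous: "\<omega> \<in> space M \<Longrightarrow> continuous_on {t..T} (\<lambda>s. X s \<omega>)"
  using sde by (auto simp: sde_solution_def)

text \<open>The growth rate is \<open>r - \<delta> = drift + \<sigma>\<^sup>2 / 2\<close>. Its
  constant part cancels the Ito correction of the exponential and its variable part moves with the
  boundary, so relative to the boundary the price is the exponential of a driftless Brownian
  motion.\<close>

lemma X_explicit:
  assumes s: "t \<le> s" "s \<le> T"
  shows "AE \<omega> in M. X s \<omega> = x * (bdenom t / bdenom s) * exp (\<sigma> * (W s \<omega> - W t \<omega>))"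
proof -
  let ?\<theta> = "\<lambda>u. bdenom u / bdenom t * exp (- (\<sigma>\<^sup>2 / 2 * (u - t)))"
  have m: "r u - \<delta> = drift u + \<sigma>\<^sup>2 / 2" if "t < u" "u < T" for u
    using r[OF that] c2 by (simp add: add_divide_distrib)
  have pos: "0 < bdenom t" "0 < bdenom s" using bdenom_pos s by auto
  have "AE \<omega> in M. ?\<theta> s * exp (\<sigma>\<^sup>2 * (s - t) / 2 - \<sigma> * (W s \<omega> - W t \<omega>)) * X s \<omega> = x"
  proof (rule linear_sde_unique[OF _ s _ _ _ _ sde])
    show "0 \<le> t" by (rule t)
    show "set_integrable lborel {t..T} (\<lambda>s. r s - \<delta>)"
      using t m by (intro drift_integral(1)[of t _ "\<sigma>\<^sup>2 / 2"]) auto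
    show "continuous_on {t..T} ?\<theta>"
      using pos by (intro continuous_intros continuous_on_bdenom) auto
    show "?\<theta> t = 1" using pos by simp
    show "?\<theta> v - ?\<theta> u = - (LBINT w:{u..v}. (r w - \<delta>) * ?\<theta> w)" if "t \<le> u" "u \<le> v" "v \<le> T" for u v
      using m that by (intro drift_integrating_factor) auto
  qed
  then show ?thesis
  proof eventually_elim
    case (elim \<omega>)
    let ?B = "W s \<omega> - W t \<omega>"
    have e: "exp (- (\<sigma>\<^sup>2 / 2 * (s - t))) * exp (\<sigma>\<^sup>2 * (s - t) / 2 - \<sigma> * ?B) = exp (- (\<sigma> * ?B))"
      by (simp flip: exp_add)
    have "X s \<omega> = (bdenom s / bdenom t * exp (- (\<sigma> * ?B)) * X s \<omega>) * (bdenom t / bdenom s) * exp (\<sigma> * ?B)"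
    proof -
      have "exp (- (\<sigma> * ?B)) * exp (\<sigma> * ?B) = 1" by (simp flip: exp_add)
      moreover have "bdenom s / bdenom t * (bdenom t / bdenom s) = 1" using pos by simp
      moreover have "(bdenom s / bdenom t * exp (- (\<sigma> * ?B)) * X s \<omega>) * (bdenom t / bdenom s) * exp (\<sigma> * ?B)
          = (bdenom s / bdenom t * (bdenom t / bdenom s)) * (exp (- (\<sigma> * ?B)) * exp (\<sigma> * ?B)) * X s \<omega>"
        by (simp only: mult_ac)
      ultimately show ?thesis by simp
    qed
    also have "bdenom s / bdenom t * exp (- (\<sigma> * ?B)) * X s \<omega> = x"
      unfolding e[symmetric] using elim by (simp only: mult.assoc)
    finally show ?case .
  qed
qed

lemma payoff_explicit:
  assumes s: "t \<le> s" "s \<le> T"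
  shows "AE \<omega> in M. payoff s \<omega>
      = bd * (exp (- (c\<^sup>2 * (s - t) / 2)) * max (bdenom s - x / bd * exp (\<sigma> * (W s \<omega> - W t \<omega>))) 0)"
  using X_explicit[OF s]
proof eventually_elim
  case (elim \<omega>)
  have pos: "0 < bdenom t" "0 < bdenom s" using bdenom_pos s by auto
  let ?e = "exp (\<sigma> * (W s \<omega> - W t \<omega>))"
  have "bdenom s * (K - X s \<omega>) = K * (bdenom s - x / bd * ?e)"
    unfolding elim using pos K by (simp add: bd_def field_simps)
  moreover have "bdenom s * max (K - X s \<omega>) 0 = max (bdenom s * (K - X s \<omega>)) 0"
    using pos max_mult_distrib_left[of "bdenom s" "K - X s \<omega>" 0] by simp
  moreover have "K * max (bdenom s - x / bd * ?e) 0 = max (K * (bdenom s - x / bd * ?e)) 0"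
    using K max_mult_distrib_left[of K "bdenom s - x / bd * ?e" 0] by simp
  ultimately have "bdenom s * max (K - X s \<omega>) 0 = K * max (bdenom s - x / bd * ?e) 0" by simp
  then show ?case
    unfolding payoff_def discount[OF s] using pos by (simp add: bd_def field_simps)
qed

lemma payoff_bounds:
  assumes s: "t \<le> s" "s \<le> T"
  shows "0 \<le> payoff s \<omega>" "AE \<omega> in M. payoff s \<omega> \<le> K"
proof -
  show "0 \<le> payoff s \<omega>" by (simp add: payoff_def)
  show "AE \<omega> in M. payoff s \<omega> \<le> K"
    using payoff_explicit[OF s]
  proof eventually_elim
    case (elim \<omega>)
    have pos: "0 < bdenom s" using bdenom_pos s by auto
    have "max (bdenom s - x / bd * exp (\<sigma> * (W s \<omega> - W t \<omega>))) 0 \<le> bdenom s"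
      using x bd pos by (intro max.boundedI) auto
    also have "\<dots> \<le> bdenom t" using s(1) by (rule bdenom_antimono)
    finally have "exp (- (c\<^sup>2 * (s - t) / 2)) * max (bdenom s - x / bd * exp (\<sigma> * (W s \<omega> - W t \<omega>))) 0 \<le> 1 * bdenom t"
      using s by (intro mult_mono) auto
    then have "payoff s \<omega> \<le> bd * (1 * bdenom t)"
      unfolding elim using bd(1) by (intro mult_left_mono) auto
    then show ?case using bd(2) by simp
  qed
qed

lemma payoff_measurable: "s \<in> {t..T} \<Longrightarrow> payoff s \<in> borel_measurable M"
  using measurable_F_M[OF X_F] unfolding payoff_def by measurable

lemma payoff_continuous:
  assumes "\<omega> \<in> space M"
  shows "continuous_on {t..T} (\<lambda>s. payoff s \<omega>)"
proof -
  have "continuous_on {t..T} (\<lambda>s. bdenom s / bdenom t * exp (- (c\<^sup>2 * (s - t) / 2)) * max (K - X s \<omega>) 0)"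
    using bdenom_pos[of t] t by (intro continuous_intros continuous_on_bdenom X_continuous assms) auto
  then show ?thesis
    by (rule continuous_on_cong[THEN iffD1, rotated 2]) (auto simp: payoff_def discount)
qed

section \<open>Stopping times with values on a grid\<close>

definition step :: "nat \<Rightarrow> real" where "step n = (T - t) / real (Suc n)"

definition grid :: "nat \<Rightarrow> nat \<Rightarrow> real" where "grid n k = t + real k * step n"

text \<open>The stopping time is given by its grid index and its level sets; in this form optional
  sampling is a finite sum. There are \<open>Suc n\<close> steps, so the index \<open>Suc n\<close>
  is maturity.\<close>

definition grid_time :: "nat \<Rightarrow> ('a \<Rightarrow> nat) \<Rightarrow> bool" where
  "grid_time n \<kappa> \<longleftrightarrow> (\<forall>\<omega>\<in>space M. \<kappa> \<omega> \<le> Suc n) \<and>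
     (\<forall>k\<le>Suc n. {\<omega> \<in> space M. \<kappa> \<omega> = k} \<in> sets (F (grid n k)))"

lemma step_pos: "0 < step n" and step_mult: "real (Suc n) * step n = T - t"
  using t by (simp_all add: step_def)

lemma step_tendsto: "step \<longlonglongrightarrow> 0"
  unfolding step_def using LIMSEQ_inverse_real_of_nat tendsto_mult_right_zero by (force simp: divide_inverse)

lemma grid_0: "grid n 0 = t" and grid_T: "grid n (Suc n) = T"
  using step_mult[of n] by (simp_all add: grid_def)

lemma grid_Suc: "grid n (Suc k) = grid n k + step n"
  by (simp add: grid_def algebra_simps)

lemma grid_mono: "k \<le> l \<Longrightarrow> grid n k \<le> grid n l"
  using step_pos[of n] by (auto simp: grid_def intro!: mult_right_mono)

lemma grid_mem: "k \<le> Suc n \<Longrightarrow> t \<le> grid n k \<and> grid n k \<le> T"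
  using grid_mono[of 0 k n] grid_mono[of k "Suc n" n] by (simp add: grid_0 grid_T)

lemma grid_time_measurable:
  assumes \<kappa>: "grid_time n \<kappa>"
  shows "\<kappa> \<in> measurable M (count_space {..Suc n})"
proof -
  have "\<kappa> -` {k} \<inter> space M \<in> sets M" if "k \<le> Suc n" for k
  proof -
    have "\<kappa> -` {k} \<inter> space M = {\<omega> \<in> space M. \<kappa> \<omega> = k}" by auto
    then show ?thesis using \<kappa> that sets_F_M[of "grid n k"] by (auto simp: grid_time_def)
  qed
  then show ?thesis
    using \<kappa> by (subst measurable_count_space_eq2) (auto simp: grid_time_def)
qed

lemma payoff_grid_integrable:
  assumes \<kappa>: "grid_time n \<kappa>"
  shows "integrable M (\<lambda>\<omega>. payoff (grid n (\<kappa> \<omega>)) \<omega>)"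
    and "AE \<omega> in M. 0 \<le> payoff (grid n (\<kappa> \<omega>)) \<omega> \<and> payoff (grid n (\<kappa> \<omega>)) \<omega> \<le> K"
    and "(\<lambda>\<omega>. payoff (grid n (\<kappa> \<omega>)) \<omega>) \<in> borel_measurable M"
proof -
  show m: "(\<lambda>\<omega>. payoff (grid n (\<kappa> \<omega>)) \<omega>) \<in> borel_measurable M"
    by (rule measurable_compose_countable'[OF _ grid_time_measurable[OF \<kappa>]])
       (use grid_mem in \<open>auto intro!: payoff_measurable\<close>)
  have "AE \<omega> in M. \<forall>k\<in>{..Suc n}. payoff (grid n k) \<omega> \<le> K"
    using grid_mem by (intro AE_finite_allI payoff_bounds) auto
  then show b: "AE \<omega> in M. 0 \<le> payoff (grid n (\<kappa> \<omega>)) \<omega> \<and> payoff (grid n (\<kappa> \<omega>)) \<omega> \<le> K"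
    using AE_space by eventually_elim (use \<kappa> in \<open>auto simp: grid_time_def payoff_def\<close>)
  show "integrable M (\<lambda>\<omega>. payoff (grid n (\<kappa> \<omega>)) \<omega>)"
    by (rule integrable_const_bound[of _ K]) (use b m in auto)
qed

lemma claim_value_sampling:
  assumes \<kappa>: "grid_time n \<kappa>"
  shows "has_bochner_integral M (\<lambda>\<omega>. exp (- (c\<^sup>2 * (grid n (\<kappa> \<omega>) - t) / 2)) *
      claim_value \<sigma> c (T - grid n (\<kappa> \<omega>)) (z + (W (grid n (\<kappa> \<omega>)) \<omega> - W t \<omega>))) (claim_value \<sigma> c (T - t) z)"
proof -
  let ?m = "\<lambda>k \<omega>. exp (- (c\<^sup>2 * (grid n k - t) / 2)) * claim_value \<sigma> c (T - grid n k) (z + (W (grid n k) \<omega> - W t \<omega>))"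
  have "has_bochner_integral M (\<lambda>\<omega>. \<Sum>k\<le>Suc n. indicator {\<omega> \<in> space M. \<kappa> \<omega> = k} \<omega> * ?m k \<omega>) (claim_value \<sigma> c (T - t) z)"
    using \<kappa> grid_mem t
    by (intro claim_value_optional_sampling \<sigma> c) (auto simp: grid_time_def disjoint_family_on_def)
  moreover have "(\<Sum>k\<le>Suc n. indicator {\<omega> \<in> space M. \<kappa> \<omega> = k} \<omega> * ?m k \<omega>) = ?m (\<kappa> \<omega>) \<omega>" if "\<omega> \<in> space M" for \<omega>
  proof -
    have "(\<Sum>k\<le>Suc n. indicator {\<omega> \<in> space M. \<kappa> \<omega> = k} \<omega> * ?m k \<omega>) = (\<Sum>k\<le>Suc n. if \<kappa> \<omega> = k then ?m k \<omega> else 0)"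
      using that by (intro sum.cong refl) simp
    also have "\<dots> = ?m (\<kappa> \<omega>) \<omega>"
      using \<kappa> that by (subst sum.delta') (auto simp: grid_time_def)
    finally show ?thesis .
  qed
  ultimately show ?thesis
    by (subst (asm) has_bochner_integral_cong[OF refl _ refl]) auto
qed

text \<open>With \<open>y = x / bd \<le> 1\<close>, convexity in \<open>x\<close> bounds the payoff
  by \<open>1 - y\<close> times the one from price 0 plus \<open>y\<close> times the one from the
  boundary. Up to the factor \<open>bd\<close>, the first is at most \<open>bdenom t\<close>, and
  the second is dominated by the claim martingale started at \<open>z = 0\<close>, of mean
  \<open>bdenom t - 1\<close>. The weighted sum is exactly \<open>K - x\<close>.\<close>

lemma payoff_grid_le:
  assumes \<kappa>: "grid_time n \<kappa>" and y: "x \<le> bd"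
  shows "(\<integral>\<omega>. payoff (grid n (\<kappa> \<omega>)) \<omega> \<partial>M) \<le> K - x"
proof -
  define y where "y = x / bd"
  have y01: "0 \<le> y" "y \<le> 1" using x bd y by (simp_all add: y_def)
  let ?m = "\<lambda>k \<omega>. exp (- (c\<^sup>2 * (grid n k - t) / 2)) * claim_value \<sigma> c (T - grid n k) (0 + (W (grid n k) \<omega> - W t \<omega>))"
  note S = claim_value_sampling[OF \<kappa>, of 0]
  have Si: "integrable M (\<lambda>\<omega>. ?m (\<kappa> \<omega>) \<omega>)" "(\<integral>\<omega>. ?m (\<kappa> \<omega>) \<omega> \<partial>M) = bdenom t - 1"
    using S t bdenom_claim_value[of t] by (simp_all only: has_bochner_integral_iff)
  have pt: "AE \<omega> in M. payoff (grid n k) \<omega> \<le> bd * ((1 - y) * bdenom t + y * ?m k \<omega>)" if "k \<in> {..Suc n}" for k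
  proof -
    have s: "t \<le> grid n k" "grid n k \<le> T" using grid_mem that by auto
    show ?thesis using payoff_explicit[OF s]
    proof eventually_elim
      case (elim \<omega>)
      let ?s = "grid n k" and ?B = "W (grid n k) \<omega> - W t \<omega>"
      let ?e = "exp (- (c\<^sup>2 * (grid n k - t) / 2))" and ?v = "claim_value \<sigma> c (T - grid n k) (0 + ?B)"
      have e: "0 \<le> ?e" "?e \<le> 1" using s by auto
      have v0: "0 \<le> ?v" by (rule claim_value_nonneg[OF \<sigma> c])
      have "bdenom ?s - 1 - \<sigma> * ?B \<le> ?v"
        using claim_value_ge_tangent[OF \<sigma> c, of "T - ?s" ?B] s bdenom_claim_value[of ?s] by simp
      then have v: "bdenom ?s - exp (\<sigma> * ?B) \<le> ?v"
        using exp_ge_add_one_self[of "\<sigma> * ?B"] by linarith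
      have "bdenom ?s - y * exp (\<sigma> * ?B) = (1 - y) * bdenom ?s + y * (bdenom ?s - exp (\<sigma> * ?B))"
        by (simp add: algebra_simps)
      also have "\<dots> \<le> (1 - y) * bdenom t + y * ?v"
        using y01 s v bdenom_antimono by (intro add_mono mult_left_mono) auto
      finally have "max (bdenom ?s - y * exp (\<sigma> * ?B)) 0 \<le> (1 - y) * bdenom t + y * ?v"
        using y01 v0 bdenom_pos[of t] t by (intro max.boundedI add_nonneg_nonneg mult_nonneg_nonneg) auto
      then have "?e * max (bdenom ?s - y * exp (\<sigma> * ?B)) 0 \<le> ?e * ((1 - y) * bdenom t + y * ?v)"
        using e by (intro mult_left_mono)
      also have "\<dots> = ?e * ((1 - y) * bdenom t) + y * (?e * ?v)" by (simp add: algebra_simps)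
      also have "?e * ((1 - y) * bdenom t) \<le> 1 * ((1 - y) * bdenom t)"
        using e y01 bdenom_pos[of t] t by (intro mult_right_mono mult_nonneg_nonneg) auto
      finally show ?case unfolding elim y_def[symmetric]
        using bd(1) by (intro mult_left_mono) auto
    qed
  qed
  have "AE \<omega> in M. \<forall>k\<in>{..Suc n}. payoff (grid n k) \<omega> \<le> bd * ((1 - y) * bdenom t + y * ?m k \<omega>)"
    by (intro AE_finite_allI pt) auto
  then have le: "AE \<omega> in M. payoff (grid n (\<kappa> \<omega>)) \<omega> \<le> bd * ((1 - y) * bdenom t + y * ?m (\<kappa> \<omega>) \<omega>)"
    using AE_space by eventually_elim (use \<kappa> in \<open>auto simp: grid_time_def\<close>)
  have i: "integrable M (\<lambda>\<omega>. bd * ((1 - y) * bdenom t + y * ?m (\<kappa> \<omega>) \<omega>))"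
    by (intro integrable_mult_right Bochner_Integration.integrable_add integrable_const Si)
  have "(\<integral>\<omega>. payoff (grid n (\<kappa> \<omega>)) \<omega> \<partial>M) \<le> (\<integral>\<omega>. bd * ((1 - y) * bdenom t + y * ?m (\<kappa> \<omega>) \<omega>) \<partial>M)"
    by (rule integral_mono_AE[OF payoff_grid_integrable(1)[OF \<kappa>] i le])
  also have "\<dots> = bd * ((1 - y) * bdenom t + y * (\<integral>\<omega>. ?m (\<kappa> \<omega>) \<omega> \<partial>M))"
  proof -
    have "(\<integral>\<omega>. (1 - y) * bdenom t + y * ?m (\<kappa> \<omega>) \<omega> \<partial>M) = (1 - y) * bdenom t + y * (\<integral>\<omega>. ?m (\<kappa> \<omega>) \<omega> \<partial>M)"
      by (subst Bochner_Integration.integral_add[OF integrable_const integrable_mult_right[OF Si(1)]]) (simp add: prob_space)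
    then show ?thesis by (simp only: integral_mult_right_zero)
  qed
  also have "\<dots> = bd * bdenom t - bd * y"
    unfolding Si(2) by (simp add: algebra_simps)
  also have "\<dots> = K - x" using bd by (simp add: y_def)
  finally show ?thesis .
qed

text \<open>Rounding up, not down, keeps a stopping time a stopping time. The rounded times converge
  to \<open>\<tau>\<close>, the payoff is continuous along paths and bounded by \<open>K\<close>
  almost surely on the grid, so dominated convergence carries a bound from grid times over to
  \<open>\<tau>\<close>.\<close>

lemma exercise_time_value_le:
  assumes \<tau>: "\<tau> \<in> exercise_times M T t X"
    and B: "\<And>n \<kappa>. grid_time n \<kappa> \<Longrightarrow> (\<integral>\<omega>. payoff (grid n (\<kappa> \<omega>)) \<omega> \<partial>M) \<le> B"
  shows "(\<integral>\<omega>. payoff (\<tau> \<omega>) \<omega> \<partial>M) \<le> B"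
proof -
  have \<tau>s: "stopping_time (natural_filtration M t X) \<tau>" and \<tau>T: "\<And>\<omega>. \<omega> \<in> space M \<Longrightarrow> \<tau> \<omega> \<in> {t..T}"
    using \<tau> by (auto simp: exercise_times_def)
  define \<kappa> where "\<kappa> n \<omega> = nat \<lceil>(\<tau> \<omega> - t) / step n\<rceil>" for n \<omega>
  have up: "\<tau> \<omega> \<le> grid n (\<kappa> n \<omega>) \<and> grid n (\<kappa> n \<omega>) < \<tau> \<omega> + step n" if "\<omega> \<in> space M" for n \<omega>
  proof -
    have q: "0 \<le> (\<tau> \<omega> - t) / step n" using \<tau>T[OF that] step_pos[of n] by simp
    then have "real (\<kappa> n \<omega>) = of_int \<lceil>(\<tau> \<omega> - t) / step n\<rceil>" unfolding \<kappa>_def by (intro of_nat_nat) linarith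
    then have "(\<tau> \<omega> - t) / step n \<le> real (\<kappa> n \<omega>)" "real (\<kappa> n \<omega>) < (\<tau> \<omega> - t) / step n + 1" by linarith+
    then show ?thesis using step_pos[of n] unfolding grid_def by (simp add: field_simps)
  qed
  have gt: "grid_time n (\<kappa> n)" for n
    unfolding grid_time_def
  proof (intro conjI ballI allI impI)
    fix \<omega> assume \<omega>: "\<omega> \<in> space M"
    show "\<kappa> n \<omega> \<le> Suc n"
    proof (rule ccontr)
      assume "\<not> \<kappa> n \<omega> \<le> Suc n"
      then have "grid n (Suc (Suc n)) \<le> grid n (\<kappa> n \<omega>)" by (intro grid_mono) simp
      then show False using up[OF \<omega>, of n] \<tau>T[OF \<omega>] by (simp add: grid_Suc[of n "Suc n"] grid_T)
    qed
  next
    fix k assume k: "k \<le> Suc n"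
    \<comment> \<open>The disjunct \<open>k = 0\<close> covers \<open>\<tau> \<omega> = t\<close>,
      where the predecessor \<open>k - 1\<close> would be 0 again.\<close>
    have eq: "{\<omega> \<in> space M. \<kappa> n \<omega> = k} = {\<omega> \<in> space M. \<tau> \<omega> \<le> grid n k \<and> (k = 0 \<or> \<not> \<tau> \<omega> \<le> grid n (k - 1))}"
    proof (intro Collect_cong conj_cong refl)
      fix \<omega> assume \<omega>: "\<omega> \<in> space M"
      note u = up[OF \<omega>, of n]
      show "\<kappa> n \<omega> = k \<longleftrightarrow> \<tau> \<omega> \<le> grid n k \<and> (k = 0 \<or> \<not> \<tau> \<omega> \<le> grid n (k - 1))"
      proof
        assume "\<kappa> n \<omega> = k"
        then show "\<tau> \<omega> \<le> grid n k \<and> (k = 0 \<or> \<not> \<tau> \<omega> \<le> grid n (k - 1))"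
          using u grid_Suc[of n "k - 1"] by (cases k) auto
      next
        assume k: "\<tau> \<omega> \<le> grid n k \<and> (k = 0 \<or> \<not> \<tau> \<omega> \<le> grid n (k - 1))"
        show "\<kappa> n \<omega> = k"
        proof (cases "\<kappa> n \<omega>" k rule: linorder_cases)
          case less
          then have "grid n (\<kappa> n \<omega>) \<le> grid n (k - 1)" by (intro grid_mono) simp
          then show ?thesis using k u less by auto
        next
          case greater
          then have "grid n (Suc k) \<le> grid n (\<kappa> n \<omega>)" by (intro grid_mono) simp
          then show ?thesis using k u by (simp add: grid_Suc)
        qed
      qed
    qed
    have pred: "Measurable.pred (F (grid n k)) (\<lambda>\<omega>. \<tau> \<omega> \<le> grid n l)" if "l \<le> k" for l
    proof -
      have "{\<omega> \<in> space M. \<tau> \<omega> \<le> grid n l} \<in> sets (natural_filtration M t X (grid n l))"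
        using stopping_timeD[OF \<tau>s, of "grid n l"] by (simp add: Measurable.pred_def)
      also have "\<dots> \<subseteq> sets (F (grid n l))"
        using grid_mem[of l n] k that by (intro sets_natural_filtration_subset[of t T] X_F) auto
      also have "\<dots> \<subseteq> sets (F (grid n k))" by (intro sets_F_mono grid_mono that)
      finally show ?thesis by (simp add: Measurable.pred_def)
    qed
    have [measurable]: "Measurable.pred (F (grid n k)) (\<lambda>\<omega>. \<tau> \<omega> \<le> grid n k)"
      "Measurable.pred (F (grid n k)) (\<lambda>\<omega>. \<tau> \<omega> \<le> grid n (k - 1))" by (auto intro: pred)
    have "{\<omega> \<in> space (F (grid n k)). \<tau> \<omega> \<le> grid n k \<and> (k = 0 \<or> \<not> \<tau> \<omega> \<le> grid n (k - 1))} \<in> sets (F (grid n k))"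
      by measurable
    then show "{\<omega> \<in> space M. \<kappa> n \<omega> = k} \<in> sets (F (grid n k))" by (simp only: eq space_F)
  qed
  have lim: "(\<lambda>n. payoff (grid n (\<kappa> n \<omega>)) \<omega>) \<longlonglongrightarrow> payoff (\<tau> \<omega>) \<omega>" if \<omega>: "\<omega> \<in> space M" for \<omega>
  proof (rule continuous_on_tendsto_compose[OF payoff_continuous[OF \<omega>]])
    show "(\<lambda>n. grid n (\<kappa> n \<omega>)) \<longlonglongrightarrow> \<tau> \<omega>"
    proof (rule tendsto_sandwich[where f = "\<lambda>_. \<tau> \<omega>" and h = "\<lambda>n. \<tau> \<omega> + step n"])
      show "(\<lambda>n. \<tau> \<omega> + step n) \<longlonglongrightarrow> \<tau> \<omega>"
        using tendsto_add[OF tendsto_const step_tendsto, of "\<tau> \<omega>"] by simp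
      show "\<forall>\<^sub>F n in sequentially. \<tau> \<omega> \<le> grid n (\<kappa> n \<omega>)"
        using up[OF \<omega>] by simp
      show "\<forall>\<^sub>F n in sequentially. grid n (\<kappa> n \<omega>) \<le> \<tau> \<omega> + step n"
        using up[OF \<omega>] by (simp add: less_imp_le)
    qed (rule tendsto_const)
    show "\<tau> \<omega> \<in> {t..T}" by (rule \<tau>T[OF \<omega>])
    show "\<forall>\<^sub>F n in sequentially. grid n (\<kappa> n \<omega>) \<in> {t..T}"
      using gt grid_mem \<omega> by (auto simp: grid_time_def)
  qed
  have "(\<lambda>n. \<integral>\<omega>. payoff (grid n (\<kappa> n \<omega>)) \<omega> \<partial>M) \<longlonglongrightarrow> (\<integral>\<omega>. payoff (\<tau> \<omega>) \<omega> \<partial>M)"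
  proof (rule integral_dominated_convergence[where w = "\<lambda>_. K"])
    show "(\<lambda>\<omega>. payoff (\<tau> \<omega>) \<omega>) \<in> borel_measurable M"
      by (rule borel_measurable_LIMSEQ_real[OF lim payoff_grid_integrable(3)[OF gt]])
    show "AE \<omega> in M. norm (payoff (grid n (\<kappa> n \<omega>)) \<omega>) \<le> K" for n
      using payoff_grid_integrable(2)[OF gt[of n]] by eventually_elim auto
    show "AE \<omega> in M. (\<lambda>n. payoff (grid n (\<kappa> n \<omega>)) \<omega>) \<longlonglongrightarrow> payoff (\<tau> \<omega>) \<omega>"
      using lim by (rule AE_I2)
    show "(\<lambda>\<omega>. payoff (grid n (\<kappa> n \<omega>)) \<omega>) \<in> borel_measurable M" for n
      by (rule payoff_grid_integrable(3)[OF gt])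
    show "integrable M (\<lambda>_. K)" by simp
  qed
  then show ?thesis
    by (rule LIMSEQ_le_const2) (use B gt in auto)
qed

lemma exercise_value_le_K:
  assumes \<tau>: "\<tau> \<in> exercise_times M T t X"
  shows "(\<integral>\<omega>. payoff (\<tau> \<omega>) \<omega> \<partial>M) \<le> K"
proof (rule exercise_time_value_le[OF \<tau>])
  fix n \<kappa> assume \<kappa>: "grid_time n \<kappa>"
  have "(\<integral>\<omega>. payoff (grid n (\<kappa> \<omega>)) \<omega> \<partial>M) \<le> (\<integral>\<omega>. K \<partial>M)"
    using payoff_grid_integrable[OF \<kappa>] by (intro integral_mono_AE) auto
  then show "(\<integral>\<omega>. payoff (grid n (\<kappa> \<omega>)) \<omega> \<partial>M) \<le> K" by (simp add: prob_space)
qed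

section \<open>Comparison of the value with immediate exercise\<close>

lemma value_eq: "american_put_value M r K T t X = (SUP \<tau>\<in>exercise_times M T t X. \<integral>\<omega>. payoff (\<tau> \<omega>) \<omega> \<partial>M)"
  by (simp add: american_put_value_def payoff_def)

text \<open>A supremum in the reals is sure to dominate its members only if they are bounded above;
  \<open>K\<close> is the bound.\<close>

lemma le_value:
  assumes "\<tau> \<in> exercise_times M T t X"
  shows "(\<integral>\<omega>. payoff (\<tau> \<omega>) \<omega> \<partial>M) \<le> american_put_value M r K T t X"
  unfolding value_eq using assms exercise_value_le_K
  by (intro cSUP_upper bdd_aboveI2[where M = K]) auto

lemma immediate_exercise: "(\<lambda>_. t) \<in> exercise_times M T t X"
  using t by (auto simp: exercise_times_def intro: stopping_time_const)

lemma intrinsic_le_value: "K - x \<le> american_put_value M r K T t X"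
proof -
  have "exp (- (LBINT u:{t..t}. r u)) = 1"
    using discount[of t] bdenom_pos[of t] t by simp
  moreover have "AE \<omega> in M. X t \<omega> = x"
    using X_explicit[of t] bdenom_pos[of t] t by simp
  ultimately have pt: "AE \<omega> in M. payoff t \<omega> = max (K - x) 0"
    unfolding payoff_def by (auto elim!: eventually_mono)
  have "(\<integral>\<omega>. payoff t \<omega> \<partial>M) = (\<integral>\<omega>. max (K - x) 0 \<partial>M)"
    using t by (intro integral_cong_AE pt payoff_measurable) auto
  then show ?thesis
    using le_value[OF immediate_exercise] by (simp add: prob_space)
qed

lemma value_stopping_region:
  assumes "x \<le> bd"
  shows "american_put_value M r K T t X = K - x"
proof (rule antisym[OF _ intrinsic_le_value])
  show "american_put_value M r K T t X \<le> K - x"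
    unfolding value_eq
  proof (rule cSUP_least)
    show "exercise_times M T t X \<noteq> {}" using immediate_exercise by blast
    show "(\<integral>\<omega>. payoff (\<tau> \<omega>) \<omega> \<partial>M) \<le> K - x" if "\<tau> \<in> exercise_times M T t X" for \<tau>
      using that payoff_grid_le[OF _ assms] by (rule exercise_time_value_le)
  qed
qed

section \<open>First grid visit to the stopping region\<close>

definition hit :: "nat \<Rightarrow> 'a \<Rightarrow> nat" where
  "hit n \<omega> = (LEAST k. k = Suc n \<or> X (grid n k) \<omega> * bdenom (grid n k) \<le> K)"

lemma hit_stops: "hit n \<omega> = Suc n \<or> X (grid n (hit n \<omega>)) \<omega> * bdenom (grid n (hit n \<omega>)) \<le> K"
  unfolding hit_def by (rule LeastI[of _ "Suc n"]) simp

lemma hit_minimal: "X (grid n k) \<omega> * bdenom (grid n k) \<le> K \<Longrightarrow> hit n \<omega> \<le> k"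
  unfolding hit_def by (rule Least_le) simp

lemma hit_le: "hit n \<omega> \<le> Suc n"
  unfolding hit_def by (rule Least_le) simp

lemma hit_grid_time: "grid_time n (hit n)"
  unfolding grid_time_def
proof (intro conjI ballI allI impI hit_le)
  fix k assume k: "k \<le> Suc n"
  have eq: "hit n \<omega> = k \<longleftrightarrow> (k = Suc n \<or> X (grid n k) \<omega> * bdenom (grid n k) \<le> K) \<and>
      (\<forall>j\<in>{..<k}. \<not> X (grid n j) \<omega> * bdenom (grid n j) \<le> K)" for \<omega>
  proof
    assume "hit n \<omega> = k"
    then show "(k = Suc n \<or> X (grid n k) \<omega> * bdenom (grid n k) \<le> K) \<and>
      (\<forall>j\<in>{..<k}. \<not> X (grid n j) \<omega> * bdenom (grid n j) \<le> K)"
      using hit_stops[of n \<omega>] hit_minimal[of n _ \<omega>] by (auto simp: not_le[symmetric])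
  next
    assume *: "(k = Suc n \<or> X (grid n k) \<omega> * bdenom (grid n k) \<le> K) \<and>
      (\<forall>j\<in>{..<k}. \<not> X (grid n j) \<omega> * bdenom (grid n j) \<le> K)"
    then have "hit n \<omega> \<le> k" using hit_le[of n \<omega>] hit_minimal[of n k \<omega>] by auto
    moreover have "\<not> hit n \<omega> < k" using * hit_stops[of n \<omega>] k by auto
    ultimately show "hit n \<omega> = k" by simp
  qed
  have [measurable]: "X (grid n j) \<in> borel_measurable (F (grid n k))" if "j \<le> k" for j
    using grid_mem[of j n] that k by (intro measurable_F_mono[OF X_F grid_mono]) auto
  have "Measurable.pred (F (grid n k)) (\<lambda>\<omega>. (k = Suc n \<or> X (grid n k) \<omega> * bdenom (grid n k) \<le> K) \<and>
      (\<forall>j\<in>{..<k}. \<not> X (grid n j) \<omega> * bdenom (grid n j) \<le> K))"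
    by measurable
  then show "{\<omega> \<in> space M. hit n \<omega> = k} \<in> sets (F (grid n k))"
    by (simp only: eq Measurable.pred_def space_F)
qed

text \<open>The rule compares \<open>X\<close> with \<open>K / bdenom\<close>, so it can be read off
  the price alone, as the filtration in the value function demands. Having stopped by time
  \<open>u\<close> is a finite union over the grid points up to \<open>u\<close>.\<close>

lemma hit_exercise_time: "(\<lambda>\<omega>. grid n (hit n \<omega>)) \<in> exercise_times M T t X"
  unfolding exercise_times_def
proof (intro CollectI conjI ballI stopping_timeI)
  fix \<omega> show "grid n (hit n \<omega>) \<in> {t..T}" using grid_mem[OF hit_le] by simp
next
  fix u
  let ?k = "{k. k \<le> Suc n \<and> grid n k \<le> u}"
  have eq: "grid n (hit n \<omega>) \<le> u \<longleftrightarrow> (\<exists>k\<in>?k. k = Suc n \<or> X (grid n k) \<omega> * bdenom (grid n k) \<le> K)" for \<omega>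
  proof
    assume "grid n (hit n \<omega>) \<le> u"
    then show "\<exists>k\<in>?k. k = Suc n \<or> X (grid n k) \<omega> * bdenom (grid n k) \<le> K"
      using hit_le hit_stops by (intro bexI[of _ "hit n \<omega>"]) auto
  next
    assume "\<exists>k\<in>?k. k = Suc n \<or> X (grid n k) \<omega> * bdenom (grid n k) \<le> K"
    then obtain k where k: "k \<in> ?k" "k = Suc n \<or> X (grid n k) \<omega> * bdenom (grid n k) \<le> K" by auto
    then have "hit n \<omega> \<le> k" using hit_le hit_minimal by auto
    then show "grid n (hit n \<omega>) \<le> u" using grid_mono[of "hit n \<omega>" k n] k by simp
  qed
  have [measurable]: "X (grid n k) \<in> borel_measurable (natural_filtration M t X u)" if "k \<in> ?k" for k
    using that grid_mem[of k n] by (intro measurable_natural_filtration) auto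
  have fin: "finite ?k" by (rule finite_subset[of _ "{..Suc n}"]) auto
  have "{\<omega> \<in> space (natural_filtration M t X u). k = Suc n \<or> X (grid n k) \<omega> * bdenom (grid n k) \<le> K}
      \<in> sets (natural_filtration M t X u)" if "k \<in> ?k" for k
    using that by measurable
  then have "(\<Union>k\<in>?k. {\<omega> \<in> space (natural_filtration M t X u). k = Suc n \<or> X (grid n k) \<omega> * bdenom (grid n k) \<le> K})
      \<in> sets (natural_filtration M t X u)"
    by (rule sets.finite_UN[OF fin])
  also have "(\<Union>k\<in>?k. {\<omega> \<in> space (natural_filtration M t X u). k = Suc n \<or> X (grid n k) \<omega> * bdenom (grid n k) \<le> K})
      = {\<omega> \<in> space (natural_filtration M t X u). grid n (hit n \<omega>) \<le> u}"
    by (simp only: eq) blast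
  finally show "Measurable.pred (natural_filtration M t X u) (\<lambda>\<omega>. grid n (hit n \<omega>) \<le> u)"
    by (simp only: Measurable.pred_def)
qed

text \<open>The sum stands in for the largest overshoot over the grid. Each term has mean of order
  \<open>(step n)\<^sup>2\<close>, so \<open>Suc n\<close> of them still vanish, whereas second
  powers would only stay bounded. The exponential factor comes from
  \<open>sinh v \<le> v * exp v\<close>.\<close>

lemma increments_quartic:
  obtains C where "0 \<le> C"
    "\<And>n. integrable M (\<lambda>\<omega>. \<Sum>j<Suc n. (c * \<bar>W (grid n (Suc j)) \<omega> - W (grid n j) \<omega>\<bar> * exp (c * \<bar>W (grid n (Suc j)) \<omega> - W (grid n j) \<omega>\<bar>)) ^ 4)"
    "\<And>n. (\<integral>\<omega>. (\<Sum>j<Suc n. (c * \<bar>W (grid n (Suc j)) \<omega> - W (grid n j) \<omega>\<bar> * exp (c * \<bar>W (grid n (Suc j)) \<omega> - W (grid n j) \<omega>\<bar>)) ^ 4) \<partial>M) \<le> C * step n"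
proof -
  let ?\<phi> = "\<lambda>y. (c * \<bar>y\<bar> * exp (c * \<bar>y\<bar>)) ^ 4"
  define C where "C = c ^ 4 * (2 * fact (2 * 2) * exp ((1 + 4 * c * sqrt (T - t))\<^sup>2 / 2))"
  have C: "0 \<le> C" by (simp add: C_def)
  have step_le: "step n \<le> T - t" for n
    using t divide_left_mono[of 1 "real (Suc n)" "T - t"] by (simp add: step_def)
  have one: "integrable M (\<lambda>\<omega>. ?\<phi> (W (grid n (Suc j)) \<omega> - W (grid n j) \<omega>)) \<and>
      (\<integral>\<omega>. ?\<phi> (W (grid n (Suc j)) \<omega> - W (grid n j) \<omega>) \<partial>M) \<le> C * (step n)\<^sup>2" if "j < Suc n" for n j
  proof -
    have b: "0 \<le> grid n j" "grid n j \<le> grid n (Suc j)"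
      using grid_mem[of j n] grid_mono[of j "Suc j" n] that t by auto
    have h: "0 \<le> step n" "step n \<le> T - t" "0 \<le> 4 * c"
      using step_pos[of n] step_le[of n] c by auto
    have eq: "?\<phi> y = c ^ 4 * (y ^ (2 * 2) * exp (4 * c * \<bar>y\<bar>))" for y
    proof -
      have "exp (c * \<bar>y\<bar>) ^ 4 = exp (4 * c * \<bar>y\<bar>)" by (simp flip: exp_of_nat_mult)
      then show ?thesis by (simp add: power_mult_distrib)
    qed
    have m: "(\<lambda>y. c ^ 4 * (y ^ (2 * 2) * exp (4 * c * \<bar>y\<bar>))) \<in> borel_measurable borel" by measurable
    have d: "grid n (Suc j) - grid n j = step n" by (simp add: grid_Suc)
    note mb = gauss_moment_bound[OF h, of 2]
    note ii = increment_integral[OF b m, unfolded d]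
    have "c ^ 4 * (\<integral>x. (sqrt (step n) * x) ^ (2 * 2) * exp (4 * c * \<bar>sqrt (step n) * x\<bar>) \<partial>gauss)
        \<le> c ^ 4 * ((step n)\<^sup>2 * (2 * fact (2 * 2) * exp ((1 + 4 * c * sqrt (T - t))\<^sup>2 / 2)))"
      using mb(2) c by (intro mult_left_mono) auto
    then have "c ^ 4 * (\<integral>x. (sqrt (step n) * x) ^ (2 * 2) * exp (4 * c * \<bar>sqrt (step n) * x\<bar>) \<partial>gauss) \<le> C * (step n)\<^sup>2"
      by (simp only: C_def mult_ac)
    then have "(\<integral>\<omega>. c ^ 4 * ((W (grid n (Suc j)) \<omega> - W (grid n j) \<omega>) ^ (2 * 2) * exp (4 * c * \<bar>W (grid n (Suc j)) \<omega> - W (grid n j) \<omega>\<bar>)) \<partial>M)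
        \<le> C * (step n)\<^sup>2"
      by (subst ii(2)) (simp only: integral_mult_right_zero)
    with ii(1)[THEN iffD2, OF integrable_mult_right[OF mb(1)]] show ?thesis
      by (simp only: eq simp_thms)
  qed
  show ?thesis
  proof (rule that[of "C * (T - t)"])
    show "0 \<le> C * (T - t)" using C t by simp
    fix n
    show "integrable M (\<lambda>\<omega>. \<Sum>j<Suc n. ?\<phi> (W (grid n (Suc j)) \<omega> - W (grid n j) \<omega>))"
      using one by (intro Bochner_Integration.integrable_sum) auto
    have "(\<integral>\<omega>. (\<Sum>j<Suc n. ?\<phi> (W (grid n (Suc j)) \<omega> - W (grid n j) \<omega>)) \<partial>M)
        = (\<Sum>j<Suc n. \<integral>\<omega>. ?\<phi> (W (grid n (Suc j)) \<omega> - W (grid n j) \<omega>) \<partial>M)"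
      using one by (intro Bochner_Integration.integral_sum) auto
    also have "\<dots> \<le> (\<Sum>j<Suc n. C * (step n)\<^sup>2)" using one by (intro sum_mono) auto
    also have "\<dots> = C * (real (Suc n) * step n) * step n" by (simp add: power2_eq_square algebra_simps)
    finally show "(\<integral>\<omega>. (\<Sum>j<Suc n. ?\<phi> (W (grid n (Suc j)) \<omega> - W (grid n j) \<omega>)) \<partial>M) \<le> C * (T - t) * step n"
      unfolding step_mult .
  qed
qed

text \<open>The overshoot below the level \<open>Z = 0\<close> is at most one increment of \<open>W\<close>.\<close>

lemma payoff_hit_ge:
  assumes y: "bd < x" and \<epsilon>: "0 < \<epsilon>"
  defines "z \<equiv> ln (x / bd) / \<sigma>"
  defines "G \<equiv> \<lambda>n \<omega>. \<Sum>j<Suc n. (c * \<bar>W (grid n (Suc j)) \<omega> - W (grid n j) \<omega>\<bar> * exp (c * \<bar>W (grid n (Suc j)) \<omega> - W (grid n j) \<omega>\<bar>)) ^ 4"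
  shows "AE \<omega> in M. bd * (exp (- (c\<^sup>2 * (grid n (hit n \<omega>) - t) / 2)) *
        claim_value \<sigma> c (T - grid n (hit n \<omega>)) (z + (W (grid n (hit n \<omega>)) \<omega> - W t \<omega>))
        - 2 * \<sigma> / c * (\<epsilon> + G n \<omega> / \<epsilon> ^ 3)) \<le> payoff (grid n (hit n \<omega>)) \<omega>"
proof -
  have ex: "AE \<omega> in M. \<forall>k\<in>{..Suc n}. X (grid n k) \<omega> = x * (bdenom t / bdenom (grid n k)) * exp (\<sigma> * (W (grid n k) \<omega> - W t \<omega>))"
    using grid_mem by (intro AE_finite_allI X_explicit) auto
  have ep: "AE \<omega> in M. \<forall>k\<in>{..Suc n}. payoff (grid n k) \<omega> = bd * (exp (- (c\<^sup>2 * (grid n k - t) / 2)) *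
      max (bdenom (grid n k) - x / bd * exp (\<sigma> * (W (grid n k) \<omega> - W t \<omega>))) 0)"
    using grid_mem by (intro AE_finite_allI payoff_explicit) auto
  have xbd: "x / bd = exp (\<sigma> * z)" "0 < z"
    using \<sigma> x bd y by (simp_all add: z_def)
  from ex ep show ?thesis
  proof eventually_elim
    case (elim \<omega>)
    define Z where "Z k = z + (W (grid n k) \<omega> - W t \<omega>)" for k
    have le_iff: "X (grid n k) \<omega> * bdenom (grid n k) \<le> K \<longleftrightarrow> Z k \<le> 0" if "k \<le> Suc n" for k
    proof -
      have pos: "0 < bdenom (grid n k)" using bdenom_pos grid_mem[OF that] by auto
      have "X (grid n k) \<omega> * bdenom (grid n k) = (x * bdenom t) * exp (\<sigma> * (W (grid n k) \<omega> - W t \<omega>))"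
        using elim(1) that pos by simp
      also have "x * bdenom t = K * exp (\<sigma> * z)"
        unfolding xbd(1)[symmetric] using bd by (simp add: field_simps)
      finally have "X (grid n k) \<omega> * bdenom (grid n k) = K * exp (\<sigma> * Z k)"
        by (simp add: Z_def distrib_left mult.assoc flip: exp_add)
      then show ?thesis using K \<sigma> by (simp add: mult_le_0_iff)
    qed
    define k where "k = hit n \<omega>"
    have k: "k \<le> Suc n" using hit_le by (simp add: k_def)
    let ?s = "grid n k" and ?e = "exp (- (c\<^sup>2 * (grid n k - t) / 2))"
    have s: "t \<le> ?s" "?s \<le> T" using grid_mem[OF k] by auto
    have e: "0 < ?e" "?e \<le> 1" using s by auto
    have G0: "0 \<le> G n \<omega>" unfolding G_def by (intro sum_nonneg) simp
    then have R0: "0 \<le> 2 * \<sigma> / c * (\<epsilon> + G n \<omega> / \<epsilon> ^ 3)" using \<sigma> c \<epsilon> by simp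
    have main: "claim_value \<sigma> c (T - ?s) (Z k) - 2 * \<sigma> / c * (\<epsilon> + G n \<omega> / \<epsilon> ^ 3) \<le> max (bdenom ?s - exp (\<sigma> * Z k)) 0"
    proof (cases "Z k \<le> 0")
      case False
      \<comment> \<open>To be still above the level means to have been stopped by maturity, where
        the claim pays nothing.\<close>
      then have "k = Suc n" using hit_stops[of n \<omega>] le_iff[OF k] by (auto simp: k_def)
      then have "claim_value \<sigma> c (T - ?s) (Z k) = 0"
        using False by (simp add: grid_T claim_value_0[OF \<sigma> c] claim_eq_0[OF \<sigma> c])
      then show ?thesis using R0 by (simp add: max_def)
    next
      case True
      have "Z 0 = z" by (simp add: Z_def grid_0)
      then have "k \<noteq> 0" using True xbd(2) by (intro notI) simp
      \<comment> \<open>The start \<open>z > 0\<close> excludes stopping at index 0, so there is a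
        previous grid time, at which the path was above the level.\<close>
      then obtain j where j: "k = Suc j" by (cases k) auto
      then have "\<not> Z j \<le> 0"
        using hit_minimal[of n j \<omega>] le_iff[of j] k by (auto simp: k_def)
      then have ov: "- Z k \<le> \<bar>W (grid n (Suc j)) \<omega> - W (grid n j) \<omega>\<bar>" (is "_ \<le> ?d")
        by (simp add: Z_def j)
      define v where "v = c * - Z k"
      have v: "0 \<le> v" "v \<le> c * ?d" using mult_left_mono[OF ov, of c] True c by (auto simp: v_def mult_nonneg_nonpos)
      have "sinh v \<le> v * exp v" using v by (intro sinh_le_mult_exp)
      also have "\<dots> \<le> c * ?d * exp (c * ?d)" using v by (intro mult_mono) auto
      also have "\<dots> \<le> \<epsilon> + (c * ?d * exp (c * ?d)) ^ 4 / \<epsilon> ^ 3"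
        using c by (intro le_add_power4 \<epsilon>) auto
      also have "(c * ?d * exp (c * ?d)) ^ 4 \<le> G n \<omega>"
        unfolding G_def using k j by (intro member_le_sum) auto
      finally have "sinh v \<le> \<epsilon> + G n \<omega> / \<epsilon> ^ 3" using \<epsilon> by (simp add: divide_right_mono)
      then have "2 * \<sigma> / c * sinh v \<le> 2 * \<sigma> / c * (\<epsilon> + G n \<omega> / \<epsilon> ^ 3)"
        using \<sigma> c by (intro mult_left_mono) auto
      moreover have "claim_value \<sigma> c (T - ?s) (Z k) \<le> claim_value \<sigma> c (T - ?s) 0 + 2 * \<sigma> / c * sinh v"
        using claim_value_gap[OF \<sigma> c, of "T - ?s" "Z k"] s True by (simp add: v_def)
      moreover have "exp (\<sigma> * Z k) \<le> 1" using True \<sigma> by (simp add: mult_nonneg_nonpos)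
      ultimately have "claim_value \<sigma> c (T - ?s) (Z k) - 2 * \<sigma> / c * (\<epsilon> + G n \<omega> / \<epsilon> ^ 3) \<le> bdenom ?s - exp (\<sigma> * Z k)"
        using bdenom_claim_value[OF s(2)] by linarith
      then show ?thesis by (rule max.coboundedI1)
    qed
    have pk: "payoff ?s \<omega> = bd * (?e * max (bdenom ?s - exp (\<sigma> * Z k)) 0)"
      using elim(2) k unfolding xbd(1) by (simp add: Z_def distrib_left flip: exp_add)
    have "?e * claim_value \<sigma> c (T - ?s) (Z k) - 2 * \<sigma> / c * (\<epsilon> + G n \<omega> / \<epsilon> ^ 3)
        \<le> ?e * (claim_value \<sigma> c (T - ?s) (Z k) - 2 * \<sigma> / c * (\<epsilon> + G n \<omega> / \<epsilon> ^ 3))"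
      using mult_right_mono[OF e(2) R0] by (simp add: right_diff_distrib)
    also have "\<dots> \<le> ?e * max (bdenom ?s - exp (\<sigma> * Z k)) 0"
      using main e by (intro mult_left_mono) auto
    finally show ?case
      unfolding k_def[symmetric] Z_def[symmetric] pk using bd(1) by (intro mult_left_mono) auto
  qed
qed

text \<open>Up to a constant, the overshoot costs
  \<open>\<epsilon> + C * step n / \<epsilon> ^ 3\<close>: the mesh tends to 0 first, for fixed
  \<open>\<epsilon>\<close>, and \<open>\<epsilon>\<close> afterwards. What remains is
  \<open>bd * claim_value \<sigma> c (T - t) z\<close>, and strictness against \<open>K - x\<close>
  comes from \<open>1 + \<sigma> * z < exp (\<sigma> * z)\<close> for \<open>z > 0\<close>.\<close>

lemma value_continuation_region:
  assumes y: "bd < x"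
  shows "K - x < american_put_value M r K T t X"
proof -
  define z where "z = ln (x / bd) / \<sigma>"
  have xbd: "x / bd = exp (\<sigma> * z)" "0 < z"
    using \<sigma> x bd y by (simp_all add: z_def)
  let ?V = "american_put_value M r K T t X" and ?v = "claim_value \<sigma> c (T - t) z"
  define G where "G n \<omega> = (\<Sum>j<Suc n. (c * \<bar>W (grid n (Suc j)) \<omega> - W (grid n j) \<omega>\<bar> * exp (c * \<bar>W (grid n (Suc j)) \<omega> - W (grid n j) \<omega>\<bar>)) ^ 4)" for n \<omega>
  obtain C where C: "0 \<le> C" "\<And>n. integrable M (G n)" "\<And>n. (\<integral>\<omega>. G n \<omega> \<partial>M) \<le> C * step n"
    unfolding G_def using increments_quartic by blast
  have low: "bd * (?v - 2 * \<sigma> / c * (\<epsilon> + C * step n / \<epsilon> ^ 3)) \<le> ?V" if \<epsilon>: "0 < \<epsilon>" for \<epsilon> n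
  proof -
    let ?m = "\<lambda>\<omega>. exp (- (c\<^sup>2 * (grid n (hit n \<omega>) - t) / 2)) *
        claim_value \<sigma> c (T - grid n (hit n \<omega>)) (z + (W (grid n (hit n \<omega>)) \<omega> - W t \<omega>))"
    have S: "integrable M ?m" "(\<integral>\<omega>. ?m \<omega> \<partial>M) = ?v"
      using claim_value_sampling[OF hit_grid_time, of n z] by (simp_all only: has_bochner_integral_iff)
    have Gi: "integrable M (\<lambda>\<omega>. 2 * \<sigma> / c * (\<epsilon> + G n \<omega> / \<epsilon> ^ 3))"
      by (intro integrable_mult_right Bochner_Integration.integrable_add integrable_const integrable_divide C)
    have GI: "(\<integral>\<omega>. 2 * \<sigma> / c * (\<epsilon> + G n \<omega> / \<epsilon> ^ 3) \<partial>M) = 2 * \<sigma> / c * (\<epsilon> + (\<integral>\<omega>. G n \<omega> \<partial>M) / \<epsilon> ^ 3)"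
      using C(2)[of n] by (subst integral_mult_right_zero, subst Bochner_Integration.integral_add) (auto simp: prob_space)
    have "(\<integral>\<omega>. G n \<omega> \<partial>M) / \<epsilon> ^ 3 \<le> C * step n / \<epsilon> ^ 3"
      using C(3)[of n] \<epsilon> by (intro divide_right_mono) auto
    then have "2 * \<sigma> / c * (\<epsilon> + (\<integral>\<omega>. G n \<omega> \<partial>M) / \<epsilon> ^ 3) \<le> 2 * \<sigma> / c * (\<epsilon> + C * step n / \<epsilon> ^ 3)"
      using \<sigma> c by (intro mult_left_mono add_left_mono) auto
    then have "bd * (?v - 2 * \<sigma> / c * (\<epsilon> + C * step n / \<epsilon> ^ 3))
        \<le> bd * (?v - 2 * \<sigma> / c * (\<epsilon> + (\<integral>\<omega>. G n \<omega> \<partial>M) / \<epsilon> ^ 3))"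
      using bd(1) by (intro mult_left_mono) auto
    also have "\<dots> = (\<integral>\<omega>. bd * (?m \<omega> - 2 * \<sigma> / c * (\<epsilon> + G n \<omega> / \<epsilon> ^ 3)) \<partial>M)"
      by (subst integral_mult_right_zero, subst Bochner_Integration.integral_diff[OF S(1) Gi]) (simp only: S(2) GI)
    also have "\<dots> \<le> (\<integral>\<omega>. payoff (grid n (hit n \<omega>)) \<omega> \<partial>M)"
      using payoff_hit_ge[OF y \<epsilon>, of n] unfolding G_def[symmetric] z_def[symmetric]
      by (intro integral_mono_AE integrable_mult_right Bochner_Integration.integrable_diff S Gi
          payoff_grid_integrable(1)[OF hit_grid_time])
    also have "\<dots> \<le> ?V" by (rule le_value[OF hit_exercise_time])
    finally show ?thesis .
  qed
  have low': "bd * (?v - 2 * \<sigma> / c * \<epsilon>) \<le> ?V" if \<epsilon>: "0 < \<epsilon>" for \<epsilon>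
  proof (rule LIMSEQ_le_const2)
    have "(\<lambda>n. bd * (?v - 2 * \<sigma> / c * (\<epsilon> + C * step n / \<epsilon> ^ 3))) \<longlonglongrightarrow> bd * (?v - 2 * \<sigma> / c * (\<epsilon> + C * 0 / \<epsilon> ^ 3))"
      using \<epsilon> by (intro tendsto_intros step_tendsto) simp
    then show "(\<lambda>n. bd * (?v - 2 * \<sigma> / c * (\<epsilon> + C * step n / \<epsilon> ^ 3))) \<longlonglongrightarrow> bd * (?v - 2 * \<sigma> / c * \<epsilon>)" by simp
  qed (use low[OF \<epsilon>] in auto)
  have "bd * ?v \<le> ?V"
  proof (rule field_le_epsilon)
    fix e :: real assume e: "0 < e"
    define \<epsilon> where "\<epsilon> = e / (bd * (2 * \<sigma> / c))"
    have "0 < \<epsilon>" using e bd \<sigma> c by (simp add: \<epsilon>_def)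
    from low'[OF this] show "bd * ?v \<le> ?V + e"
      using bd \<sigma> c by (simp add: \<epsilon>_def right_diff_distrib)
  qed
  moreover have "bdenom t - 1 - \<sigma> * z \<le> ?v"
    using claim_value_ge_tangent[OF \<sigma> c, of "T - t" z] bdenom_claim_value[of t] t by simp
  moreover have "1 + \<sigma> * z < exp (\<sigma> * z)"
  proof -
    have p: "0 < \<sigma> * z" using \<sigma> xbd(2) by simp
    then have "1 + \<sigma> * z + (\<sigma> * z)\<^sup>2 / 2 \<le> exp (\<sigma> * z)" by (intro exp_lower_Taylor_quadratic) simp
    moreover have "0 < (\<sigma> * z)\<^sup>2 / 2" using p by (intro divide_pos_pos zero_less_power) auto
    ultimately show ?thesis by linarith
  qed
  ultimately have "bd * (bdenom t - exp (\<sigma> * z)) < ?V"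
    using mult_strict_left_mono[OF _ bd(1), of "bdenom t - exp (\<sigma> * z)" ?v] by linarith
  moreover have "bd * (bdenom t - exp (\<sigma> * z)) = K - x"
    unfolding xbd(1)[symmetric] using bd by (simp add: right_diff_distrib)
  ultimately show ?thesis by simp
qed

lemma value_eq_intrinsic_iff: "american_put_value M r K T t X = K - x \<longleftrightarrow> x \<le> bd"
  using value_stopping_region value_continuation_region by (cases "x \<le> bd") auto

end

theorem theorem3p1:
  fixes M :: "'a measure" and F :: "real \<Rightarrow> 'a measure" and W :: "real \<Rightarrow> 'a \<Rightarrow> real"
    and X :: "real \<Rightarrow> real \<Rightarrow> real \<Rightarrow> 'a \<Rightarrow> real"
    and K T \<sigma> \<delta> :: real and r b :: "real \<Rightarrow> real" and V :: "real \<Rightarrow> real \<Rightarrow> real"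
  assumes "0 < K" and "0 < T" and "0 < \<sigma>" and "0 \<le> \<delta>"
    and "prob_space M" and "brownian_motion M F W"
    and r: "\<And>t. t \<in> {0..<T} \<Longrightarrow> r t =
          std_normal_density (sqrt ((2 * \<delta> + \<sigma>\<^sup>2) * (T - t))) /
          (1 + 2 * \<sigma> / sqrt (2 * \<delta> + \<sigma>\<^sup>2) *
             (std_normal_cdf (sqrt ((2 * \<delta> + \<sigma>\<^sup>2) * (T - t))) - 1 / 2))
          * (\<sigma> / sqrt (T - t)) + \<delta> + \<sigma>\<^sup>2 / 2"
    and X: "\<And>t x. t \<in> {0..<T} \<Longrightarrow> 0 < x \<Longrightarrow>
          sde_solution M F W (\<lambda>s y. (r s - \<delta>) * y) (\<lambda>s y. \<sigma> * y) T t x (X t x)"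
    and V: "\<And>t x. t \<in> {0..<T} \<Longrightarrow> 0 < x \<Longrightarrow> V t x = american_put_value M r K T t (X t x)"
    and b: "\<And>t. t \<in> {0..<T} \<Longrightarrow> b t =
          K / (1 + 2 * \<sigma> / sqrt (2 * \<delta> + \<sigma>\<^sup>2) *
             (std_normal_cdf (sqrt ((2 * \<delta> + \<sigma>\<^sup>2) * (T - t))) - 1 / 2))"
  shows "optimal_exercise_boundary K T V b"
proof -
  interpret prob_space M by fact
  define c where "c = sqrt (2 * \<delta> + \<sigma>\<^sup>2)"
  have a: "0 < 2 * \<delta> + \<sigma>\<^sup>2" using \<open>0 < \<sigma>\<close> \<open>0 \<le> \<delta>\<close> by (intro add_nonneg_pos) auto
  have c_eq: "0 < c" "c\<^sup>2 = 2 * \<delta> + \<sigma>\<^sup>2" using a by (simp_all add: c_def)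
  have cs: "sqrt ((2 * \<delta> + \<sigma>\<^sup>2) * u) = c * sqrt u" for u by (simp add: c_def real_sqrt_mult)
  interpret boundary \<sigma> c T by unfold_locales fact+
  have b': "b t = K / bdenom t" if "t \<in> {0..<T}" for t
    using b[OF that] unfolding cs c_def[symmetric] bdenom_def .
  have r': "r t = drift t + c\<^sup>2 / 2" if "t \<in> {0..<T}" for t
    using r[OF that] unfolding cs c_def[symmetric] bdenom_def[symmetric] c_eq(2) drift_def
    by (simp add: add_divide_distrib mult.commute)
  have iff: "V t x = K - x \<longleftrightarrow> x \<le> b t" if "t \<in> {0..<T}" "0 < x" for t x
  proof -
    \<comment> \<open>The locale fixes one starting point and its price process, so it is
      interpreted anew for each pair \<open>(t, x)\<close>.\<close>
    interpret american_put M F W \<sigma> c T K \<delta> t x r "X t x"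
      using that X[OF that] r' c_eq \<open>0 < K\<close> \<open>0 \<le> \<delta>\<close> \<open>brownian_motion M F W\<close> by unfold_locales auto
    show ?thesis
      unfolding V[OF that] b'[OF that(1)] using value_eq_intrinsic_iff by (simp add: bd_def)
  qed
  have "0 < b t" if "t \<in> {0..<T}" for t
    unfolding b'[OF that] using bdenom_ge_1[of t] that \<open>0 < K\<close> by simp
  with iff show ?thesis
    by (auto simp: optimal_exercise_boundary_def exercise_region_def)
qed

end
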